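(* Let $G$ be an infinite, countable discrete, residually finite group with Kazhdan's property (T). Let $\mathbb{T}=\mathbb{R}/\mathbb{Z}$, let $X=\mathbb{T}^G/\{(\ldots,\theta,\theta,\ldots):\theta\in\mathbb{T}\}$ be the quotient of the compact group $\mathbb{T}^G$ by its diagonal subgroup, let $\mu$ be the Haar probability measure on $X$, and let $T$ be the action of $G$ on $X$ induced by the right-shift action on $\mathbb{T}^G$. Then $(X,\mu,T)$ is not a complemented factor of any Bernoulli shift over $G$.
   Context: A $G$-system $(X,\mu,T)$ is a standard probability space $(X,\mu)$ with a measurable $\mu$-preserving action $T$ of $G$. A factor map between $G$-systems is a measurable map, equivariant a.e., pushing the first measure to the second; it is an isomorphism if it is invertible modulo null sets. A factor map $\Phi:(X,\mu,T)\to(Y,\nu,S)$ is complemented if there is another factor map $\Psi:(X,\mu,T)\to(Z,\theta,R)$ such that $(\Phi,\Psi):(X,\mu,T)\to(Y\times Z,\nu\times\theta,S\times R)$ is a measure-theoretic isomorphism; in this case $(Y,\nu,S)$ is a complemented factor of $(X,\mu,T)$. The right-shift action on $\mathcal{X}^G$ is $(S^hx)_g=x_{gh}$. A Bernoulli shift over $G$ is a $G$-system $(\mathcal{X}^G,\nu^{\times G},S)$ with $(\mathcal{X},\nu)$ a standard probability space and $S$ the right-shift action. *)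

theory Defs
  imports "HOL-Probability.Probability" "HOL-Algebra.Algebra"
begin

section \<open>Residual finiteness\<close>

definition residually_finite :: "('g, 'm) monoid_scheme \<Rightarrow> bool" where
  "residually_finite G \<longleftrightarrow>
     (\<forall>g\<in>carrier G. g \<noteq> \<one>\<^bsub>G\<^esub> \<longrightarrow> (\<exists>N. N \<lhd> G \<and> finite (rcosets\<^bsub>G\<^esub> N) \<and> g \<notin> N))"


section \<open>Kazhdan's property (T)\<close>

definition complex_ring :: "complex ring" where
  "complex_ring = \<lparr>carrier = UNIV, monoid.mult = (*), one = 1, ring.zero = 0, ring.add = (+)\<rparr>"

lemma cring_complex_ring: "cring complex_ring"
proof (intro cringI abelian_groupI comm_monoidI)
  show "\<exists>y\<in>carrier complex_ring. y \<oplus>\<^bsub>complex_ring\<^esub> x = \<zero>\<^bsub>complex_ring\<^esub>" for x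
    by (auto simp: complex_ring_def intro: exI[of _ "- x"])
qed (auto simp: complex_ring_def algebra_simps)

text \<open>Complex Hilbert spaces are carrier-based, so that one can quantify over them inside a
  formula. The multiplication and unit of the record type of modules are unused.\<close>

definition hilbert_norm :: "('h \<Rightarrow> 'h \<Rightarrow> complex) \<Rightarrow> 'h \<Rightarrow> real" where
  "hilbert_norm ip v = sqrt (Re (ip v v))"

locale complex_hilbert_space = module complex_ring H
  for H :: "(complex, 'h) module" (structure) +
  fixes ip :: "'h \<Rightarrow> 'h \<Rightarrow> complex"
  assumes ip_add: "\<lbrakk>u \<in> carrier H; v \<in> carrier H; w \<in> carrier H\<rbrakk>
      \<Longrightarrow> ip (u \<oplus>\<^bsub>H\<^esub> v) w = ip u w + ip v w"
    and ip_smult: "\<lbrakk>v \<in> carrier H; w \<in> carrier H\<rbrakk> \<Longrightarrow> ip (c \<odot>\<^bsub>H\<^esub> v) w = c * ip v w"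
    and ip_cnj: "\<lbrakk>v \<in> carrier H; w \<in> carrier H\<rbrakk> \<Longrightarrow> ip w v = cnj (ip v w)"
    and ip_pos: "\<lbrakk>v \<in> carrier H; v \<noteq> \<zero>\<^bsub>H\<^esub>\<rbrakk> \<Longrightarrow> 0 < Re (ip v v)"
    and complete: "\<lbrakk>\<And>n. s n \<in> carrier H;
        \<And>e. 0 < e \<Longrightarrow> \<exists>k. \<forall>m\<ge>k. \<forall>n\<ge>k. hilbert_norm ip (s m \<ominus>\<^bsub>H\<^esub> s n) < e\<rbrakk>
      \<Longrightarrow> \<exists>l\<in>carrier H. (\<lambda>n::nat. hilbert_norm ip (s n \<ominus>\<^bsub>H\<^esub> l)) \<longlonglongrightarrow> 0"

definition unitary_operator ::
  "(complex, 'h) module \<Rightarrow> ('h \<Rightarrow> 'h \<Rightarrow> complex) \<Rightarrow> ('h \<Rightarrow> 'h) \<Rightarrow> bool" where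
  "unitary_operator H ip U \<longleftrightarrow>
     U ` carrier H = carrier H \<and>
     (\<forall>v\<in>carrier H. \<forall>w\<in>carrier H. U (v \<oplus>\<^bsub>H\<^esub> w) = U v \<oplus>\<^bsub>H\<^esub> U w) \<and>
     (\<forall>c. \<forall>v\<in>carrier H. U (c \<odot>\<^bsub>H\<^esub> v) = c \<odot>\<^bsub>H\<^esub> U v) \<and>
     (\<forall>v\<in>carrier H. \<forall>w\<in>carrier H. ip (U v) (U w) = ip v w)"

definition unitary_rep :: "('g, 'm) monoid_scheme \<Rightarrow> (complex, 'h) module \<Rightarrow>
    ('h \<Rightarrow> 'h \<Rightarrow> complex) \<Rightarrow> ('g \<Rightarrow> 'h \<Rightarrow> 'h) \<Rightarrow> bool" where
  "unitary_rep G H ip \<pi> \<longleftrightarrow>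
     complex_hilbert_space H ip \<and>
     (\<forall>g\<in>carrier G. unitary_operator H ip (\<pi> g)) \<and>
     (\<forall>v\<in>carrier H. \<pi> \<one>\<^bsub>G\<^esub> v = v) \<and>
     (\<forall>g\<in>carrier G. \<forall>h\<in>carrier G. \<forall>v\<in>carrier H. \<pi> (g \<otimes>\<^bsub>G\<^esub> h) v = \<pi> g (\<pi> h v))"

text \<open>Property (T) of a discrete group, tested on Hilbert spaces whose elements have type
  \<open>'h\<close>.\<close>

definition property_T_on :: "'h itself \<Rightarrow> ('g, 'm) monoid_scheme \<Rightarrow> bool" where
  "property_T_on _ G \<longleftrightarrow>
     (\<exists>Q \<epsilon>. finite Q \<and> Q \<subseteq> carrier G \<and> (0::real) < \<epsilon> \<and>
       (\<forall>(H :: (complex, 'h) module) ip \<pi>. unitary_rep G H ip \<pi> \<longrightarrow>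
          (\<exists>v\<in>carrier H. v \<noteq> \<zero>\<^bsub>H\<^esub> \<and>
             (\<forall>q\<in>Q. hilbert_norm ip (\<pi> q v \<ominus>\<^bsub>H\<^esub> v) < \<epsilon> * hilbert_norm ip v)) \<longrightarrow>
          (\<exists>v\<in>carrier H. v \<noteq> \<zero>\<^bsub>H\<^esub> \<and> (\<forall>g\<in>carrier G. \<pi> g v = v))))"

text \<open>HOL cannot quantify over all types \<open>'h\<close>, so the type is fixed to be large enough. Every
  separable Hilbert space is isomorphic to one with elements of type \<open>nat \<Rightarrow> complex\<close>. For
  countable \<open>G\<close> this loses nothing: an almost invariant vector of an arbitrary unitary
  representation lies in the separable subrepresentation that it generates.\<close>

definition property_T :: "('g, 'm) monoid_scheme \<Rightarrow> bool" where
  "property_T G \<longleftrightarrow> property_T_on TYPE(nat \<Rightarrow> complex) G"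


section \<open>Probability-preserving systems\<close>

definition borel_sets :: "'a topology \<Rightarrow> 'a set set" where
  "borel_sets \<T> = sigma_sets (topspace \<T>) {U. openin \<T> U}"

definition standard_prob_space :: "'a measure \<Rightarrow> bool" where
  "standard_prob_space M \<longleftrightarrow> prob_space M \<and>
     (\<exists>\<T>. completely_metrizable_space \<T> \<and> second_countable \<T> \<and>
          topspace \<T> = space M \<and> sets M = borel_sets \<T>)"

definition G_system :: "('g, 'm) monoid_scheme \<Rightarrow> 'x measure \<Rightarrow> ('g \<Rightarrow> 'x \<Rightarrow> 'x) \<Rightarrow> bool" where
  "G_system G M T \<longleftrightarrow> standard_prob_space M \<and>
     (\<forall>g\<in>carrier G. T g \<in> M \<rightarrow>\<^sub>M M \<and> distr M M (T g) = M) \<and>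
     (\<forall>x\<in>space M. T \<one>\<^bsub>G\<^esub> x = x) \<and>
     (\<forall>g\<in>carrier G. \<forall>h\<in>carrier G. \<forall>x\<in>space M. T (g \<otimes>\<^bsub>G\<^esub> h) x = T g (T h x))"

text \<open>In the definitions of factor maps below, the systems passed as arguments are meant to satisfy
  \<^const>\<open>G_system\<close>; this is not repeated in the definitions, so that denying
  \<open>complemented_factor\<close> cannot be true merely for want of it.\<close>

definition factor_map :: "('g, 'm) monoid_scheme \<Rightarrow> 'x measure \<Rightarrow> ('g \<Rightarrow> 'x \<Rightarrow> 'x) \<Rightarrow>
    'y measure \<Rightarrow> ('g \<Rightarrow> 'y \<Rightarrow> 'y) \<Rightarrow> ('x \<Rightarrow> 'y) \<Rightarrow> bool" where
  "factor_map G M T N S \<Phi> \<longleftrightarrow>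
     \<Phi> \<in> M \<rightarrow>\<^sub>M N \<and> distr M N \<Phi> = N \<and>
     (\<forall>g\<in>carrier G. AE x in M. \<Phi> (T g x) = S g (\<Phi> x))"

definition system_iso :: "('g, 'm) monoid_scheme \<Rightarrow> 'x measure \<Rightarrow> ('g \<Rightarrow> 'x \<Rightarrow> 'x) \<Rightarrow>
    'y measure \<Rightarrow> ('g \<Rightarrow> 'y \<Rightarrow> 'y) \<Rightarrow> ('x \<Rightarrow> 'y) \<Rightarrow> bool" where
  "system_iso G M T N S \<Phi> \<longleftrightarrow> factor_map G M T N S \<Phi> \<and>
     (\<exists>\<Phi>'. \<Phi>' \<in> N \<rightarrow>\<^sub>M M \<and> (AE x in M. \<Phi>' (\<Phi> x) = x) \<and> (AE y in N. \<Phi> (\<Phi>' y) = y))"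

text \<open>The argument of type \<open>'z itself\<close> names the type over which the complementary system
  \<open>(Z, \<theta>, R)\<close> ranges.\<close>

definition complemented_factor_map :: "'z itself \<Rightarrow> ('g, 'm) monoid_scheme \<Rightarrow>
    'x measure \<Rightarrow> ('g \<Rightarrow> 'x \<Rightarrow> 'x) \<Rightarrow> 'y measure \<Rightarrow> ('g \<Rightarrow> 'y \<Rightarrow> 'y) \<Rightarrow> ('x \<Rightarrow> 'y) \<Rightarrow> bool" where
  "complemented_factor_map _ G M T N S \<Phi> \<longleftrightarrow> factor_map G M T N S \<Phi> \<and>
     (\<exists>(\<theta> :: 'z measure) R \<Psi>. G_system G \<theta> R \<and> factor_map G M T \<theta> R \<Psi> \<and>
        system_iso G M T (N \<Otimes>\<^sub>M \<theta>) (\<lambda>g. map_prod (S g) (R g)) (\<lambda>x. (\<Phi> x, \<Psi> x)))"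

text \<open>The system \<open>(N, S)\<close> is a complemented factor of the system \<open>(M, T)\<close>.\<close>

definition complemented_factor :: "'z itself \<Rightarrow> ('g, 'm) monoid_scheme \<Rightarrow>
    'y measure \<Rightarrow> ('g \<Rightarrow> 'y \<Rightarrow> 'y) \<Rightarrow> 'x measure \<Rightarrow> ('g \<Rightarrow> 'x \<Rightarrow> 'x) \<Rightarrow> bool" where
  "complemented_factor Z G N S M T \<longleftrightarrow> (\<exists>\<Phi>. complemented_factor_map Z G M T N S \<Phi>)"

definition right_shift :: "('g, 'm) monoid_scheme \<Rightarrow> 'g \<Rightarrow> ('g \<Rightarrow> 'a) \<Rightarrow> 'g \<Rightarrow> 'a" where
  "right_shift G h x = (\<lambda>g\<in>carrier G. x (g \<otimes>\<^bsub>G\<^esub> h))"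

text \<open>The underlying probability space of the Bernoulli shift with base \<open>N\<close>; the action is
  \<^const>\<open>right_shift\<close>.\<close>

definition bernoulli_space :: "('g, 'm) monoid_scheme \<Rightarrow> 'a measure \<Rightarrow> ('g \<Rightarrow> 'a) measure" where
  "bernoulli_space G N = (\<Pi>\<^sub>M g\<in>carrier G. N)"


section \<open>The quotient of the torus by its diagonal\<close>

definition quotient_topology :: "'a topology \<Rightarrow> ('a \<Rightarrow> 'b) \<Rightarrow> 'b topology" where
  "quotient_topology \<T> f =
     topology (\<lambda>U. U \<subseteq> f ` topspace \<T> \<and> openin \<T> {x \<in> topspace \<T>. f x \<in> U})"

lemma openin_quotient_topology:
  "openin (quotient_topology \<T> f) U \<longleftrightarrow>
     U \<subseteq> f ` topspace \<T> \<and> openin \<T> {x \<in> topspace \<T>. f x \<in> U}"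
proof -
  let ?L = "\<lambda>U. U \<subseteq> f ` topspace \<T> \<and> openin \<T> {x \<in> topspace \<T>. f x \<in> U}"
  have "istopology ?L"
    unfolding istopology_def
  proof (intro conjI allI impI)
    fix S T assume "?L S" "?L T"
    moreover have "{x \<in> topspace \<T>. f x \<in> S \<inter> T} =
        {x \<in> topspace \<T>. f x \<in> S} \<inter> {x \<in> topspace \<T>. f x \<in> T}" by auto
    ultimately show "S \<inter> T \<subseteq> f ` topspace \<T>" "openin \<T> {x \<in> topspace \<T>. f x \<in> S \<inter> T}"
      by auto
  next
    fix K assume K: "\<forall>S\<in>K. ?L S"
    have "{x \<in> topspace \<T>. f x \<in> \<Union>K} = (\<Union>S\<in>K. {x \<in> topspace \<T>. f x \<in> S})" by auto
    with K show "\<Union>K \<subseteq> f ` topspace \<T>" "openin \<T> {x \<in> topspace \<T>. f x \<in> \<Union>K}"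
      by auto
  qed
  then show ?thesis
    by (simp add: quotient_topology_def)
qed

lemma topspace_quotient_topology: "topspace (quotient_topology \<T> f) = f ` topspace \<T>"
proof
  show "topspace (quotient_topology \<T> f) \<subseteq> f ` topspace \<T>"
    using openin_quotient_topology openin_topspace by metis
  have "{x \<in> topspace \<T>. f x \<in> f ` topspace \<T>} = topspace \<T>" by auto
  then have "openin (quotient_topology \<T> f) (f ` topspace \<T>)"
    by (simp add: openin_quotient_topology)
  then show "f ` topspace \<T> \<subseteq> topspace (quotient_topology \<T> f)"
    by (rule openin_subset)
qed

lemma quotient_map_quotient_topology: "quotient_map \<T> (quotient_topology \<T> f) f"
  by (auto simp: quotient_map_def topspace_quotient_topology openin_quotient_topology)

text \<open>Invariant regular Borel probability measures on a compact group; inner regularity follows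
  from outer regularity by taking complements.\<close>

definition haar_prob_measure :: "('a, 'm) monoid_scheme \<Rightarrow> 'a topology \<Rightarrow> 'a measure \<Rightarrow> bool" where
  "haar_prob_measure K \<T> M \<longleftrightarrow> prob_space M \<and> space M = carrier K \<and> sets M = borel_sets \<T> \<and>
     (\<forall>a\<in>carrier K. \<forall>A\<in>sets M. emeasure M (a <#\<^bsub>K\<^esub> A) = emeasure M A) \<and>
     (\<forall>A\<in>sets M. emeasure M A = (INF U\<in>{U. openin \<T> U \<and> A \<subseteq> U}. emeasure M U))"

definition real_group :: "real monoid" where
  "real_group = \<lparr>carrier = UNIV, monoid.mult = (+), one = 0\<rparr>"

definition circle_group :: "real set monoid" where
  "circle_group = real_group Mod \<int>"

definition circle_topology :: "real set topology" where
  "circle_topology = quotient_topology euclideanreal (\<lambda>t. \<int> #>\<^bsub>real_group\<^esub> t)"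

definition torus_group :: "('g, 'm) monoid_scheme \<Rightarrow> ('g \<Rightarrow> real set) monoid" where
  "torus_group G = product_group (carrier G) (\<lambda>_. circle_group)"

definition torus_topology :: "('g, 'm) monoid_scheme \<Rightarrow> ('g \<Rightarrow> real set) topology" where
  "torus_topology G = product_topology (\<lambda>_. circle_topology) (carrier G)"

definition torus_diagonal :: "('g, 'm) monoid_scheme \<Rightarrow> ('g \<Rightarrow> real set) set" where
  "torus_diagonal G = {(\<lambda>g\<in>carrier G. \<theta>) | \<theta>. \<theta> \<in> carrier circle_group}"

definition torus_quotient_group :: "('g, 'm) monoid_scheme \<Rightarrow> ('g \<Rightarrow> real set) set monoid" where
  "torus_quotient_group G = torus_group G Mod torus_diagonal G"

definition torus_quotient_topology :: "('g, 'm) monoid_scheme \<Rightarrow> ('g \<Rightarrow> real set) set topology" where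
  "torus_quotient_topology G =
     quotient_topology (torus_topology G) (\<lambda>x. torus_diagonal G #>\<^bsub>torus_group G\<^esub> x)"

text \<open>The right shift maps cosets of the diagonal onto cosets of the diagonal, so the induced
  action on the quotient is given by images.\<close>

definition torus_quotient_shift ::
  "('g, 'm) monoid_scheme \<Rightarrow> 'g \<Rightarrow> ('g \<Rightarrow> real set) set \<Rightarrow> ('g \<Rightarrow> real set) set" where
  "torus_quotient_shift G h C = right_shift G h ` C"

lemma torus_quotient_shift_coset:
  assumes "group G" "h \<in> carrier G"
  shows "torus_quotient_shift G h (torus_diagonal G #>\<^bsub>torus_group G\<^esub> x) =
         torus_diagonal G #>\<^bsub>torus_group G\<^esub> right_shift G h x"
proof -
  interpret group G by fact
  have "right_shift G h ((\<lambda>g\<in>carrier G. \<theta>) \<otimes>\<^bsub>torus_group G\<^esub> x) =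
        (\<lambda>g\<in>carrier G. \<theta>) \<otimes>\<^bsub>torus_group G\<^esub> right_shift G h x" for \<theta>
    using assms(2) by (auto simp: right_shift_def torus_group_def product_group_def fun_eq_iff)
  then show ?thesis
    by (simp add: torus_quotient_shift_def r_coset_def image_UN torus_diagonal_def Setcompr_eq_image)
qed

end

theory Submission
  imports Defs
begin

text \<open>
  The argument is Popa's deformation against rigidity. Write \<open>e(t) = exp(2 \<pi> i t)\<close>. On \<open>X\<close> the
  functions \<open>c_g([\<theta>]) = e(\<theta>_g - \<theta>_1)\<close> are well defined and form a cocycle with values in the unit
  circle. On \<open>\<T>^G\<close> this cocycle is the coboundary of \<open>e(\<theta>_1)\<close>, but that function changes sign
  when \<open>\<theta>\<close> is rotated by the constant \<open>1/2\<close>, so it does not descend to \<open>X\<close>. If \<open>X\<close> were a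
  complemented factor of the Bernoulli shift \<open>B\<close>, then \<open>B\<close> would be isomorphic to \<open>X \<times> Z\<close>, the
  cocycle would lift to a cocycle \<open>\<phi>\<close> on \<open>B\<close>, and property (T) gives a kind of triviality of
  \<open>\<phi>\<close> that contradicts this sign change.

  Rigidity. Let \<open>x\<close>, \<open>x'\<close> be independent points of \<open>B\<close>, and let \<open>b_t\<close> for \<open>0 \<le> t \<le> 1\<close> be the point
  that keeps the coordinate \<open>x_g\<close> if an independent uniform label \<open>u_g\<close> is at least \<open>t\<close>, and takes
  \<open>x'_g\<close> otherwise. Each \<open>b_t\<close> has the law of \<open>B\<close> and depends equivariantly on the data
  \<open>(x, x', u)\<close>, and \<open>b_0 = x\<close>, \<open>b_1 = x'\<close>. For \<open>s\<close> close to \<open>t\<close> the cocycle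
  \<open>\<phi>_g(b_s)\<close> times the conjugate of \<open>\<phi>_g(b_t)\<close> is close to 1 in square mean (\<open>twist_tendsto\<close>). So
  the constant 1 is almost invariant in the Koopman representation twisted by it, property (T) gives a
  nonzero invariant vector (\<open>property_T_twisted\<close>), and this vector vanishes almost nowhere because the
  space of the \<open>(x, x', u)\<close> is mixing. Multiplying these vectors along
  \<open>0 = t_0 < \<dots> < t_n = 1\<close> telescopes: there is a function \<open>\<Xi>\<close>, almost nowhere zero, whose
  multiplicative coboundary is \<open>\<phi>_g(x)\<close> times the conjugate of \<open>\<phi>_g(x')\<close>
  (\<open>cocycle_difference_coboundary\<close>).

  Contradiction. Pull \<open>\<Xi>\<close> back along \<open>((\<theta>, z), (\<theta>', z'), u) \<mapsto> (x, x', u)\<close>, where \<open>x\<close> corresponds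
  to \<open>([\<theta>], z)\<close> and \<open>x'\<close> to \<open>([\<theta>'], z')\<close>. The product of \<open>e(\<theta>_1 - \<theta>'_1)\<close> with the conjugate of
  the pullback is \<open>G\<close>-invariant. It changes sign under the rotation of \<open>\<theta>\<close> by \<open>1/2\<close>, since this
  rotation does not change \<open>[\<theta>]\<close>. Both cannot hold on a mixing space
  (\<open>no_odd_invariant_function\<close>). The space in question is mixing because \<open>\<T>^G\<close> and the space of
  labels are Bernoulli and \<open>Z\<close> is a factor of \<open>B\<close>. Complementedness enters here: it is what makes the
  extension of \<open>B\<close> by \<open>\<theta>\<close> a product \<open>\<T>^G \<times> Z\<close>. That \<open>\<theta> \<mapsto> [\<theta>]\<close> carries the product measure
  to \<open>\<mu>\<close> is the uniqueness of Haar measure (\<open>torus_lift_preserves\<close>).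
\<close>

section \<open>Measure-preserving maps and mixing actions\<close>

definition preserves :: "'x measure \<Rightarrow> 'y measure \<Rightarrow> ('x \<Rightarrow> 'y) \<Rightarrow> bool" where
  "preserves M N f \<longleftrightarrow> f \<in> M \<rightarrow>\<^sub>M N \<and> distr M N f = N"

lemma preservesD:
  assumes "preserves M N f"
  shows "f \<in> M \<rightarrow>\<^sub>M N" "distr M N f = N" "x \<in> space M \<Longrightarrow> f x \<in> space N"
  using assms by (auto simp: preserves_def dest: measurable_space)

lemma preserves_AE:
  assumes "preserves M N f" "AE y in N. P y"
  shows "AE x in M. P (f x)"
  using assms AE_distrD[of f M N P] unfolding preserves_def by metis

lemma preserves_measure:
  assumes "preserves M N f" "A \<in> sets N"
  shows "measure M (f -` A \<inter> space M) = measure N A"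
  using assms measure_distr[of f M N A] by (auto simp: preserves_def)

lemma preserves_integral:
  fixes h :: "_ \<Rightarrow> _::{banach, second_countable_topology}"
  assumes "preserves M N f" "h \<in> borel_measurable N"
  shows "integral\<^sup>L M (\<lambda>x. h (f x)) = integral\<^sup>L N h"
  using assms integral_distr[of f M N h] by (auto simp: preserves_def)

lemma preserves_integrable:
  fixes h :: "_ \<Rightarrow> _::{banach, second_countable_topology}"
  assumes "preserves M N f" "h \<in> borel_measurable N"
  shows "integrable M (\<lambda>x. h (f x)) \<longleftrightarrow> integrable N h"
  using assms integrable_distr_eq[of f M N h] by (auto simp: preserves_def)

lemma preserves_comp:
  assumes "preserves M N f" "preserves N L g"
  shows "preserves M L (\<lambda>x. g (f x))"
  using assms distr_distr[of g N L f M] by (auto simp: preserves_def comp_def)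

lemma preserves_id: "preserves M M (\<lambda>x. x)"
  by (simp add: preserves_def distr_id2)

lemma preserves_map_prod:
  assumes "preserves M M' f" "preserves N N' g" "prob_space N'"
  shows "preserves (M \<Otimes>\<^sub>M N) (M' \<Otimes>\<^sub>M N') (map_prod f g)"
proof -
  have [measurable]: "f \<in> M \<rightarrow>\<^sub>M M'" "g \<in> N \<rightarrow>\<^sub>M N'"
    using assms by (auto simp: preserves_def)
  have "distr M M' f \<Otimes>\<^sub>M distr N N' g = distr (M \<Otimes>\<^sub>M N) (M' \<Otimes>\<^sub>M N') (\<lambda>(x, y). (f x, g y))"
    using assms by (intro pair_measure_distr) (auto simp: preserves_def prob_space_imp_sigma_finite)
  then show ?thesis
    using assms by (auto simp: preserves_def map_prod_def)
qed

lemma preserves_fst: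
  assumes "prob_space N"
  shows "preserves (M \<Otimes>\<^sub>M N) M fst"
proof -
  interpret prob_space N by fact
  have "distr (M \<Otimes>\<^sub>M N) M fst = M"
  proof (rule measure_eqI)
    fix A assume "A \<in> sets (distr (M \<Otimes>\<^sub>M N) M fst)"
    then have A: "A \<in> sets M" by simp
    then have "fst -` A \<inter> space (M \<Otimes>\<^sub>M N) = A \<times> space N"
      by (auto simp: space_pair_measure dest: sets.sets_into_space)
    then show "emeasure (distr (M \<Otimes>\<^sub>M N) M fst) A = emeasure M A"
      using A by (simp add: emeasure_distr emeasure_pair_measure_Times emeasure_space_1)
  qed simp
  then show ?thesis by (simp add: preserves_def)
qed

lemma preserves_snd:
  assumes "prob_space M" "prob_space N"
  shows "preserves (M \<Otimes>\<^sub>M N) N snd"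
proof -
  interpret M: prob_space M by fact
  interpret N: prob_space N by fact
  have "distr (M \<Otimes>\<^sub>M N) N snd = N"
  proof (rule measure_eqI)
    fix A assume "A \<in> sets (distr (M \<Otimes>\<^sub>M N) N snd)"
    then have A: "A \<in> sets N" by simp
    then have "snd -` A \<inter> space (M \<Otimes>\<^sub>M N) = space M \<times> A"
      by (auto simp: space_pair_measure dest: sets.sets_into_space)
    then show "emeasure (distr (M \<Otimes>\<^sub>M N) N snd) A = emeasure N A"
      using A by (simp add: emeasure_distr N.emeasure_pair_measure_Times M.emeasure_space_1)
  qed simp
  then show ?thesis by (simp add: preserves_def)
qed

text \<open>The filter of neighbourhoods of infinity of the discrete space \<open>G\<close>. Limits along it express
  mixing, and the algebra of limits then does the bookkeeping of exceptional finite sets.\<close>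

definition group_infinity :: "('g, 'm) monoid_scheme \<Rightarrow> 'g filter" where
  "group_infinity G = inf cofinite (principal (carrier G))"

lemma eventually_group_infinity:
  "eventually P (group_infinity G) \<longleftrightarrow> finite {g \<in> carrier G. \<not> P g}"
  by (simp add: group_infinity_def eventually_inf_principal eventually_cofinite)

lemma group_infinity_neq_bot: "infinite (carrier G) \<Longrightarrow> group_infinity G \<noteq> bot"
  by (simp add: trivial_limit_def eventually_group_infinity)

definition mixing :: "('g, 'm) monoid_scheme \<Rightarrow> 'x measure \<Rightarrow> ('g \<Rightarrow> 'x \<Rightarrow> 'x) \<Rightarrow> bool" where
  "mixing G M T \<longleftrightarrow> (\<forall>A\<in>sets M. \<forall>B\<in>sets M.
     ((\<lambda>g. measure M (A \<inter> T g -` B)) \<longlongrightarrow> measure M A * measure M B) (group_infinity G))"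

text \<open>The pairs \<open>(A, B)\<close> that mix are closed under complements and countable disjoint unions in each
  argument, by Tannery's theorem: the terms of the series are dominated, uniformly in \<open>g\<close>, by the
  measures of the summands. So Dynkin's theorem can be applied first to \<open>B\<close> and then to \<open>A\<close>.\<close>

lemma mixing_from_generator:
  fixes G :: "('g, 'm) monoid_scheme"
  assumes inf: "infinite (carrier G)"
    and M: "prob_space M" and T: "\<And>g. g \<in> carrier G \<Longrightarrow> preserves M M (T g)"
    and E: "Int_stable E" "E \<subseteq> Pow (space M)" "sets M = sigma_sets (space M) E"
    and basic: "\<And>A B. A \<in> E \<Longrightarrow> B \<in> E \<Longrightarrow>
      ((\<lambda>g. measure M (A \<inter> T g -` B)) \<longlongrightarrow> measure M A * measure M B) (group_infinity G)"
  shows "mixing G M T"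
proof -
  interpret prob_space M by fact
  let ?F = "group_infinity G"
  let ?P = "\<lambda>A B. ((\<lambda>g. measure M (A \<inter> T g -` B)) \<longlongrightarrow> measure M A * measure M B) ?F"
  have F: "?F \<noteq> bot" using inf by (rule group_infinity_neq_bot)
  have ev: "eventually (\<lambda>g. g \<in> carrier G) ?F"
    by (simp add: eventually_group_infinity)
  have meas: "A \<inter> T g -` B \<in> sets M" if "A \<in> sets M" "B \<in> sets M" "g \<in> carrier G" for A B g
  proof -
    have "A \<inter> T g -` B = A \<inter> (T g -` B \<inter> space M)"
      using that sets.sets_into_space by auto
    also have "\<dots> \<in> sets M"
      using that T[of g] by (intro sets.Int measurable_sets[of "T g" M M]) (auto simp: preserves_def)
    finally show ?thesis .
  qed
  have le: "measure M (A \<inter> T g -` B) \<le> measure M B" if "A \<in> sets M" "B \<in> sets M" "g \<in> carrier G" for A B g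
  proof -
    have "measure M (A \<inter> T g -` B) \<le> measure M (T g -` B \<inter> space M)"
      using that sets.sets_into_space T[of g]
      by (intro finite_measure_mono measurable_sets[of "T g" M M]) (auto simp: preserves_def)
    also have "\<dots> = measure M B" using that T by (intro preserves_measure)
    finally show ?thesis .
  qed
  have sumlim: "((\<lambda>g. measure M (\<Union>i. C i g)) \<longlongrightarrow> a * suminf b) ?F"
    if "\<And>i. ((\<lambda>g. measure M (C i g)) \<longlongrightarrow> a * b i) ?F"
       "\<And>i g. g \<in> carrier G \<Longrightarrow> C i g \<in> sets M" "\<And>g. disjoint_family (\<lambda>i. C i g)"
       "\<And>i g. g \<in> carrier G \<Longrightarrow> measure M (C i g) \<le> bnd i" "summable bnd" "summable b"
    for C :: "nat \<Rightarrow> 'g \<Rightarrow> 'a set" and a :: real and b bnd :: "nat \<Rightarrow> real"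
  proof -
    have "((\<lambda>g. suminf (\<lambda>i. measure M (C i g))) \<longlongrightarrow> suminf (\<lambda>i. a * b i)) ?F"
    proof (rule conjunct2[OF conjunct2[OF tannerys_theorem[where M = bnd]]])
      have "eventually (\<lambda>(k, g). g \<in> carrier G) (at_top \<times>\<^sub>F ?F)"
        using eventually_prodI[OF _ ev, of "\<lambda>_. True" at_top] by (simp add: case_prod_unfold)
      then show "eventually (\<lambda>(k, g). norm (measure M (C k g)) \<le> bnd k) (at_top \<times>\<^sub>F ?F)"
        by eventually_elim (use that in auto)
    qed (use that F in auto)
    moreover have "eventually (\<lambda>g. suminf (\<lambda>i. measure M (C i g)) = measure M (\<Union>i. C i g)) ?F"
      using ev
    proof eventually_elim
      case (elim g)
      then show ?case
        using that by (intro sums_unique[symmetric] finite_measure_UNION) auto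
    qed
    ultimately have "((\<lambda>g. measure M (\<Union>i. C i g)) \<longlongrightarrow> suminf (\<lambda>i. a * b i)) ?F"
      by (rule Lim_transform_eventually)
    then show ?thesis using that by (simp add: suminf_mult)
  qed
  have 1: "?P A B" if A: "A \<in> E" and B: "B \<in> sets M" for A B
    using E(1,2) B[unfolded E(3)]
  proof (induction rule: sigma_sets_induct_disjoint)
    case (basic B)
    then show ?case using A assms(7) by auto
  next
    case empty
    show ?case by simp
  next
    case (compl B)
    have A': "A \<in> sets M" using A E by auto
    have B': "B \<in> sets M" using compl E by auto
    have "((\<lambda>g. measure M A - measure M (A \<inter> T g -` B)) \<longlongrightarrow> measure M A - measure M A * measure M B) ?F"
      by (intro tendsto_diff tendsto_const compl)
    moreover have "eventually (\<lambda>g. measure M A - measure M (A \<inter> T g -` B)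
        = measure M (A \<inter> T g -` (space M - B))) ?F"
      using ev
    proof eventually_elim
      case (elim g)
      have "A \<inter> T g -` (space M - B) = A - (A \<inter> T g -` B)"
        using preservesD(3)[OF T[OF elim]] sets.sets_into_space[OF A'] by auto
      then show ?case
        using A' meas[OF A' B' elim] by (simp add: finite_measure_Diff)
    qed
    ultimately show ?case
      using B' by (simp add: prob_compl algebra_simps Lim_transform_eventually)
  next
    case (union B)
    have A': "A \<in> sets M" using A E by auto
    have B': "\<And>i. B i \<in> sets M" using union E by auto
    have sums: "(\<lambda>i. measure M (B i)) sums measure M (\<Union>i. B i)"
      using union B' by (intro finite_measure_UNION) auto
    have "((\<lambda>g. measure M (\<Union>i. A \<inter> T g -` B i)) \<longlongrightarrow> measure M A * suminf (\<lambda>i. measure M (B i))) ?F"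
      using union(1,3) A' B' meas le sums
      by (intro sumlim[of _ _ _ "\<lambda>i. measure M (B i)"]) (auto simp: disjoint_family_on_def sums_iff)
    moreover have "(\<Union>i. A \<inter> T g -` B i) = A \<inter> T g -` (\<Union>i. B i)" for g by auto
    ultimately show ?case using sums by (simp add: sums_iff)
  qed
  have 2: "?P A B" if A: "A \<in> sets M" and B: "B \<in> sets M" for A B
    using E(1,2) A[unfolded E(3)]
  proof (induction rule: sigma_sets_induct_disjoint)
    case (basic A)
    then show ?case using B 1 by auto
  next
    case empty
    show ?case by simp
  next
    case (compl A)
    have A': "A \<in> sets M" using compl E by auto
    have "((\<lambda>g. measure M B - measure M (A \<inter> T g -` B)) \<longlongrightarrow> measure M B - measure M A * measure M B) ?F"
      by (intro tendsto_diff tendsto_const compl)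
    moreover have "eventually (\<lambda>g. measure M B - measure M (A \<inter> T g -` B)
        = measure M ((space M - A) \<inter> T g -` B)) ?F"
      using ev
    proof eventually_elim
      case (elim g)
      have "(space M - A) \<inter> T g -` B = (T g -` B \<inter> space M) - (A \<inter> T g -` B)"
        using sets.sets_into_space[OF A'] by auto
      moreover have sub: "A \<inter> T g -` B \<subseteq> T g -` B \<inter> space M"
        using sets.sets_into_space[OF A'] by auto
      moreover have "T g -` B \<inter> space M \<in> sets M"
        using T[OF elim] B by (intro measurable_sets[of "T g" M M]) (auto simp: preserves_def)
      ultimately show ?case
        using meas[OF A' B elim] preserves_measure[OF T[OF elim] B] sub by (simp add: finite_measure_Diff)
    qed
    ultimately show ?case
      using A' by (simp add: prob_compl algebra_simps Lim_transform_eventually)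
  next
    case (union A)
    have A': "\<And>i. A i \<in> sets M" using union E by auto
    have sums: "(\<lambda>i. measure M (A i)) sums measure M (\<Union>i. A i)"
      using union A' by (intro finite_measure_UNION) auto
    have "((\<lambda>g. measure M (\<Union>i. A i \<inter> T g -` B)) \<longlongrightarrow> measure M B * suminf (\<lambda>i. measure M (A i))) ?F"
      using union(1,3) A' B meas sums
      by (intro sumlim[of _ _ _ "\<lambda>i. measure M (A i)"])
         (auto simp: disjoint_family_on_def sums_iff mult.commute intro!: finite_measure_mono)
    moreover have "(\<Union>i. A i \<inter> T g -` B) = (\<Union>i. A i) \<inter> T g -` B" for g by auto
    ultimately show ?case using sums by (simp add: sums_iff mult.commute)
  qed
  then show ?thesis by (simp add: mixing_def)
qed

lemma mixing_factor:
  assumes mix: "mixing G M T" and f: "preserves M N f"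
    and T: "\<And>g. g \<in> carrier G \<Longrightarrow> preserves M M (T g)"
    and S: "\<And>g. g \<in> carrier G \<Longrightarrow> preserves N N (S g)"
    and eq: "\<And>g. g \<in> carrier G \<Longrightarrow> AE x in M. f (T g x) = S g (f x)"
  shows "mixing G N S"
  unfolding mixing_def
proof (intro ballI)
  fix A B assume AB: "A \<in> sets N" "B \<in> sets N"
  let ?A = "f -` A \<inter> space M" and ?B = "f -` B \<inter> space M"
  have sets: "?A \<in> sets M" "?B \<in> sets M"
    using f AB by (auto simp: preserves_def)
  have "eventually (\<lambda>g. g \<in> carrier G) (group_infinity G)"
    by (simp add: eventually_group_infinity)
  then have "eventually (\<lambda>g. measure M (?A \<inter> T g -` ?B) = measure N (A \<inter> S g -` B)) (group_infinity G)"
  proof eventually_elim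
    case (elim g)
    have *: "A \<inter> S g -` B \<in> sets N"
    proof -
      have "A \<inter> S g -` B = A \<inter> (S g -` B \<inter> space N)" using AB sets.sets_into_space by auto
      also have "\<dots> \<in> sets N"
        using AB S[OF elim] by (intro sets.Int measurable_sets[of "S g" N N]) (auto simp: preserves_def)
      finally show ?thesis .
    qed
    have **: "?A \<inter> T g -` ?B \<in> sets M"
    proof -
      have "?A \<inter> T g -` ?B = ?A \<inter> (T g -` ?B \<inter> space M)" by auto
      also have "\<dots> \<in> sets M"
        using measurable_sets[OF preservesD(1)[OF T[OF elim]] sets(2)] sets(1) by blast
      finally show ?thesis .
    qed
    have "measure N (A \<inter> S g -` B) = measure M (f -` (A \<inter> S g -` B) \<inter> space M)"
      using preserves_measure[OF f *] by simp
    also have "\<dots> = measure M (?A \<inter> T g -` ?B)"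
    proof (rule measure_eq_AE)
      show "AE x in M. (x \<in> f -` (A \<inter> S g -` B) \<inter> space M) = (x \<in> ?A \<inter> T g -` ?B)"
        using eq[OF elim] AE_space
        by eventually_elim (use preservesD(3)[OF T[OF elim]] in auto)
      show "f -` (A \<inter> S g -` B) \<inter> space M \<in> sets M"
        using measurable_sets[OF preservesD(1)[OF f] *] .
      show "?A \<inter> T g -` ?B \<in> sets M" by (rule **)
    qed
    finally show ?case by simp
  qed
  moreover have "((\<lambda>g. measure M (?A \<inter> T g -` ?B)) \<longlongrightarrow> measure M ?A * measure M ?B) (group_infinity G)"
    using mix[unfolded mixing_def] sets by blast
  ultimately show "((\<lambda>g. measure N (A \<inter> S g -` B)) \<longlongrightarrow> measure N A * measure N B) (group_infinity G)"
    using preserves_measure[OF f] AB by (simp add: Lim_transform_eventually)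
qed

lemma mixing_pair:
  assumes inf: "infinite (carrier G)"
    and M: "prob_space M" "\<And>g. g \<in> carrier G \<Longrightarrow> preserves M M (T g)" "mixing G M T"
    and N: "prob_space N" "\<And>g. g \<in> carrier G \<Longrightarrow> preserves N N (S g)" "mixing G N S"
  shows "mixing G (M \<Otimes>\<^sub>M N) (\<lambda>g. map_prod (T g) (S g))"
proof (rule mixing_from_generator[OF inf _ _ Int_stable_pair_measure_generator])
  interpret M: prob_space M by fact
  interpret N: prob_space N by fact
  interpret pair_prob_space M N ..
  show "prob_space (M \<Otimes>\<^sub>M N)" by (rule prob_space_axioms)
  show "preserves (M \<Otimes>\<^sub>M N) (M \<Otimes>\<^sub>M N) (map_prod (T g) (S g))" if "g \<in> carrier G" for g
    using that M N by (intro preserves_map_prod) auto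
  let ?E = "{a \<times> b |a b. a \<in> sets M \<and> b \<in> sets N}"
  show "?E \<subseteq> Pow (space (M \<Otimes>\<^sub>M N))"
    by (auto simp: space_pair_measure dest: sets.sets_into_space)
  show "sets (M \<Otimes>\<^sub>M N) = sigma_sets (space (M \<Otimes>\<^sub>M N)) ?E"
    by (simp add: sets_pair_measure space_pair_measure)
  have times: "measure (M \<Otimes>\<^sub>M N) (A \<times> B) = measure M A * measure N B" if "A \<in> sets M" "B \<in> sets N" for A B
    using that by (simp add: measure_def N.emeasure_pair_measure_Times enn2real_mult)
  fix A B assume "A \<in> ?E" "B \<in> ?E"
  then obtain a b c d where AB: "A = a \<times> b" "B = c \<times> d"
    and s: "a \<in> sets M" "b \<in> sets N" "c \<in> sets M" "d \<in> sets N" by auto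
  have "((\<lambda>g. measure M (a \<inter> T g -` c) * measure N (b \<inter> S g -` d)) \<longlongrightarrow>
      (measure M a * measure M c) * (measure N b * measure N d)) (group_infinity G)"
    using M(3) N(3) s by (intro tendsto_mult) (auto simp: mixing_def)
  moreover have "eventually (\<lambda>g. g \<in> carrier G) (group_infinity G)"
    by (simp add: eventually_group_infinity)
  then have "eventually (\<lambda>g. measure M (a \<inter> T g -` c) * measure N (b \<inter> S g -` d) =
      measure (M \<Otimes>\<^sub>M N) (A \<inter> map_prod (T g) (S g) -` B)) (group_infinity G)"
  proof eventually_elim
    case (elim g)
    have "A \<inter> map_prod (T g) (S g) -` B = (a \<inter> (T g -` c \<inter> space M)) \<times> (b \<inter> (S g -` d \<inter> space N))"
      using s AB by (auto dest: sets.sets_into_space)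
    moreover have "a \<inter> (T g -` c \<inter> space M) = a \<inter> T g -` c" "b \<inter> (S g -` d \<inter> space N) = b \<inter> S g -` d"
      using s by (auto dest: sets.sets_into_space)
    moreover have "T g -` c \<inter> space M \<in> sets M" "S g -` d \<inter> space N \<in> sets N"
      using s M(2)[OF elim] N(2)[OF elim] by (auto simp: preserves_def)
    ultimately show ?case using s times by (metis sets.Int)
  qed
  ultimately have "((\<lambda>g. measure (M \<Otimes>\<^sub>M N) (A \<inter> map_prod (T g) (S g) -` B)) \<longlongrightarrow>
      (measure M a * measure M c) * (measure N b * measure N d)) (group_infinity G)"
    by (rule Lim_transform_eventually)
  then show "((\<lambda>g. measure (M \<Otimes>\<^sub>M N) (A \<inter> map_prod (T g) (S g) -` B)) \<longlongrightarrow>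
      measure (M \<Otimes>\<^sub>M N) A * measure (M \<Otimes>\<^sub>M N) B) (group_infinity G)"
    using s AB times by (simp add: ac_simps)
qed

text \<open>An invariant set is asymptotically independent of itself.\<close>

lemma mixing_zero_one:
  assumes inf: "infinite (carrier G)" and mix: "mixing G M T"
    and A: "A \<in> sets M" and inv: "\<And>g. g \<in> carrier G \<Longrightarrow> AE x in M. T g x \<in> A \<longleftrightarrow> x \<in> A"
    and T: "\<And>g. g \<in> carrier G \<Longrightarrow> preserves M M (T g)"
  shows "measure M A = 0 \<or> measure M A = 1"
proof -
  have "eventually (\<lambda>g. g \<in> carrier G) (group_infinity G)"
    by (simp add: eventually_group_infinity)
  then have "eventually (\<lambda>g. measure M (A \<inter> T g -` A) = measure M A) (group_infinity G)"
  proof eventually_elim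
    case (elim g)
    have "A \<inter> T g -` A = A \<inter> (T g -` A \<inter> space M)" using A sets.sets_into_space by auto
    also have "\<dots> \<in> sets M"
      using A T[OF elim] by (intro sets.Int measurable_sets[of "T g" M M]) (auto simp: preserves_def)
    finally show ?case
      using inv[OF elim] A by (intro measure_eq_AE) auto
  qed
  then have "((\<lambda>g. measure M A) \<longlongrightarrow> measure M A * measure M A) (group_infinity G)"
    using mix A by (auto simp: mixing_def intro: Lim_transform_eventually)
  then have "measure M A = measure M A * measure M A"
    using group_infinity_neq_bot[OF inf] tendsto_const_iff by blast
  then show ?thesis by simp
qed

section \<open>Bernoulli shifts\<close>

lemma right_shift_preserves:
  assumes "group G" "prob_space P" "h \<in> carrier G"
  shows "preserves (PiM (carrier G) (\<lambda>_. P)) (PiM (carrier G) (\<lambda>_. P)) (right_shift G h)"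
proof -
  interpret group G by fact
  have "distr (PiM (carrier G) (\<lambda>_. P)) (PiM (carrier G) (\<lambda>_. P)) (\<lambda>\<omega>. \<lambda>n\<in>carrier G. \<omega> (n \<otimes>\<^bsub>G\<^esub> h)) =
      PiM (carrier G) (\<lambda>_. P)"
    using assms by (intro distr_PiM_reindex) (auto simp: inj_on_def)
  moreover have "(\<lambda>\<omega>. \<lambda>n\<in>carrier G. \<omega> (n \<otimes>\<^bsub>G\<^esub> h)) \<in> PiM (carrier G) (\<lambda>_. P) \<rightarrow>\<^sub>M PiM (carrier G) (\<lambda>_. P)"
    using assms by (intro measurable_restrict measurable_component_singleton) auto
  ultimately show ?thesis by (simp add: preserves_def right_shift_def[abs_def])
qed

text \<open>Two cylinder sets become exactly independent once a translation has made their finite sets of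
  coordinates disjoint, which fails for finitely many translations only.\<close>

lemma right_shift_mixing:
  assumes G: "group G" "infinite (carrier G)" and P: "prob_space P"
  shows "mixing G (PiM (carrier G) (\<lambda>_. P)) (right_shift G)"
proof (rule mixing_from_generator[OF G(2) _ _ Int_stable_prod_algebra])
  interpret group G by fact
  interpret P: prob_space P by fact
  let ?I = "carrier G"
  interpret PP: product_prob_space "\<lambda>_. P" ?I ..
  let ?M = "PiM ?I (\<lambda>_. P)"
  show "prob_space ?M" by (rule PP.prob_space_axioms)
  show "preserves ?M ?M (right_shift G g)" if "g \<in> carrier G" for g
    using that G P by (intro right_shift_preserves)
  show "prod_algebra ?I (\<lambda>_. P) \<subseteq> Pow (space ?M)"
    using prod_algebra_sets_into_space[of ?I "\<lambda>_. P"] by (simp add: space_PiM)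
  show "sets ?M = sigma_sets (space ?M) (prod_algebra ?I (\<lambda>_. P))"
    by (simp add: sets_PiM space_PiM)
  fix A B assume "A \<in> prod_algebra ?I (\<lambda>_. P)" "B \<in> prod_algebra ?I (\<lambda>_. P)"
  then obtain J E K F where A: "A = prod_emb ?I (\<lambda>_. P) J (\<Pi>\<^sub>E j\<in>J. E j)"
    and J: "finite J" "J \<subseteq> ?I" "\<And>i. i \<in> J \<Longrightarrow> E i \<in> sets P"
    and B: "B = prod_emb ?I (\<lambda>_. P) K (\<Pi>\<^sub>E j\<in>K. F j)"
    and K: "finite K" "K \<subseteq> ?I" "\<And>i. i \<in> K \<Longrightarrow> F i \<in> sets P"
    by (metis prod_algebraE)
  have fin: "finite {g \<in> carrier G. \<not> J \<inter> (\<lambda>k. k \<otimes>\<^bsub>G\<^esub> g) ` K = {}}"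
  proof (rule finite_subset)
    show "{g \<in> carrier G. \<not> J \<inter> (\<lambda>k. k \<otimes>\<^bsub>G\<^esub> g) ` K = {}} \<subseteq> (\<lambda>(j, k). inv\<^bsub>G\<^esub> k \<otimes>\<^bsub>G\<^esub> j) ` (J \<times> K)"
    proof
      fix g assume "g \<in> {g \<in> carrier G. \<not> J \<inter> (\<lambda>k. k \<otimes>\<^bsub>G\<^esub> g) ` K = {}}"
      then obtain k where "g \<in> carrier G" "k \<in> K" "k \<otimes>\<^bsub>G\<^esub> g \<in> J" by auto
      then show "g \<in> (\<lambda>(j, k). inv\<^bsub>G\<^esub> k \<otimes>\<^bsub>G\<^esub> j) ` (J \<times> K)"
        using K(2) by (intro image_eqI[of _ _ "(k \<otimes>\<^bsub>G\<^esub> g, k)"]) (auto simp: m_assoc[symmetric])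
    qed
  qed (use J K in auto)
  have "eventually (\<lambda>g. measure ?M (A \<inter> right_shift G g -` B) = measure ?M A * measure ?M B) (group_infinity G)"
    unfolding eventually_group_infinity
  proof (rule finite_subset[OF _ fin], safe, rule ccontr)
    fix g assume g: "g \<in> carrier G" "J \<inter> (\<lambda>k. k \<otimes>\<^bsub>G\<^esub> g) ` K = {}"
      and neq: "measure ?M (A \<inter> right_shift G g -` B) \<noteq> measure ?M A * measure ?M B"
    let ?K = "(\<lambda>k. k \<otimes>\<^bsub>G\<^esub> g) ` K"
    let ?H = "\<lambda>i. if i \<in> J then E i else F (i \<otimes>\<^bsub>G\<^esub> inv\<^bsub>G\<^esub> g)"
    have cancel: "k \<otimes>\<^bsub>G\<^esub> g \<otimes>\<^bsub>G\<^esub> inv\<^bsub>G\<^esub> g = k" if "k \<in> K" for k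
      using that K(2) g by (auto simp: m_assoc)
    have inj: "inj_on (\<lambda>k. k \<otimes>\<^bsub>G\<^esub> g) K" by (rule inj_on_inverseI[of _ "\<lambda>k. k \<otimes>\<^bsub>G\<^esub> inv\<^bsub>G\<^esub> g"]) (rule cancel)
    have notJ: "k \<otimes>\<^bsub>G\<^esub> g \<notin> J" if "k \<in> K" for k using that g by auto
    have "A \<inter> right_shift G g -` B = prod_emb ?I (\<lambda>_. P) (J \<union> ?K) (Pi\<^sub>E (J \<union> ?K) ?H)"
      using J(2) K(2) g notJ cancel
      unfolding A B prod_emb_def space_PiM
      by (auto simp: PiE_iff right_shift_def subset_eq extensional_def ball_Un)
    moreover have "J \<union> ?K \<subseteq> ?I" using J K g by auto
    ultimately have "measure ?M (A \<inter> right_shift G g -` B) = (\<Prod>i\<in>J \<union> ?K. measure P (?H i))"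
      using J K g cancel notJ by (auto intro!: PP.measure_PiM_emb)
    also have "\<dots> = (\<Prod>i\<in>J. measure P (?H i)) * (\<Prod>i\<in>?K. measure P (?H i))"
      using J K g by (intro prod.union_disjoint) auto
    also have "(\<Prod>i\<in>?K. measure P (?H i)) = (\<Prod>i\<in>K. measure P (F i))"
      using inj cancel notJ by (subst prod.reindex) (auto intro!: prod.cong)
    also have "(\<Prod>i\<in>J. measure P (?H i)) * \<dots> = measure ?M A * measure ?M B"
      using J K unfolding A B by (simp add: PP.measure_PiM_emb)
    finally show False using neq by simp
  qed
  then show "((\<lambda>g. measure ?M (A \<inter> right_shift G g -` B)) \<longlongrightarrow> measure ?M A * measure ?M B) (group_infinity G)"
    by (rule tendsto_eventually)
qed

section \<open>Square-integrable functions\<close>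

text \<open>Square-integrable functions are not identified when they agree almost everywhere. Quotients are
  avoided until the Hilbert space of the representation is built, where functions are replaced by
  coefficient sequences.\<close>

definition L2 :: "'x measure \<Rightarrow> ('x \<Rightarrow> complex) set" where
  "L2 M = {f \<in> borel_measurable M. integrable M (\<lambda>x. (cmod (f x))\<^sup>2)}"

definition l2_ip :: "'x measure \<Rightarrow> ('x \<Rightarrow> complex) \<Rightarrow> ('x \<Rightarrow> complex) \<Rightarrow> complex" where
  "l2_ip M f g = integral\<^sup>L M (\<lambda>x. f x * cnj (g x))"

definition l2_sq :: "'x measure \<Rightarrow> ('x \<Rightarrow> complex) \<Rightarrow> real" where
  "l2_sq M f = integral\<^sup>L M (\<lambda>x. (cmod (f x))\<^sup>2)"

lemma borel_measurable_cnj [measurable (raw)]: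
  "f \<in> borel_measurable M \<Longrightarrow> (\<lambda>x. cnj (f x)) \<in> borel_measurable M"
  by (rule borel_measurable_continuous_on[where f = cnj]) (auto intro: continuous_intros)

lemma L2_measurable: "f \<in> L2 M \<Longrightarrow> f \<in> borel_measurable M"
  by (simp add: L2_def)

lemma L2_prod_integrable:
  assumes "f \<in> L2 M" "g \<in> L2 M"
  shows "integrable M (\<lambda>x. f x * cnj (g x))"
proof (rule Bochner_Integration.integrable_bound)
  show "integrable M (\<lambda>x. (cmod (f x))\<^sup>2 + (cmod (g x))\<^sup>2)"
    using assms by (auto simp: L2_def)
  show "(\<lambda>x. f x * cnj (g x)) \<in> borel_measurable M"
    using assms by (auto simp: L2_def)
  have "norm (f x * cnj (g x)) \<le> (cmod (f x))\<^sup>2 + (cmod (g x))\<^sup>2" for x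
    using sum_squares_bound[of "cmod (f x)" "cmod (g x)"]
      mult_nonneg_nonneg[OF norm_ge_zero norm_ge_zero, of "f x" "g x"]
    unfolding norm_mult complex_mod_cnj by linarith
  then show "AE x in M. norm (f x * cnj (g x)) \<le> norm ((cmod (f x))\<^sup>2 + (cmod (g x))\<^sup>2)"
    by simp
qed

lemma L2_add:
  assumes "f \<in> L2 M" "g \<in> L2 M"
  shows "(\<lambda>x. f x + g x) \<in> L2 M"
proof -
  have "integrable M (\<lambda>x. (cmod (f x + g x))\<^sup>2)"
  proof (rule Bochner_Integration.integrable_bound)
    show "integrable M (\<lambda>x. 2 * (cmod (f x))\<^sup>2 + 2 * (cmod (g x))\<^sup>2)"
      using assms by (auto simp: L2_def)
    have "(cmod (f x + g x))\<^sup>2 \<le> 2 * (cmod (f x))\<^sup>2 + 2 * (cmod (g x))\<^sup>2" for x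
    proof -
      have "(cmod (f x + g x))\<^sup>2 \<le> (cmod (f x) + cmod (g x))\<^sup>2"
        by (intro power_mono norm_triangle_ineq) auto
      also have "\<dots> \<le> 2 * (cmod (f x))\<^sup>2 + 2 * (cmod (g x))\<^sup>2"
        using sum_squares_bound[of "cmod (f x)" "cmod (g x)"] by (simp add: power2_sum)
      finally show ?thesis .
    qed
    then show "AE x in M. norm ((cmod (f x + g x))\<^sup>2) \<le> norm (2 * (cmod (f x))\<^sup>2 + 2 * (cmod (g x))\<^sup>2)"
      by simp
  qed (use assms in \<open>auto simp: L2_def\<close>)
  then show ?thesis using assms by (auto simp: L2_def)
qed

lemma L2_scale: "f \<in> L2 M \<Longrightarrow> (\<lambda>x. c * f x) \<in> L2 M"
  by (auto simp: L2_def norm_mult power_mult_distrib)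

lemma L2_diff:
  assumes "f \<in> L2 M" "g \<in> L2 M"
  shows "(\<lambda>x. f x - g x) \<in> L2 M"
  using L2_add[OF assms(1) L2_scale[OF assms(2), of "-1"]] by simp

lemma L2_zero: "(\<lambda>x. 0) \<in> L2 M"
  by (simp add: L2_def)

lemma L2_bounded:
  assumes "prob_space M" "f \<in> borel_measurable M" "\<And>x. cmod (f x) \<le> c"
  shows "f \<in> L2 M"
proof -
  interpret prob_space M by fact
  have "integrable M (\<lambda>x. (cmod (f x))\<^sup>2)"
    using assms by (intro integrable_const_bound[of _ "c\<^sup>2"]) (auto intro!: power_mono)
  then show ?thesis using assms by (simp add: L2_def)
qed

lemma l2_ip_add:
  assumes "f \<in> L2 M" "g \<in> L2 M" "h \<in> L2 M"
  shows "l2_ip M (\<lambda>x. f x + g x) h = l2_ip M f h + l2_ip M g h"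
  using assms L2_prod_integrable[of _ M h]
  by (simp add: l2_ip_def distrib_right)

lemma l2_ip_diff:
  assumes "f \<in> L2 M" "g \<in> L2 M" "h \<in> L2 M"
  shows "l2_ip M (\<lambda>x. f x - g x) h = l2_ip M f h - l2_ip M g h"
  using assms L2_prod_integrable[of _ M h]
  by (simp add: l2_ip_def left_diff_distrib)

lemma l2_ip_scale: "l2_ip M (\<lambda>x. c * f x) h = c * l2_ip M f h"
  by (simp add: l2_ip_def mult.assoc)

lemma l2_ip_cnj: "l2_ip M g f = cnj (l2_ip M f g)"
  unfolding l2_ip_def by (subst Bochner_Integration.integral_cnj[symmetric]) (simp add: mult.commute)

lemma l2_ip_self: "l2_ip M f f = of_real (l2_sq M f)"
  unfolding l2_ip_def l2_sq_def integral_complex_of_real[symmetric]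
  by (simp only: complex_norm_square)

lemma l2_sq_nonneg: "l2_sq M f \<ge> 0"
  by (simp add: l2_sq_def)

lemma l2_ip_cong_AE:
  assumes "AE x in M. f x = f' x" "AE x in M. g x = g' x"
    "f \<in> borel_measurable M" "f' \<in> borel_measurable M" "g \<in> borel_measurable M" "g' \<in> borel_measurable M"
  shows "l2_ip M f g = l2_ip M f' g'"
  unfolding l2_ip_def
proof (rule integral_cong_AE)
  show "AE x in M. f x * cnj (g x) = f' x * cnj (g' x)"
    using assms(1,2) by eventually_elim simp
qed (use assms in auto)

lemma l2_sq_eq_0:
  assumes "f \<in> L2 M"
  shows "l2_sq M f = 0 \<longleftrightarrow> (AE x in M. f x = 0)"
  using assms unfolding l2_sq_def by (subst integral_nonneg_eq_0_iff_AE) (auto simp: L2_def)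

lemma l2_Cauchy_Schwarz:
  assumes f: "f \<in> L2 M" and g: "g \<in> L2 M"
  shows "(cmod (l2_ip M f g))\<^sup>2 \<le> l2_sq M f * l2_sq M g"
proof -
  have [measurable]: "f \<in> borel_measurable M" "g \<in> borel_measurable M"
    using f g by (auto simp: L2_def)
  have "ennreal (cmod (l2_ip M f g)) \<le> (\<integral>\<^sup>+x. ennreal (cmod (f x)) * ennreal (cmod (g x)) \<partial>M)"
  proof -
    have "cmod (l2_ip M f g) \<le> (LINT x|M. norm (f x * cnj (g x)))"
      unfolding l2_ip_def by (rule integral_norm_bound)
    then have "ennreal (cmod (l2_ip M f g)) \<le> ennreal (LINT x|M. norm (f x * cnj (g x)))"
      by (rule ennreal_leI)
    also have "\<dots> = (\<integral>\<^sup>+x. norm (f x * cnj (g x)) \<partial>M)"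
      using L2_prod_integrable[OF f g] by (intro nn_integral_eq_integral[symmetric]) auto
    finally show ?thesis by (simp add: norm_mult ennreal_mult)
  qed
  then have "(ennreal (cmod (l2_ip M f g)))\<^sup>2 \<le> (\<integral>\<^sup>+x. ennreal (cmod (f x)) * ennreal (cmod (g x)) \<partial>M)\<^sup>2"
    by (intro power_mono) auto
  also have "\<dots> \<le> (\<integral>\<^sup>+x. (ennreal (cmod (f x)))\<^sup>2 \<partial>M) * (\<integral>\<^sup>+x. (ennreal (cmod (g x)))\<^sup>2 \<partial>M)"
    by (rule Cauchy_Schwarz_nn_integral) auto
  also have "(\<integral>\<^sup>+x. (ennreal (cmod (f x)))\<^sup>2 \<partial>M) = ennreal (l2_sq M f)"
    using f unfolding l2_sq_def by (subst nn_integral_eq_integral[symmetric]) (auto simp: L2_def ennreal_power)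
  also have "(\<integral>\<^sup>+x. (ennreal (cmod (g x)))\<^sup>2 \<partial>M) = ennreal (l2_sq M g)"
    using g unfolding l2_sq_def by (subst nn_integral_eq_integral[symmetric]) (auto simp: L2_def ennreal_power)
  finally show ?thesis
    by (simp add: ennreal_power ennreal_mult[symmetric] l2_sq_nonneg)
qed

text \<open>The theorem of Riesz and Fischer: a Cauchy sequence in mean square is Cauchy in mean, hence has a
  subsequence that converges almost everywhere, and Fatou's lemma bounds the distance to its limit.\<close>

lemma L2_complete:
  assumes M: "prob_space M" and s: "\<And>n. s n \<in> L2 M"
    and Cauchy: "\<And>e. 0 < e \<Longrightarrow> \<exists>k. \<forall>m\<ge>k. \<forall>n\<ge>k. l2_sq M (\<lambda>x. s m x - s n x) < e"
  obtains l where "l \<in> L2 M" "(\<lambda>n::nat. l2_sq M (\<lambda>x. s n x - l x)) \<longlonglongrightarrow> 0"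
proof -
  interpret prob_space M by fact
  have [measurable]: "s n \<in> borel_measurable M" for n using s[of n] by (simp add: L2_def)
  have sq_int: "integrable M (\<lambda>x. (cmod (s m x - s n x))\<^sup>2)" for m n
    using L2_diff[OF s s] by (simp add: L2_def)
  have int: "integrable M (s n)" for n
    using L2_prod_integrable[OF s[of n], of "\<lambda>_. 1"] by (simp add: L2_def)
  have "\<exists>N. \<forall>i\<ge>N. \<forall>j\<ge>N. (LINT x|M. norm (s i x - s j x)) < e" if e: "e > 0" for e
  proof -
    obtain k where k: "l2_sq M (\<lambda>x. s m x - s n x) < e\<^sup>2" if "m \<ge> k" "n \<ge> k" for m n
      using Cauchy[of "e\<^sup>2"] e by auto
    have "(LINT x|M. norm (s i x - s j x)) < e" if "i \<ge> k" "j \<ge> k" for i j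
    proof -
      have "norm z \<le> (e + (cmod z)\<^sup>2 / e) / 2" for z
        using sum_squares_bound[of e "cmod z"] e by (simp add: field_simps power2_eq_square)
      then have "(LINT x|M. norm (s i x - s j x)) \<le> (LINT x|M. (e + (cmod (s i x - s j x))\<^sup>2 / e) / 2)"
        using sq_int[of i j] int by (intro integral_mono) auto
      also have "\<dots> = (e + l2_sq M (\<lambda>x. s i x - s j x) / e) / 2"
        using sq_int[of i j] by (simp add: l2_sq_def prob_space)
      also have "\<dots> < (e + e\<^sup>2 / e) / 2"
        using k[OF that] e by (simp add: divide_strict_right_mono)
      finally show ?thesis using e by (simp add: power2_eq_square)
    qed
    then show ?thesis by blast
  qed
  then obtain r where r: "strict_mono r" "AE x in M. Cauchy (\<lambda>i. s (r i) x)"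
    using cauchy_L1_AE_cauchy_subseq[of M s, OF int] by blast
  define l where "l x = lim (\<lambda>i. s (r i) x)" for x
  have l_meas [measurable]: "l \<in> borel_measurable M"
    unfolding l_def by measurable
  have lim: "AE x in M. (\<lambda>i. s (r i) x) \<longlonglongrightarrow> l x"
    using r(2) by eventually_elim (simp add: l_def Cauchy_convergent_iff convergent_LIMSEQ_iff)
  have bound: "(\<lambda>x. s n x - l x) \<in> L2 M \<and> l2_sq M (\<lambda>x. s n x - l x) \<le> e"
    if e: "e > 0" and k: "\<And>m n. m \<ge> k \<Longrightarrow> n \<ge> k \<Longrightarrow> l2_sq M (\<lambda>x. s m x - s n x) < e" and n: "n \<ge> k" for e k n
  proof -
    have "(\<integral>\<^sup>+x. ennreal ((cmod (s n x - l x))\<^sup>2) \<partial>M) =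
        (\<integral>\<^sup>+x. liminf (\<lambda>i. ennreal ((cmod (s n x - s (r i) x))\<^sup>2)) \<partial>M)"
    proof (rule nn_integral_cong_AE)
      show "AE x in M. ennreal ((cmod (s n x - l x))\<^sup>2) = liminf (\<lambda>i. ennreal ((cmod (s n x - s (r i) x))\<^sup>2))"
        using lim
        by eventually_elim (intro lim_imp_Liminf[symmetric] tendsto_intros; simp)
    qed
    also have "\<dots> \<le> liminf (\<lambda>i. \<integral>\<^sup>+x. ennreal ((cmod (s n x - s (r i) x))\<^sup>2) \<partial>M)"
      by (rule nn_integral_liminf) auto
    also have "\<dots> \<le> ennreal e"
    proof (rule Liminf_le)
      show "\<forall>\<^sub>F i in sequentially. (\<integral>\<^sup>+x. ennreal ((cmod (s n x - s (r i) x))\<^sup>2) \<partial>M) \<le> ennreal e"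
        using eventually_ge_at_top[of k]
      proof eventually_elim
        case (elim i)
        then have "r i \<ge> k" using r(1) strict_mono_imp_increasing le_trans by blast
        then have "l2_sq M (\<lambda>x. s n x - s (r i) x) \<le> e" using k[OF n] by (simp add: less_imp_le)
        then show ?case
          using sq_int by (subst nn_integral_eq_integral) (auto simp: l2_sq_def ennreal_leI)
      qed
    qed simp
    finally have le: "(\<integral>\<^sup>+x. ennreal ((cmod (s n x - l x))\<^sup>2) \<partial>M) \<le> ennreal e" .
    then have int: "integrable M (\<lambda>x. (cmod (s n x - l x))\<^sup>2)"
      by (intro integrableI_bounded) (auto simp: le_less_trans)
    then have "ennreal (l2_sq M (\<lambda>x. s n x - l x)) \<le> ennreal e"
      using le unfolding l2_sq_def by (subst (asm) nn_integral_eq_integral) auto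
    then show ?thesis using int e by (simp add: L2_def)
  qed
  obtain k where "\<forall>m\<ge>k. \<forall>n\<ge>k. l2_sq M (\<lambda>x. s m x - s n x) < 1"
    using Cauchy[of 1] by auto
  then have "(\<lambda>x. s k x - l x) \<in> L2 M" using bound[of 1 k k] by auto
  from L2_diff[OF s[of k] this] have "l \<in> L2 M" by simp
  moreover have "(\<lambda>n. l2_sq M (\<lambda>x. s n x - l x)) \<longlonglongrightarrow> 0"
  proof (rule LIMSEQ_I)
    fix e :: real assume "e > 0"
    then obtain k where "\<forall>m\<ge>k. \<forall>n\<ge>k. l2_sq M (\<lambda>x. s m x - s n x) < e / 2"
      using Cauchy[of "e / 2"] by auto
    then have "l2_sq M (\<lambda>x. s n x - l x) < e" if "n \<ge> k" for n
      using bound[of "e / 2" k n] that \<open>e > 0\<close> by (auto intro: le_less_trans[of _ "e / 2"])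
    then show "\<exists>no. \<forall>n\<ge>no. norm (l2_sq M (\<lambda>x. s n x - l x) - 0) < e"
      using l2_sq_nonneg[of M] by (intro exI[of _ k]) auto
  qed
  ultimately show thesis by (rule that)
qed

section \<open>Unitary representations twisted by a cocycle\<close>

text \<open>A measure-preserving action with a circle-valued cocycle \<open>w\<close>. The cocycle identity is required
  almost everywhere only, as it is inherited from a factor map that is equivariant almost everywhere.\<close>

locale twisted_action = group G + prob_space M
  for G :: "('g, 'm) monoid_scheme" and M :: "'x measure" +
  fixes T :: "'g \<Rightarrow> 'x \<Rightarrow> 'x" and w :: "'g \<Rightarrow> 'x \<Rightarrow> complex"
  assumes countable_carrier: "countable (carrier G)"
    and T_preserves: "g \<in> carrier G \<Longrightarrow> preserves M M (T g)"
    and T_mult: "\<lbrakk>g \<in> carrier G; h \<in> carrier G; x \<in> space M\<rbrakk> \<Longrightarrow> T (g \<otimes>\<^bsub>G\<^esub> h) x = T g (T h x)"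
    and T_one: "x \<in> space M \<Longrightarrow> T \<one>\<^bsub>G\<^esub> x = x"
    and w_measurable: "g \<in> carrier G \<Longrightarrow> w g \<in> borel_measurable M"
    and w_norm: "cmod (w g x) = 1"
    and w_cocycle: "\<lbrakk>g \<in> carrier G; h \<in> carrier G\<rbrakk> \<Longrightarrow>
      AE x in M. w (g \<otimes>\<^bsub>G\<^esub> h) x = w g (T h x) * w h x"
begin

lemma T_measurable: "g \<in> carrier G \<Longrightarrow> T g \<in> M \<rightarrow>\<^sub>M M"
  using T_preserves by (auto simp: preserves_def)

lemma w_cancel: "w g x * cnj (w g x) = 1" "cnj (w g x) * w g x = 1"
  using complex_norm_square[of "w g x"] by (auto simp: w_norm mult.commute)

lemma w_one: "AE x in M. w \<one>\<^bsub>G\<^esub> x = 1"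
proof -
  have "AE x in M. w \<one>\<^bsub>G\<^esub> x = w \<one>\<^bsub>G\<^esub> (T \<one>\<^bsub>G\<^esub> x) * w \<one>\<^bsub>G\<^esub> x"
    using w_cocycle[of "\<one>\<^bsub>G\<^esub>" "\<one>\<^bsub>G\<^esub>"] by simp
  with AE_space show ?thesis
  proof eventually_elim
    case (elim x)
    then have "w \<one>\<^bsub>G\<^esub> x \<noteq> 0" using w_norm[of "\<one>\<^bsub>G\<^esub>" x] by auto
    with elim T_one show ?case by simp
  qed
qed

text \<open>As \<open>act (k l)\<close> is \<open>act l\<close> after \<open>act k\<close>, the unitary representation is \<open>g \<mapsto> act (inv g)\<close>. A
  function that it fixes satisfies \<open>f (T g x) = w g x * f x\<close>.\<close>

definition act :: "'g \<Rightarrow> ('x \<Rightarrow> complex) \<Rightarrow> 'x \<Rightarrow> complex" where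
  "act k f x = cnj (w k x) * f (T k x)"

lemma act_measurable:
  assumes k: "k \<in> carrier G" and f: "f \<in> borel_measurable M"
  shows "act k f \<in> borel_measurable M"
proof -
  have "(\<lambda>x. f (T k x)) \<in> borel_measurable M"
    using f T_measurable[OF k] by (rule measurable_compose[rotated])
  then show ?thesis using w_measurable[OF k] unfolding act_def by measurable
qed

lemma act_L2:
  assumes k: "k \<in> carrier G" and f: "f \<in> L2 M"
  shows "act k f \<in> L2 M"
proof -
  have "integrable M (\<lambda>x. (cmod (f (T k x)))\<^sup>2)"
    using preserves_integrable[OF T_preserves[OF k], of "\<lambda>x. (cmod (f x))\<^sup>2"] f by (auto simp: L2_def)
  then show ?thesis
    using act_measurable[OF k L2_measurable[OF f]] by (simp add: L2_def act_def norm_mult w_norm)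
qed

lemma act_ip:
  assumes k: "k \<in> carrier G" and f: "f \<in> L2 M" and g: "g \<in> L2 M"
  shows "l2_ip M (act k f) (act k g) = l2_ip M f g"
proof -
  have "act k f x * cnj (act k g x) = f (T k x) * cnj (g (T k x))" for x
    using w_cancel[of k x] by (simp add: act_def algebra_simps)
  then have "l2_ip M (act k f) (act k g) = integral\<^sup>L M (\<lambda>x. f (T k x) * cnj (g (T k x)))"
    by (simp add: l2_ip_def)
  also have "\<dots> = l2_ip M f g"
    using f g unfolding l2_ip_def
    by (intro preserves_integral[OF T_preserves[OF k], of "\<lambda>x. f x * cnj (g x)"]) (auto simp: L2_def)
  finally show ?thesis .
qed

lemma act_cong:
  assumes "k \<in> carrier G" "AE x in M. f x = f' x"
  shows "AE x in M. act k f x = act k f' x"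
  using preserves_AE[OF T_preserves[OF assms(1)] assms(2)] by eventually_elim (simp add: act_def)

lemma act_act:
  assumes "k \<in> carrier G" "l \<in> carrier G"
  shows "AE x in M. act (k \<otimes>\<^bsub>G\<^esub> l) f x = act l (act k f) x"
  using w_cocycle[OF assms] AE_space
  by eventually_elim (simp add: act_def T_mult[OF assms])

lemma act_one: "AE x in M. act \<one>\<^bsub>G\<^esub> f x = f x"
  using w_one AE_space by eventually_elim (simp add: act_def T_one)

lemma act_inv:
  assumes "k \<in> carrier G"
  shows "AE x in M. act k (act (inv\<^bsub>G\<^esub> k) f) x = f x"
  using act_act[of "inv\<^bsub>G\<^esub> k" k f] act_one[of f] assms by auto

text \<open>The orbit of the constant function 1 under the representation.\<close>

definition orbit :: "'g \<Rightarrow> 'x \<Rightarrow> complex" where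
  "orbit g x = cnj (w g x)"

lemma orbit_L2: "g \<in> carrier G \<Longrightarrow> orbit g \<in> L2 M"
  using w_measurable[of g] unfolding orbit_def[abs_def]
  by (intro L2_bounded[of _ _ 1]) (auto simp: w_norm prob_space_axioms)

lemma act_orbit:
  assumes "k \<in> carrier G" "g \<in> carrier G"
  shows "AE x in M. act k (orbit g) x = orbit (g \<otimes>\<^bsub>G\<^esub> k) x"
  using w_cocycle[OF assms(2,1)] by eventually_elim (simp add: act_def orbit_def mult.commute)

definition perp :: "('x \<Rightarrow> complex) set" where
  "perp = {h \<in> L2 M. \<forall>g\<in>carrier G. l2_ip M h (orbit g) = 0}"

text \<open>The closed span of the orbit of 1, described as a double orthogonal complement. In this form it is
  visibly invariant and closed, and an element of it that is orthogonal to the orbit is orthogonal to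
  itself (\<open>coef_inj\<close>).\<close>

definition cyc :: "('x \<Rightarrow> complex) set" where
  "cyc = {f \<in> L2 M. \<forall>h\<in>perp. l2_ip M f h = 0}"

lemma cyc_L2: "f \<in> cyc \<Longrightarrow> f \<in> L2 M"
  by (simp add: cyc_def)

lemma act_perp:
  assumes "k \<in> carrier G" "h \<in> perp"
  shows "act k h \<in> perp"
proof -
  have h: "h \<in> L2 M" using assms by (simp add: perp_def)
  have "l2_ip M (act k h) (orbit g) = 0" if g: "g \<in> carrier G" for g
  proof -
    have "AE x in M. act k (orbit (g \<otimes>\<^bsub>G\<^esub> inv\<^bsub>G\<^esub> k)) x = orbit g x"
      using act_orbit[of k "g \<otimes>\<^bsub>G\<^esub> inv\<^bsub>G\<^esub> k"] assms g by (simp add: m_assoc)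
    then have "l2_ip M (act k h) (orbit g) = l2_ip M (act k h) (act k (orbit (g \<otimes>\<^bsub>G\<^esub> inv\<^bsub>G\<^esub> k)))"
      using act_L2[OF assms(1)] h orbit_L2 assms(1) g
      by (intro l2_ip_cong_AE) (auto intro: L2_measurable)
    also have "\<dots> = l2_ip M h (orbit (g \<otimes>\<^bsub>G\<^esub> inv\<^bsub>G\<^esub> k))"
      using assms g h orbit_L2 by (intro act_ip) auto
    also have "\<dots> = 0" using assms g by (simp add: perp_def)
    finally show ?thesis .
  qed
  then show ?thesis using act_L2[OF assms(1) h] by (simp add: perp_def)
qed

lemma act_cyc:
  assumes "k \<in> carrier G" "f \<in> cyc"
  shows "act k f \<in> cyc"
proof -
  have f: "f \<in> L2 M" using assms by (simp add: cyc_def)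
  have "l2_ip M (act k f) h = 0" if h: "h \<in> perp" for h
  proof -
    have h': "h \<in> L2 M" "act (inv\<^bsub>G\<^esub> k) h \<in> perp" "act (inv\<^bsub>G\<^esub> k) h \<in> L2 M"
      using h act_perp assms(1) by (auto simp: perp_def)
    have "l2_ip M (act k f) h = l2_ip M (act k f) (act k (act (inv\<^bsub>G\<^esub> k) h))"
      using act_inv[OF assms(1), of h] act_L2 assms(1) f h'
      by (intro l2_ip_cong_AE) (auto intro: L2_measurable)
    also have "\<dots> = l2_ip M f (act (inv\<^bsub>G\<^esub> k) h)"
      using assms f h' by (intro act_ip)
    also have "\<dots> = 0" using assms(2) h' by (simp add: cyc_def)
    finally show ?thesis .
  qed
  then show ?thesis using act_L2[OF assms(1) f] by (simp add: cyc_def)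
qed

lemma perp_L2: "h \<in> perp \<Longrightarrow> h \<in> L2 M"
  by (simp add: perp_def)

lemma cyc_add: "f \<in> cyc \<Longrightarrow> g \<in> cyc \<Longrightarrow> (\<lambda>x. f x + g x) \<in> cyc"
  by (auto simp: cyc_def L2_add l2_ip_add perp_L2)

lemma cyc_diff: "f \<in> cyc \<Longrightarrow> g \<in> cyc \<Longrightarrow> (\<lambda>x. f x - g x) \<in> cyc"
  by (auto simp: cyc_def L2_diff l2_ip_diff perp_L2)

lemma cyc_scale: "f \<in> cyc \<Longrightarrow> (\<lambda>x. c * f x) \<in> cyc"
  by (auto simp: cyc_def L2_scale l2_ip_scale)

lemma cyc_zero: "(\<lambda>x. 0) \<in> cyc"
  by (simp add: cyc_def L2_zero l2_ip_def)

lemma one_L2: "(\<lambda>x. 1) \<in> L2 M"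
  by (intro L2_bounded[of _ _ 1]) (auto simp: prob_space_axioms)

lemma cyc_one: "(\<lambda>x. 1) \<in> cyc"
proof -
  have "l2_ip M (\<lambda>x. 1) h = 0" if "h \<in> perp" for h
  proof -
    have "AE x in M. orbit \<one>\<^bsub>G\<^esub> x = 1" using w_one by eventually_elim (simp add: orbit_def)
    then have "l2_ip M h (\<lambda>x. 1) = l2_ip M h (orbit \<one>\<^bsub>G\<^esub>)"
      using orbit_L2[of "\<one>\<^bsub>G\<^esub>"] perp_L2[OF that]
      by (intro l2_ip_cong_AE) (auto intro: L2_measurable)
    also have "\<dots> = 0" using that by (simp add: perp_def)
    finally show ?thesis by (subst l2_ip_cnj) simp
  qed
  then show ?thesis using one_L2 by (simp add: cyc_def)
qed

lemma cyc_closed: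
  assumes s: "\<And>n. s n \<in> cyc" and l: "l \<in> L2 M"
    and lim: "(\<lambda>n::nat. l2_sq M (\<lambda>x. s n x - l x)) \<longlonglongrightarrow> 0"
  shows "l \<in> cyc"
proof -
  have "l2_ip M l h = 0" if h: "h \<in> perp" for h
  proof -
    have "(cmod (l2_ip M l h))\<^sup>2 \<le> l2_sq M (\<lambda>x. s n x - l x) * l2_sq M h" for n
    proof -
      have "l2_ip M (\<lambda>x. s n x - l x) h = - l2_ip M l h"
        using s[of n] h l by (simp add: l2_ip_diff cyc_def perp_def)
      then show ?thesis
        using l2_Cauchy_Schwarz[of "\<lambda>x. s n x - l x" M h] L2_diff[OF cyc_L2[OF s] l, of n] perp_L2[OF h] by simp
    qed
    moreover have "(\<lambda>n. l2_sq M (\<lambda>x. s n x - l x) * l2_sq M h) \<longlonglongrightarrow> 0"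
      using tendsto_mult_left_zero[OF lim] .
    ultimately have "(cmod (l2_ip M l h))\<^sup>2 \<le> 0"
      by (intro LIMSEQ_le_const[of _ 0]) auto
    then show ?thesis by simp
  qed
  then show ?thesis using l by (simp add: cyc_def)
qed

text \<open>Property (T) is available for Hilbert spaces of sequences. An element of the cyclic subspace is
  determined almost everywhere by its inner products with the countably many members of the orbit,
  so these inner products serve as the elements of the Hilbert space. The vector space
  operations become pointwise.\<close>

definition coef :: "('x \<Rightarrow> complex) \<Rightarrow> nat \<Rightarrow> complex" where
  "coef f n = l2_ip M f (orbit (from_nat_into (carrier G) n))"

lemma orbit_enum_L2: "orbit (from_nat_into (carrier G) n) \<in> L2 M"
  by (intro orbit_L2 from_nat_into) auto

lemma coef_add: "f \<in> cyc \<Longrightarrow> g \<in> cyc \<Longrightarrow> coef (\<lambda>x. f x + g x) = (\<lambda>n. coef f n + coef g n)"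
  by (auto simp: coef_def fun_eq_iff l2_ip_add cyc_L2 orbit_enum_L2)

lemma coef_diff: "f \<in> cyc \<Longrightarrow> g \<in> cyc \<Longrightarrow> coef (\<lambda>x. f x - g x) = (\<lambda>n. coef f n - coef g n)"
  by (auto simp: coef_def fun_eq_iff l2_ip_diff cyc_L2 orbit_enum_L2)

lemma coef_scale: "coef (\<lambda>x. c * f x) = (\<lambda>n. c * coef f n)"
  by (auto simp: coef_def fun_eq_iff l2_ip_scale)

lemma coef_zero: "coef (\<lambda>x. 0) = (\<lambda>n. 0)"
  by (auto simp: coef_def fun_eq_iff l2_ip_def)

lemma coef_cong:
  assumes "AE x in M. f x = f' x" "f \<in> cyc" "f' \<in> cyc"
  shows "coef f = coef f'"
  using assms orbit_enum_L2 unfolding coef_def fun_eq_iff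
  by (intro allI l2_ip_cong_AE) (auto intro: L2_measurable cyc_L2)

lemma coef_inj:
  assumes "f \<in> cyc" "f' \<in> cyc" "coef f = coef f'"
  shows "AE x in M. f x = f' x"
proof -
  let ?d = "\<lambda>x. f x - f' x"
  have d: "?d \<in> cyc" using assms by (intro cyc_diff)
  have "l2_ip M ?d (orbit g) = 0" if g: "g \<in> carrier G" for g
  proof -
    obtain n where "from_nat_into (carrier G) n = g"
      using from_nat_into_surj[OF countable_carrier g] by auto
    then show ?thesis
      using fun_cong[OF coef_diff[OF assms(1,2)], of n] assms(3) by (simp add: coef_def)
  qed
  then have "?d \<in> perp" using cyc_L2[OF d] by (simp add: perp_def)
  then have "l2_ip M ?d ?d = 0" using d by (simp add: cyc_def)
  then have "l2_sq M ?d = 0" by (simp add: l2_ip_self)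
  then show ?thesis using l2_sq_eq_0[OF cyc_L2[OF d]] by simp
qed

definition rep :: "(nat \<Rightarrow> complex) \<Rightarrow> 'x \<Rightarrow> complex" where
  "rep a = (SOME f. f \<in> cyc \<and> coef f = a)"

lemma rep:
  assumes "a \<in> coef ` cyc"
  shows "rep a \<in> cyc" "coef (rep a) = a"
proof -
  have "\<exists>f. f \<in> cyc \<and> coef f = a" using assms by auto
  from someI_ex[OF this] show "rep a \<in> cyc" "coef (rep a) = a" by (auto simp: rep_def)
qed

lemma rep_coef:
  assumes "f \<in> cyc"
  shows "rep (coef f) \<in> cyc" "AE x in M. rep (coef f) x = f x"
  using rep[of "coef f"] assms coef_inj[of "rep (coef f)" f] by auto

definition H :: "(complex, nat \<Rightarrow> complex) module" where
  "H = \<lparr>carrier = coef ` cyc, monoid.mult = (\<lambda>a b. a), one = (\<lambda>n. 0),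
        ring.zero = (\<lambda>n. 0), ring.add = (\<lambda>a b n. a n + b n), module.smult = (\<lambda>c a n. c * a n)\<rparr>"

lemma H_simps [simp]:
  "carrier H = coef ` cyc" "\<zero>\<^bsub>H\<^esub> = (\<lambda>n. 0)"
  "a \<oplus>\<^bsub>H\<^esub> b = (\<lambda>n. a n + b n)" "c \<odot>\<^bsub>H\<^esub> a = (\<lambda>n. c * a n)"
  by (simp_all add: H_def)

definition hip :: "(nat \<Rightarrow> complex) \<Rightarrow> (nat \<Rightarrow> complex) \<Rightarrow> complex" where
  "hip a b = l2_ip M (rep a) (rep b)"

lemma hip_coef:
  assumes "f \<in> cyc" "g \<in> cyc"
  shows "hip (coef f) (coef g) = l2_ip M f g"
  unfolding hip_def using rep_coef assms
  by (intro l2_ip_cong_AE) (auto intro: L2_measurable cyc_L2)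

lemma hnorm_coef: "f \<in> cyc \<Longrightarrow> hilbert_norm hip (coef f) = sqrt (l2_sq M f)"
  by (simp add: hilbert_norm_def hip_coef l2_ip_self)

lemma H_abelian_group: "abelian_group H"
proof (intro abelian_groupI)
  fix a b assume "a \<in> carrier H" "b \<in> carrier H"
  then obtain f g where "f \<in> cyc" "g \<in> cyc" "a = coef f" "b = coef g" by auto
  then show "a \<oplus>\<^bsub>H\<^esub> b \<in> carrier H"
    by (simp add: coef_add[symmetric] cyc_add)
next
  show "\<zero>\<^bsub>H\<^esub> \<in> carrier H" using coef_zero cyc_zero by (auto intro!: image_eqI)
next
  fix a assume "a \<in> carrier H"
  then obtain f where "f \<in> cyc" "a = coef f" by auto
  moreover have "coef (\<lambda>x. -1 * f x) \<oplus>\<^bsub>H\<^esub> coef f = \<zero>\<^bsub>H\<^esub>"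
    unfolding coef_scale by simp
  ultimately show "\<exists>b\<in>carrier H. b \<oplus>\<^bsub>H\<^esub> a = \<zero>\<^bsub>H\<^esub>"
    using cyc_scale[of f "-1"] by (metis H_simps(1) imageI)
qed (auto simp: algebra_simps)

lemma H_minus:
  assumes "f \<in> cyc" "g \<in> cyc"
  shows "coef f \<ominus>\<^bsub>H\<^esub> coef g = coef (\<lambda>x. f x - g x)"
proof -
  interpret H: abelian_group H by (rule H_abelian_group)
  have neg: "coef (\<lambda>x. -1 * g x) \<in> carrier H" using cyc_scale[OF assms(2), of "-1"] by auto
  have "coef (\<lambda>x. -1 * g x) \<oplus>\<^bsub>H\<^esub> coef g = \<zero>\<^bsub>H\<^esub>"
    unfolding coef_scale by simp
  then have "\<ominus>\<^bsub>H\<^esub> coef g = coef (\<lambda>x. -1 * g x)"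
    using neg assms by (intro H.minus_equality) auto
  then show ?thesis
    unfolding a_minus_def coef_diff[OF assms] coef_scale by simp
qed

lemma H_hilbert: "complex_hilbert_space H hip"
proof -
  interpret H: abelian_group H by (rule H_abelian_group)
  have scale: "c \<odot>\<^bsub>H\<^esub> a \<in> carrier H" if "a \<in> carrier H" for c a
    using that by (auto simp: coef_scale[symmetric] cyc_scale)
  interpret module complex_ring H
    by (intro moduleI cring_complex_ring H_abelian_group)
       (use scale in \<open>auto simp: complex_ring_def algebra_simps\<close>)
  show ?thesis
  proof
    fix u v w c assume "u \<in> carrier H" "v \<in> carrier H" "w \<in> carrier H"
    then obtain f g h where [simp]: "u = coef f" "v = coef g" "w = coef h"
      and fgh: "f \<in> cyc" "g \<in> cyc" "h \<in> cyc" by auto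
    show "hip (u \<oplus>\<^bsub>H\<^esub> v) w = hip u w + hip v w"
      using fgh by (simp add: hip_coef coef_add[symmetric] cyc_add l2_ip_add cyc_L2)
  next
    fix v w c assume "v \<in> carrier H" "w \<in> carrier H"
    then obtain g h where [simp]: "v = coef g" "w = coef h"
      and fgh: "g \<in> cyc" "h \<in> cyc" by auto
    show "hip (c \<odot>\<^bsub>H\<^esub> v) w = c * hip v w"
      using fgh by (simp add: hip_coef coef_scale[symmetric] cyc_scale l2_ip_scale)
    show "hip w v = cnj (hip v w)"
      using fgh by (simp add: hip_coef l2_ip_cnj[of _ h])
  next
    fix v assume v: "v \<in> carrier H" "v \<noteq> \<zero>\<^bsub>H\<^esub>"
    then obtain g where [simp]: "v = coef g" and g: "g \<in> cyc" by auto
    have "\<not> (AE x in M. g x = 0)"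
      using coef_cong[OF _ g cyc_zero] coef_zero v by auto
    then have "l2_sq M g \<noteq> 0" using l2_sq_eq_0[OF cyc_L2[OF g]] by simp
    then show "0 < Re (hip v v)"
      using g l2_sq_nonneg[of M g] by (simp add: hip_coef l2_ip_self)
  next
    fix s :: "nat \<Rightarrow> nat \<Rightarrow> complex"
    assume s: "\<And>n. s n \<in> carrier H"
      and C: "\<And>e. 0 < e \<Longrightarrow> \<exists>k. \<forall>m\<ge>k. \<forall>n\<ge>k. hilbert_norm hip (s m \<ominus>\<^bsub>H\<^esub> s n) < e"
    define f where "f n = rep (s n)" for n
    have f: "f n \<in> cyc" "coef (f n) = s n" for n using rep[of "s n"] s[of n] by (auto simp: f_def)
    have norm: "hilbert_norm hip (s m \<ominus>\<^bsub>H\<^esub> s n) = sqrt (l2_sq M (\<lambda>x. f m x - f n x))" for m n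
      using H_minus[of "f m" "f n"] f hnorm_coef[OF cyc_diff[of "f m" "f n"]] by simp
    have "\<exists>k. \<forall>m\<ge>k. \<forall>n\<ge>k. l2_sq M (\<lambda>x. f m x - f n x) < e" if "e > 0" for e
      using C[of "sqrt e"] that by (simp add: norm)
    then obtain l where l: "l \<in> L2 M" "(\<lambda>n. l2_sq M (\<lambda>x. f n x - l x)) \<longlonglongrightarrow> 0"
      using L2_complete[OF prob_space_axioms, of f] cyc_L2[OF f(1)] by blast
    have lc: "l \<in> cyc" using cyc_closed[of f, OF f(1) l] .
    have "hilbert_norm hip (s n \<ominus>\<^bsub>H\<^esub> coef l) = sqrt (l2_sq M (\<lambda>x. f n x - l x))" for n
      using H_minus[OF f(1)[of n] lc] f(2)[of n] hnorm_coef[OF cyc_diff[OF f(1)[of n] lc]] by simp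
    then have "(\<lambda>n. hilbert_norm hip (s n \<ominus>\<^bsub>H\<^esub> coef l)) \<longlonglongrightarrow> 0"
      using tendsto_real_sqrt[OF l(2)] by simp
    then show "\<exists>l\<in>carrier H. (\<lambda>n. hilbert_norm hip (s n \<ominus>\<^bsub>H\<^esub> l)) \<longlonglongrightarrow> 0"
      using lc by auto
  qed
qed

definition hrep :: "'g \<Rightarrow> (nat \<Rightarrow> complex) \<Rightarrow> nat \<Rightarrow> complex" where
  "hrep g a = coef (act (inv\<^bsub>G\<^esub> g) (rep a))"

lemma hrep_coef:
  assumes "g \<in> carrier G" "f \<in> cyc"
  shows "hrep g (coef f) = coef (act (inv\<^bsub>G\<^esub> g) f)"
  unfolding hrep_def using assms rep_coef[OF assms(2)]
  by (intro coef_cong act_cong act_cyc) auto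

lemma H_rep: "unitary_rep G H hip hrep"
  unfolding unitary_rep_def
proof (intro conjI ballI H_hilbert)
  fix g assume g: "g \<in> carrier G"
  show "unitary_operator H hip (hrep g)"
    unfolding unitary_operator_def
  proof (intro conjI ballI allI)
    show "hrep g ` carrier H = carrier H"
    proof
      show "hrep g ` carrier H \<subseteq> carrier H"
        using g by (auto simp: hrep_coef intro!: act_cyc)
      show "carrier H \<subseteq> hrep g ` carrier H"
      proof
        fix a assume "a \<in> carrier H"
        then obtain f where f: "f \<in> cyc" "a = coef f" by auto
        have "coef f = hrep g (coef (act g f))"
          using act_inv[of "inv\<^bsub>G\<^esub> g" f] g f act_cyc by (auto simp: hrep_coef intro!: coef_cong)
        then show "a \<in> hrep g ` carrier H" using f g act_cyc by auto
      qed
    qed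
    fix c v w assume "v \<in> carrier H" "w \<in> carrier H"
    then obtain f h where [simp]: "v = coef f" "w = coef h" and fh: "f \<in> cyc" "h \<in> cyc" by auto
    have "act (inv\<^bsub>G\<^esub> g) (\<lambda>x. f x + h x) = (\<lambda>x. act (inv\<^bsub>G\<^esub> g) f x + act (inv\<^bsub>G\<^esub> g) h x)"
      by (auto simp: act_def fun_eq_iff algebra_simps)
    then show "hrep g (v \<oplus>\<^bsub>H\<^esub> w) = hrep g v \<oplus>\<^bsub>H\<^esub> hrep g w"
      using fh g by (simp add: coef_add[symmetric] hrep_coef cyc_add act_cyc)
    show "hip (hrep g v) (hrep g w) = hip v w"
      using fh g by (simp add: hrep_coef hip_coef act_cyc act_ip cyc_L2)
  next
    fix c v assume "v \<in> carrier H"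
    then obtain f where [simp]: "v = coef f" and f: "f \<in> cyc" by auto
    have "act (inv\<^bsub>G\<^esub> g) (\<lambda>x. c * f x) = (\<lambda>x. c * act (inv\<^bsub>G\<^esub> g) f x)"
      by (auto simp: act_def fun_eq_iff algebra_simps)
    then show "hrep g (c \<odot>\<^bsub>H\<^esub> v) = c \<odot>\<^bsub>H\<^esub> hrep g v"
      using f g by (simp add: coef_scale[symmetric] hrep_coef cyc_scale act_cyc)
  qed
next
  fix v assume "v \<in> carrier H"
  then obtain f where [simp]: "v = coef f" and f: "f \<in> cyc" by auto
  show "hrep \<one>\<^bsub>G\<^esub> v = v"
    using f act_one[of f] act_cyc[of "\<one>\<^bsub>G\<^esub>" f] by (auto simp: hrep_coef intro!: coef_cong)
next
  fix g h v assume g: "g \<in> carrier G" and h: "h \<in> carrier G" and "v \<in> carrier H"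
  then obtain f where [simp]: "v = coef f" and f: "f \<in> cyc" by auto
  have "AE x in M. act (inv\<^bsub>G\<^esub> (g \<otimes>\<^bsub>G\<^esub> h)) f x = act (inv\<^bsub>G\<^esub> g) (act (inv\<^bsub>G\<^esub> h) f) x"
    using g h act_act[of "inv\<^bsub>G\<^esub> h" "inv\<^bsub>G\<^esub> g" f] by (simp add: inv_mult_group)
  then have "coef (act (inv\<^bsub>G\<^esub> (g \<otimes>\<^bsub>G\<^esub> h)) f) = coef (act (inv\<^bsub>G\<^esub> g) (act (inv\<^bsub>G\<^esub> h) f))"
    using g h f by (intro coef_cong act_cyc) auto
  then show "hrep (g \<otimes>\<^bsub>G\<^esub> h) v = hrep g (hrep h v)"
    using g h f by (simp add: hrep_coef act_cyc)
qed

end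

text \<open>The bound \<open>\<epsilon>\<close> here is the square of the Kazhdan constant, and \<open>Q\<close> consists of the inverses of the
  Kazhdan set, because \<open>q\<close> moves the constant 1 to the conjugate of \<open>w (inv q)\<close>.\<close>

lemma property_T_twisted:
  fixes G :: "('g, 'm) monoid_scheme"
  assumes "property_T G" "group G"
  obtains Q \<epsilon> where "finite Q" "Q \<subseteq> carrier G" "(0::real) < \<epsilon>"
    "\<And>(M :: 'x measure) T w. twisted_action G M T w \<Longrightarrow>
      (\<And>q. q \<in> Q \<Longrightarrow> l2_sq M (\<lambda>x. w q x - 1) < \<epsilon>) \<Longrightarrow>
      \<exists>f\<in>L2 M. \<not> (AE x in M. f x = 0) \<and> (\<forall>g\<in>carrier G. AE x in M. f (T g x) = w g x * f x)"
proof -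
  interpret group G by fact
  obtain Q \<epsilon> where Q: "finite Q" "Q \<subseteq> carrier G" "(0::real) < \<epsilon>"
    and inv: "\<And>(H :: (complex, nat \<Rightarrow> complex) module) ip \<pi>. unitary_rep G H ip \<pi> \<Longrightarrow>
      \<exists>v\<in>carrier H. v \<noteq> \<zero>\<^bsub>H\<^esub> \<and> (\<forall>q\<in>Q. hilbert_norm ip (\<pi> q v \<ominus>\<^bsub>H\<^esub> v) < \<epsilon> * hilbert_norm ip v) \<Longrightarrow>
      \<exists>v\<in>carrier H. v \<noteq> \<zero>\<^bsub>H\<^esub> \<and> (\<forall>g\<in>carrier G. \<pi> g v = v)"
    using assms(1) unfolding property_T_def property_T_on_def by blast
  show thesis
  proof (rule that[of "m_inv G ` Q" "\<epsilon>\<^sup>2"])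
    fix M :: "'x measure" and T w
    assume "twisted_action G M T w" and small: "\<And>q. q \<in> m_inv G ` Q \<Longrightarrow> l2_sq M (\<lambda>x. w q x - 1) < \<epsilon>\<^sup>2"
    then interpret twisted_action G M T w by simp
    \<comment> \<open>The vector of the constant function 1 is the almost invariant one.\<close>
    let ?v = "coef (\<lambda>x. 1)"
    have norm1: "hilbert_norm hip ?v = 1"
      using cyc_one by (simp add: hnorm_coef l2_sq_def prob_space)
    have "?v \<noteq> \<zero>\<^bsub>H\<^esub>"
    proof
      assume "?v = \<zero>\<^bsub>H\<^esub>"
      then have "AE x in M. (1::complex) = 0"
        using coef_inj[OF cyc_one cyc_zero] coef_zero by simp
      then show False by simp
    qed
    moreover have "hilbert_norm hip (hrep q ?v \<ominus>\<^bsub>H\<^esub> ?v) < \<epsilon> * hilbert_norm hip ?v" if q: "q \<in> Q" for q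
    proof -
      have qG: "q \<in> carrier G" using q Q by auto
      have a: "act (inv\<^bsub>G\<^esub> q) (\<lambda>x. 1) \<in> cyc" using qG cyc_one by (intro act_cyc) auto
      have "cmod (act (inv\<^bsub>G\<^esub> q) (\<lambda>x. 1) x - 1) = cmod (w (inv\<^bsub>G\<^esub> q) x - 1)" for x
        by (metis act_def complex_cnj_diff complex_cnj_one complex_mod_cnj mult.right_neutral)
      then have "hilbert_norm hip (hrep q ?v \<ominus>\<^bsub>H\<^esub> ?v) = sqrt (l2_sq M (\<lambda>x. w (inv\<^bsub>G\<^esub> q) x - 1))"
        using H_minus[OF a cyc_one] qG cyc_one cyc_diff[OF a cyc_one]
        by (simp add: hrep_coef hnorm_coef l2_sq_def)
      also have "\<dots> < \<epsilon>" using small[of "inv\<^bsub>G\<^esub> q"] q Q(3)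
        by (intro real_less_lsqrt) (auto simp: l2_sq_nonneg)
      finally show ?thesis using norm1 by simp
    qed
    ultimately obtain v where v: "v \<in> carrier H" "v \<noteq> \<zero>\<^bsub>H\<^esub>" "\<And>g. g \<in> carrier G \<Longrightarrow> hrep g v = v"
      using inv[OF H_rep] cyc_one by (metis H_simps(1) imageI)
    then obtain f where f: "f \<in> cyc" "v = coef f" by auto
    show "\<exists>f\<in>L2 M. \<not> (AE x in M. f x = 0) \<and> (\<forall>g\<in>carrier G. AE x in M. f (T g x) = w g x * f x)"
    proof (intro bexI conjI ballI notI)
      show "f \<in> L2 M" using f by (simp add: cyc_L2)
      show False if "AE x in M. f x = 0"
        using coef_cong[OF that f(1) cyc_zero] v(2) f(2) coef_zero by simp
      fix g assume g: "g \<in> carrier G"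
      have "coef (act g f) = coef f"
        using v(3)[of "inv\<^bsub>G\<^esub> g"] hrep_coef[of "inv\<^bsub>G\<^esub> g" f] f g by simp
      then have "AE x in M. act g f x = f x"
        using f g by (intro coef_inj act_cyc)
      then show "AE x in M. f (T g x) = w g x * f x"
      proof eventually_elim
        case (elim x)
        then have "w g x * f x = (w g x * cnj (w g x)) * f (T g x)" by (simp add: act_def mult.assoc)
        then show ?case by (simp add: w_cancel)
      qed
    qed
  qed (use Q in auto)
qed

section \<open>The circle\<close>

definition unit_circle_measure :: "real measure" where
  "unit_circle_measure = uniform_measure lborel {0..<1}"

lemma sets_unit_circle_measure [measurable_cong]: "sets unit_circle_measure = sets borel"
  by (simp add: unit_circle_measure_def)

lemma space_unit_circle_measure [simp]: "space unit_circle_measure = UNIV"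
  by (simp add: unit_circle_measure_def)

lemma prob_space_unit_circle_measure: "prob_space unit_circle_measure"
  unfolding unit_circle_measure_def by (intro prob_space_uniform_measure) auto

lemma emeasure_unit_circle_measure:
  "A \<in> sets borel \<Longrightarrow> emeasure unit_circle_measure A = emeasure lborel ({0..<1} \<inter> A)"
  unfolding unit_circle_measure_def by (subst emeasure_uniform_measure) (auto simp: divide_ennreal_def)

lemma borel_measurable_frac [measurable]: "(frac :: real \<Rightarrow> real) \<in> borel_measurable borel"
  unfolding frac_def[abs_def] by measurable

lemma emeasure_lborel_shift:
  assumes "A \<in> sets borel"
  shows "emeasure lborel ((\<lambda>x::real. x + c) -` A) = emeasure lborel A"
proof -
  have "emeasure lborel A = emeasure (distr lborel borel (\<lambda>x. c + x)) A"
    by (subst lborel_distr_plus) simp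
  also have "\<dots> = emeasure lborel ((\<lambda>x. x + c) -` A)"
    using assms by (subst emeasure_distr) (auto simp: add.commute[of c] vimage_def)
  finally show ?thesis by simp
qed

text \<open>Cut the circle at the image of 0 and translate the two pieces separately.\<close>

lemma frac_shift_preserves: "preserves unit_circle_measure unit_circle_measure (\<lambda>u. frac (u + s))"
proof -
  let ?P = unit_circle_measure
  define t where "t = frac s"
  have t: "0 \<le> t" "t < 1" by (auto simp: t_def frac_lt_1)
  have m: "(\<lambda>u. frac (u + s)) \<in> ?P \<rightarrow>\<^sub>M ?P" by measurable
  have "distr ?P ?P (\<lambda>u. frac (u + s)) = ?P"
  proof (rule measure_eqI)
    fix A assume "A \<in> sets (distr ?P ?P (\<lambda>u. frac (u + s)))"
    then have A [measurable]: "A \<in> sets borel" by (simp add: sets_unit_circle_measure)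
    have fr: "frac (u + s) = (if u < 1 - t then u + t else u + (t - 1))" if "0 \<le> u" "u < 1" for u
    proof -
      have "u + s - (u + t) \<in> \<int>" by (simp add: t_def frac_def)
      then have "u + s - (u + t) \<in> \<int>" "u + s - (u + (t - 1)) \<in> \<int>"
        using Ints_add[of "u + s - (u + t)" 1] by (auto simp: algebra_simps)
      then show ?thesis using that t by (auto simp: frac_unique_iff)
    qed
    have split: "{0..<1} \<inter> (\<lambda>u. frac (u + s)) -` A =
        (\<lambda>u. u + t) -` (A \<inter> {t..<1}) \<union> (\<lambda>u. u + (t - 1)) -` (A \<inter> {0..<t})"
    proof (rule Set.set_eqI)
      fix u
      show "u \<in> {0..<1} \<inter> (\<lambda>u. frac (u + s)) -` A \<longleftrightarrow>
        u \<in> (\<lambda>u. u + t) -` (A \<inter> {t..<1}) \<union> (\<lambda>u. u + (t - 1)) -` (A \<inter> {0..<t})"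
        using fr[of u] t by (cases "0 \<le> u \<and> u < 1") auto
    qed
    have "emeasure (distr ?P ?P (\<lambda>u. frac (u + s))) A = emeasure ?P ((\<lambda>u. frac (u + s)) -` A)"
      using m by (subst emeasure_distr) (auto simp: sets_unit_circle_measure)
    moreover have "(\<lambda>u. frac (u + s)) -` A \<in> sets borel"
      using measurable_sets[of "\<lambda>u. frac (u + s)" borel borel A] by simp
    then have "emeasure ?P ((\<lambda>u. frac (u + s)) -` A) = emeasure lborel ({0..<1} \<inter> (\<lambda>u. frac (u + s)) -` A)"
      by (rule emeasure_unit_circle_measure)
    ultimately have "emeasure (distr ?P ?P (\<lambda>u. frac (u + s))) A = emeasure lborel ({0..<1} \<inter> (\<lambda>u. frac (u + s)) -` A)"
      by simp
    also have "\<dots> = emeasure lborel ((\<lambda>u. u + t) -` (A \<inter> {t..<1})) + emeasure lborel ((\<lambda>u. u + (t - 1)) -` (A \<inter> {0..<t}))"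
      unfolding split using t by (intro plus_emeasure[symmetric]) auto
    also have "\<dots> = emeasure lborel (A \<inter> {t..<1}) + emeasure lborel (A \<inter> {0..<t})"
      by (subst (1 2) emeasure_lborel_shift) auto
    also have "\<dots> = emeasure lborel ((A \<inter> {t..<1}) \<union> (A \<inter> {0..<t}))"
      by (intro plus_emeasure) auto
    also have "(A \<inter> {t..<1}) \<union> (A \<inter> {0..<t}) = {0..<1} \<inter> A"
      using t by auto
    finally show "emeasure (distr ?P ?P (\<lambda>u. frac (u + s))) A = emeasure ?P A"
      by (simp add: emeasure_unit_circle_measure)
  qed simp
  with m show ?thesis by (simp add: preserves_def)
qed

definition ee :: "real \<Rightarrow> complex" where
  "ee t = cis (2 * pi * t)"

lemma ee_add: "ee (a + b) = ee a * ee b"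
  by (simp add: ee_def cis_mult distrib_left)

lemma ee_diff: "ee (a - b) = ee a * cnj (ee b)"
  by (simp add: ee_def cis_mult cis_cnj right_diff_distrib)

lemma norm_ee [simp]: "cmod (ee a) = 1"
  by (simp add: ee_def)

lemma ee_Ints: "a \<in> \<int> \<Longrightarrow> ee a = 1"
  by (simp add: ee_def)

lemma ee_eq_iff: "ee a = ee b \<longleftrightarrow> a - b \<in> \<int>"
proof
  assume "ee a = ee b"
  then have "cos (2 * pi * (a - b)) = 1"
    using arg_cong[of _ _ Re, OF ee_diff[of a b]] complex_norm_square[of "ee b"] by (simp add: ee_def)
  then obtain n :: int where "2 * pi * (a - b) = of_int n * 2 * pi"
    using cos_one_2pi_int by auto
  then have "a - b = of_int n" by simp
  then show "a - b \<in> \<int>" by simp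
next
  assume "a - b \<in> \<int>"
  then show "ee a = ee b" using ee_add[of "a - b" b] by (simp add: ee_Ints)
qed

lemma continuous_on_ee: "continuous_on UNIV ee"
  unfolding ee_def[abs_def] by (intro continuous_intros)

lemma borel_measurable_ee [measurable]: "ee \<in> borel_measurable borel"
  by (intro borel_measurable_continuous_onI continuous_on_ee)

text \<open>A measurable inverse of \<open>ee\<close> on the unit circle. The principal argument is continuous off the
  closed negative axis, which meets the unit circle in \<open>-1\<close> alone, so a constant does there.\<close>

definition angle :: "complex \<Rightarrow> real" where
  "angle z = (if z \<in> - \<real>\<^sub>\<le>\<^sub>0 then Arg z else pi) / (2 * pi)"

lemma borel_measurable_angle [measurable]: "angle \<in> borel_measurable borel"
proof -
  have "(\<lambda>z. if z \<in> - \<real>\<^sub>\<le>\<^sub>0 then Arg z else pi) \<in> borel_measurable borel"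
    by (intro borel_measurable_continuous_on_if continuous_intros) (auto intro: borel_open)
  then show ?thesis unfolding angle_def[abs_def] by measurable
qed

lemma ee_angle:
  assumes "cmod z = 1"
  shows "ee (angle z) = z"
proof (cases "z \<in> \<real>\<^sub>\<le>\<^sub>0")
  case True
  then obtain a where "z = complex_of_real a" "a \<le> 0" by (elim nonpos_Reals_cases)
  with assms have "z = -1" by auto
  with True show ?thesis by (simp add: ee_def angle_def)
next
  case False
  moreover have "z \<noteq> 0" using assms by auto
  ultimately show ?thesis
    using assms cis_Arg[of z] by (auto simp: ee_def angle_def sgn_div_norm)
qed

section \<open>The quotient of the torus by its diagonal\<close>

text \<open>The Borel sets of a countable product of lines are generated by the coordinates: boxes with finitely
  many constrained sides, taken from a countable basis, form a countable basis of the product.\<close>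

lemma openin_product_sets_PiM:
  assumes I: "countable I" and W: "openin (product_topology (\<lambda>_. euclideanreal) I) W"
  shows "W \<in> sets (PiM I (\<lambda>_. borel))"
proof -
  obtain \<B> :: "real set set" where B: "countable \<B>" "topological_basis \<B>"
    using ex_countable_basis by auto
  define \<D> where "\<D> = (SIGMA J : {J. finite J \<and> J \<subseteq> I}. PiE J (\<lambda>_. \<B>))"
  define box where "box = (\<lambda>(J, f). prod_emb I (\<lambda>_. borel :: real measure) J (PiE J f))"
  have cD: "countable \<D>"
    unfolding \<D>_def using B I
    by (intro countable_SIGMA countable_Collect_finite_subset countable_PiE) auto
  have box: "box d \<in> sets (PiM I (\<lambda>_. borel))" if "d \<in> \<D>" for d
    using that topological_basis_open[OF B(2)]
    by (auto simp: \<D>_def box_def PiE_iff intro!: sets_PiM_I)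
  have "W = (\<Union>d\<in>{d\<in>\<D>. box d \<subseteq> W}. box d)"
  proof (intro equalityI subsetI)
    fix x assume x: "x \<in> W"
    have "\<exists>U. finite {i \<in> I. U i \<noteq> topspace euclideanreal} \<and> (\<forall>i\<in>I. openin euclideanreal (U i)) \<and>
        x \<in> PiE I U \<and> PiE I U \<subseteq> W"
      using iffD1[OF openin_product_topology_alt W] x by blast
    then obtain U where U0: "finite {i \<in> I. U i \<noteq> topspace euclideanreal}"
        "\<forall>i\<in>I. openin euclideanreal (U i)" and U3: "x \<in> PiE I U" "PiE I U \<subseteq> W"
      by (elim exE conjE) (rule that)
    have U: "finite {i \<in> I. U i \<noteq> UNIV}" "\<And>i. i \<in> I \<Longrightarrow> open (U i)"
      using U0 by simp_all
    define J where "J = {i \<in> I. U i \<noteq> UNIV}"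
    have "\<exists>V\<in>\<B>. x i \<in> V \<and> V \<subseteq> U i" if "i \<in> J" for i
    proof -
      have i: "i \<in> I" using that by (simp add: J_def)
      then have "x i \<in> U i" using U3(1) by (simp add: PiE_iff)
      then show ?thesis using topological_basisE[OF B(2) U(2)[OF i]] by metis
    qed
    then obtain V where V: "\<And>i. i \<in> J \<Longrightarrow> V i \<in> \<B> \<and> x i \<in> V i \<and> V i \<subseteq> U i" by metis
    let ?d = "(J, restrict V J)"
    have "?d \<in> \<D>" using U(1) V by (auto simp: \<D>_def J_def)
    moreover have "box ?d \<subseteq> PiE I U"
    proof
      fix y assume "y \<in> box ?d"
      then have y: "y \<in> extensional I" "\<And>i. i \<in> J \<Longrightarrow> y i \<in> V i"
        by (simp_all add: box_def prod_emb_def PiE_iff)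
      have "y i \<in> U i" if "i \<in> I" for i
      proof (cases "i \<in> J")
        case True
        then show ?thesis using y(2) V by blast
      next
        case False
        then show ?thesis using that by (simp add: J_def)
      qed
      then show "y \<in> PiE I U" using y(1) by (simp add: PiE_iff)
    qed
    moreover have "x \<in> box ?d"
      using V U3(1) by (simp add: box_def prod_emb_def PiE_iff)
    ultimately show "x \<in> (\<Union>d\<in>{d\<in>\<D>. box d \<subseteq> W}. box d)" using U3(2) by blast
  qed auto
  also have "\<dots> \<in> sets (PiM I (\<lambda>_. borel))"
    using cD box by (intro sets.countable_UN'' countable_subset[OF _ cD]) auto
  finally show ?thesis .
qed

lemma PiM_map_preserves:
  assumes P: "prob_space P" and f: "\<And>i. i \<in> I \<Longrightarrow> preserves P P (f i)"
  shows "preserves (PiM I (\<lambda>_. P)) (PiM I (\<lambda>_. P)) (\<lambda>r. \<lambda>i\<in>I. f i (r i))"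
proof -
  interpret P: prob_space P by fact
  interpret PP: product_prob_space "\<lambda>_. P" I ..
  let ?M = "PiM I (\<lambda>_. P)"
  have m: "(\<lambda>r. \<lambda>i\<in>I. f i (r i)) \<in> ?M \<rightarrow>\<^sub>M ?M"
    using f by (intro measurable_restrict measurable_compose[OF measurable_component_singleton])
      (auto simp: preserves_def)
  moreover have "distr ?M ?M (\<lambda>r. \<lambda>i\<in>I. f i (r i)) = ?M"
  proof (rule PP.PiM_eq)
    fix J F assume J: "finite J" "J \<subseteq> I" and F: "\<And>j. j \<in> J \<Longrightarrow> F j \<in> sets P"
    have F': "f j -` F j \<inter> space P \<in> sets P" if "j \<in> J" for j
      using measurable_sets[OF preservesD(1)[OF f] F] J that by blast
    have "(\<lambda>r. \<lambda>i\<in>I. f i (r i)) -` prod_emb I (\<lambda>_. P) J (Pi\<^sub>E J F) \<inter> space ?M =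
        prod_emb I (\<lambda>_. P) J (\<Pi>\<^sub>E j\<in>J. f j -` F j \<inter> space P)"
      using J preservesD(3)[OF f] by (auto simp: prod_emb_def space_PiM PiE_iff subset_eq)
    then have "emeasure (distr ?M ?M (\<lambda>r. \<lambda>i\<in>I. f i (r i))) (prod_emb I (\<lambda>_. P) J (Pi\<^sub>E J F)) =
        emeasure ?M (prod_emb I (\<lambda>_. P) J (\<Pi>\<^sub>E j\<in>J. f j -` F j \<inter> space P))"
      using m J F by (subst emeasure_distr) (auto intro!: sets_PiM_I)
    also have "\<dots> = (\<Prod>j\<in>J. emeasure P (f j -` F j \<inter> space P))"
      using J F' by (intro PP.emeasure_PiM_emb)
    also have "\<dots> = (\<Prod>j\<in>J. emeasure P (F j))"
    proof (rule prod.cong)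
      fix j assume "j \<in> J"
      then have "emeasure P (F j) = emeasure (distr P P (f j)) (F j)"
        using f[of j] J by (auto simp: preserves_def)
      also have "\<dots> = emeasure P (f j -` F j \<inter> space P)"
        using f[of j] J F \<open>j \<in> J\<close> by (intro emeasure_distr) (auto simp: preserves_def)
      finally show "emeasure P (f j -` F j \<inter> space P) = emeasure P (F j)" by simp
    qed simp
    finally show "emeasure (distr ?M ?M (\<lambda>r. \<lambda>i\<in>I. f i (r i))) (prod_emb I (\<lambda>_. P) J (Pi\<^sub>E J F)) =
        (\<Prod>j\<in>J. emeasure P (F j))" .
  qed simp
  ultimately show ?thesis by (simp add: preserves_def)
qed

definition circle_point :: "real \<Rightarrow> real set" where
  "circle_point t = \<int> #>\<^bsub>real_group\<^esub> t"

lemma comm_group_real_group: "comm_group real_group"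
  by (intro comm_groupI) (auto simp: real_group_def intro: exI[of _ "- x" for x])

lemma normal_Ints: "\<int> \<lhd> real_group"
proof -
  interpret comm_group real_group by (rule comm_group_real_group)
  have inv: "inv\<^bsub>real_group\<^esub> x = - x" for x
    by (rule inv_equality) (auto simp: real_group_def)
  have "subgroup \<int> real_group"
    by (rule subgroupI) (auto simp: inv, auto simp: real_group_def)
  then show ?thesis by (rule subgroup_imp_normal)
qed

lemma circle_point_eq_iff: "circle_point a = circle_point b \<longleftrightarrow> a - b \<in> \<int>"
proof
  assume "circle_point a = circle_point b"
  moreover have "a \<in> circle_point a" by (auto simp: circle_point_def r_coset_def real_group_def intro: bexI[of _ 0])
  ultimately show "a - b \<in> \<int>" by (auto simp: circle_point_def r_coset_def real_group_def)
next
  assume ab: "a - b \<in> \<int>"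
  have "z + a \<in> circle_point b" if "z \<in> \<int>" for z
    using ab that by (auto simp: circle_point_def r_coset_def real_group_def intro!: bexI[of _ "z + (a - b)"])
  moreover have "z + b \<in> circle_point a" if "z \<in> \<int>" for z
    using ab that by (auto simp: circle_point_def r_coset_def real_group_def intro!: bexI[of _ "z - (a - b)"])
  ultimately show "circle_point a = circle_point b"
    by (auto simp: circle_point_def r_coset_def real_group_def)
qed

lemma circle_mult: "circle_point a \<otimes>\<^bsub>circle_group\<^esub> circle_point b = circle_point (a + b)"
  using normal.rcos_sum[OF normal_Ints, of a b]
  by (simp add: circle_group_def circle_point_def) (simp add: real_group_def)

lemma carrier_circle: "carrier circle_group = range circle_point"
  by (simp add: circle_group_def carrier_FactGroup circle_point_def image_def) (simp add: real_group_def)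

lemma comm_group_circle: "comm_group circle_group"
proof (rule group.group_comm_groupI)
  show "group circle_group"
    unfolding circle_group_def by (rule normal.factorgroup_is_group[OF normal_Ints])
qed (auto simp: carrier_circle circle_mult add.commute)

lemma comm_group_torus: "comm_group (torus_group G)"
proof (rule group.group_comm_groupI)
  interpret C: comm_group circle_group by (rule comm_group_circle)
  show "group (torus_group G)"
    unfolding torus_group_def by (rule product_group) (rule C.is_group)
  show "x \<otimes>\<^bsub>torus_group G\<^esub> y = y \<otimes>\<^bsub>torus_group G\<^esub> x"
    if "x \<in> carrier (torus_group G)" "y \<in> carrier (torus_group G)" for x y
    using that by (auto simp: torus_group_def PiE_iff C.m_comm intro!: restrict_ext)
qed

lemma normal_torus_diagonal: "torus_diagonal G \<lhd> torus_group G"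
proof -
  interpret C: comm_group circle_group by (rule comm_group_circle)
  interpret T: comm_group "torus_group G" by (rule comm_group_torus)
  have "subgroup (torus_diagonal G) (torus_group G)"
  proof (rule T.subgroupI)
    show "torus_diagonal G \<subseteq> carrier (torus_group G)" by (auto simp: torus_diagonal_def torus_group_def)
    show "torus_diagonal G \<noteq> {}" by (auto simp: torus_diagonal_def)
    fix a assume "a \<in> torus_diagonal G"
    then obtain s where s: "s \<in> carrier circle_group" "a = (\<lambda>g\<in>carrier G. s)"
      by (auto simp: torus_diagonal_def)
    have "inv\<^bsub>torus_group G\<^esub> a = (\<lambda>g\<in>carrier G. inv\<^bsub>circle_group\<^esub> s)"
      using s by (intro T.inv_equality) (auto simp: torus_group_def intro!: restrict_ext)
    then show "inv\<^bsub>torus_group G\<^esub> a \<in> torus_diagonal G"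
      using s by (auto simp: torus_diagonal_def)
    fix b assume "b \<in> torus_diagonal G"
    then obtain t where t: "t \<in> carrier circle_group" "b = (\<lambda>g\<in>carrier G. t)"
      by (auto simp: torus_diagonal_def)
    have "a \<otimes>\<^bsub>torus_group G\<^esub> b = (\<lambda>g\<in>carrier G. s \<otimes>\<^bsub>circle_group\<^esub> t)"
      using s t by (auto simp: torus_group_def intro!: restrict_ext)
    then show "a \<otimes>\<^bsub>torus_group G\<^esub> b \<in> torus_diagonal G"
      using s t by (auto simp: torus_diagonal_def)
  qed
  then show ?thesis by (rule T.subgroup_imp_normal)
qed

definition torus_point :: "('g, 'm) monoid_scheme \<Rightarrow> ('g \<Rightarrow> real) \<Rightarrow> ('g \<Rightarrow> real set)" where
  "torus_point G r = (\<lambda>g\<in>carrier G. circle_point (r g))"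

lemma torus_point_carrier: "torus_point G r \<in> carrier (torus_group G)"
  by (auto simp: torus_point_def torus_group_def carrier_circle)

lemma torus_point_mult:
  "torus_point G r \<otimes>\<^bsub>torus_group G\<^esub> torus_point G s = torus_point G (\<lambda>g. r g + s g)"
  by (auto simp: torus_point_def torus_group_def circle_mult intro!: restrict_ext)

lemma torus_point_surj:
  assumes "x \<in> carrier (torus_group G)"
  obtains r where "x = torus_point G r"
proof -
  have "\<forall>g\<in>carrier G. \<exists>t. x g = circle_point t"
    using assms by (auto simp: torus_group_def carrier_circle PiE_iff)
  then obtain r where "\<forall>g\<in>carrier G. x g = circle_point (r g)" by metis
  then have "x = torus_point G r"
    using assms by (auto simp: torus_point_def torus_group_def PiE_iff extensional_def fun_eq_iff)
  then show thesis by (rule that)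
qed

text \<open>Points of the quotient are coordinatized by real vectors, so that the measure theory takes place on a
  product of real lines. In the rest of the text \<open>[r]\<close> is the class of \<open>r\<close>.\<close>

definition torus_lift :: "('g, 'm) monoid_scheme \<Rightarrow> ('g \<Rightarrow> real) \<Rightarrow> ('g \<Rightarrow> real set) set" where
  "torus_lift G r = torus_diagonal G #>\<^bsub>torus_group G\<^esub> torus_point G r"

lemma torus_lift_mult:
  "torus_lift G r \<otimes>\<^bsub>torus_quotient_group G\<^esub> torus_lift G s = torus_lift G (\<lambda>g. r g + s g)"
  using normal.rcos_sum[OF normal_torus_diagonal torus_point_carrier torus_point_carrier, of G r s]
  by (simp add: torus_quotient_group_def torus_lift_def torus_point_mult)

lemma carrier_torus_quotient: "carrier (torus_quotient_group G) = range (torus_lift G)"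
proof -
  have "carrier (torus_group G) = range (torus_point G)"
  proof (intro equalityI subsetI)
    fix x assume "x \<in> carrier (torus_group G)"
    then show "x \<in> range (torus_point G)" by (rule torus_point_surj) simp
  qed (use torus_point_carrier in auto)
  then show ?thesis
    by (simp add: torus_quotient_group_def carrier_FactGroup torus_lift_def[abs_def] image_image)
qed

lemma torus_lift_eqD:
  assumes "torus_lift G a = torus_lift G b"
  obtains t where "\<And>g. g \<in> carrier G \<Longrightarrow> a g - b g - t \<in> \<int>"
proof -
  interpret T: comm_group "torus_group G" by (rule comm_group_torus)
  have "torus_point G a \<in> torus_lift G a"
    unfolding torus_lift_def using normal_torus_diagonal torus_point_carrier
    by (intro subgroup.rcos_module_imp T.rcos_self normal_imp_subgroup) auto
  then obtain d where d: "d \<in> torus_diagonal G" "torus_point G a = d \<otimes>\<^bsub>torus_group G\<^esub> torus_point G b"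
    unfolding assms unfolding torus_lift_def by (auto simp: r_coset_def)
  then obtain t where "d = (\<lambda>g\<in>carrier G. circle_point t)"
    by (auto simp: torus_diagonal_def carrier_circle)
  then have "d = torus_point G (\<lambda>g. t)" by (simp add: torus_point_def)
  then have eq: "torus_point G a = torus_point G (\<lambda>g. t + b g)"
    using d by (simp add: torus_point_mult)
  have "circle_point (a g) = circle_point (t + b g)" if "g \<in> carrier G" for g
    using fun_cong[OF eq, of g] that by (simp add: torus_point_def)
  then show thesis by (intro that[of t]) (simp add: circle_point_eq_iff algebra_simps)
qed

lemma torus_lift_eqI:
  assumes "\<And>g. g \<in> carrier G \<Longrightarrow> a g - b g - t \<in> \<int>"
  shows "torus_lift G a = torus_lift G b"
proof -
  interpret T: comm_group "torus_group G" by (rule comm_group_torus)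
  have "torus_point G a = torus_point G (\<lambda>g. t + b g)"
    unfolding torus_point_def using assms
    by (intro restrict_ext) (simp add: circle_point_eq_iff algebra_simps)
  also have "\<dots> = torus_point G (\<lambda>g. t) \<otimes>\<^bsub>torus_group G\<^esub> torus_point G b"
    by (simp add: torus_point_mult)
  also have "\<dots> \<in> torus_lift G b"
    by (auto simp: torus_lift_def r_coset_def torus_diagonal_def carrier_circle torus_point_def)
  finally show ?thesis
    unfolding torus_lift_def using normal_torus_diagonal torus_point_carrier
    by (intro T.repr_independence[symmetric] normal_imp_subgroup) auto
qed

lemma torus_shift_lift:
  assumes "group G" "h \<in> carrier G"
  shows "torus_quotient_shift G h (torus_lift G r) = torus_lift G (right_shift G h r)"
proof -
  interpret group G by fact
  have "right_shift G h (torus_point G r) = torus_point G (right_shift G h r)"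
    using assms by (auto simp: right_shift_def torus_point_def intro!: restrict_ext)
  then show ?thesis
    unfolding torus_lift_def using torus_quotient_shift_coset[OF assms] by simp
qed

text \<open>The cocycle \<open>c_g([r]) = e(r_g - r_1)\<close>. It is defined through a choice of \<open>r\<close>, which makes it take
  values in the unit circle even outside the quotient; \<open>lift_cocycle_lift\<close> shows that the choice does
  not matter.\<close>

definition lift_cocycle :: "('g, 'm) monoid_scheme \<Rightarrow> 'g \<Rightarrow> ('g \<Rightarrow> real set) set \<Rightarrow> complex" where
  "lift_cocycle G g x = (let r = (SOME r. x = torus_lift G r) in ee (r g - r \<one>\<^bsub>G\<^esub>))"

lemma norm_lift_cocycle [simp]: "cmod (lift_cocycle G g x) = 1"
  by (simp add: lift_cocycle_def Let_def)

lemma lift_cocycle_lift: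
  assumes "group G" "g \<in> carrier G"
  shows "lift_cocycle G g (torus_lift G r) = ee (r g - r \<one>\<^bsub>G\<^esub>)"
proof -
  interpret group G by fact
  define s where "s = (SOME s. torus_lift G r = torus_lift G s)"
  have "torus_lift G r = torus_lift G s"
    unfolding s_def by (rule someI[of _ r]) simp
  then obtain t where t: "\<And>g. g \<in> carrier G \<Longrightarrow> r g - s g - t \<in> \<int>"
    by (rule torus_lift_eqD) blast
  have "(r g - r \<one>\<^bsub>G\<^esub>) - (s g - s \<one>\<^bsub>G\<^esub>) \<in> \<int>"
    using Ints_diff[OF t[OF assms(2)] t[OF one_closed]] by (simp add: algebra_simps)
  then have "ee (r g - r \<one>\<^bsub>G\<^esub>) = ee (s g - s \<one>\<^bsub>G\<^esub>)" by (simp only: ee_eq_iff)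
  then show ?thesis
    by (simp add: lift_cocycle_def Let_def s_def)
qed

lemma lift_cocycle_mult:
  assumes "group G" "g \<in> carrier G" "h \<in> carrier G" "x \<in> carrier (torus_quotient_group G)"
  shows "lift_cocycle G (g \<otimes>\<^bsub>G\<^esub> h) x = lift_cocycle G g (torus_quotient_shift G h x) * lift_cocycle G h x"
proof -
  interpret group G by fact
  obtain r where x: "x = torus_lift G r" using assms(4) by (auto simp: carrier_torus_quotient)
  show ?thesis
    using assms(1-3) unfolding x
    by (simp add: torus_shift_lift lift_cocycle_lift right_shift_def ee_add[symmetric])
qed

lemma continuous_circle_point: "continuous_map euclideanreal circle_topology circle_point"
  unfolding circle_topology_def circle_point_def[abs_def]
  by (rule quotient_imp_continuous_map[OF quotient_map_quotient_topology])

lemma topspace_circle: "topspace circle_topology = range circle_point"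
  by (simp add: circle_topology_def topspace_quotient_topology circle_point_def[abs_def])

lemma topspace_torus: "topspace (torus_topology G) = carrier (torus_group G)"
  by (simp add: torus_topology_def torus_group_def topspace_circle carrier_circle)

lemma continuous_torus_lift:
  "continuous_map (product_topology (\<lambda>_. euclideanreal) (carrier G)) (torus_quotient_topology G) (torus_lift G)"
proof -
  have "continuous_map (product_topology (\<lambda>_. euclideanreal) (carrier G)) (torus_topology G) (torus_point G)"
    unfolding torus_topology_def continuous_map_componentwise
  proof (intro conjI ballI)
    show "torus_point G ` topspace (product_topology (\<lambda>_. euclideanreal) (carrier G)) \<subseteq> extensional (carrier G)"
      by (auto simp: torus_point_def)
    fix k assume k: "k \<in> carrier G"
    have "continuous_map (product_topology (\<lambda>_. euclideanreal) (carrier G)) circle_topology (circle_point \<circ> (\<lambda>r. r k))"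
      using k by (intro continuous_map_compose[OF _ continuous_circle_point] continuous_map_product_projection)
    moreover have "(circle_point \<circ> (\<lambda>r. r k)) = (\<lambda>r. torus_point G r k)"
      using k by (auto simp: torus_point_def)
    ultimately show "continuous_map (product_topology (\<lambda>_. euclideanreal) (carrier G)) circle_topology (\<lambda>r. torus_point G r k)"
      by simp
  qed
  moreover have "continuous_map (torus_topology G) (torus_quotient_topology G) (\<lambda>x. torus_diagonal G #>\<^bsub>torus_group G\<^esub> x)"
    unfolding torus_quotient_topology_def
    by (rule quotient_imp_continuous_map[OF quotient_map_quotient_topology])
  ultimately have "continuous_map (product_topology (\<lambda>_. euclideanreal) (carrier G)) (torus_quotient_topology G)
      ((\<lambda>x. torus_diagonal G #>\<^bsub>torus_group G\<^esub> x) \<circ> torus_point G)"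
    by (rule continuous_map_compose)
  then show ?thesis by (simp add: comp_def torus_lift_def[abs_def])
qed

text \<open>The standard character of the circle; continuity of the cocycle is deduced from its continuity.\<close>

definition circle_char :: "real set \<Rightarrow> complex" where
  "circle_char c = ee (SOME t. c = circle_point t)"

lemma circle_char_point: "circle_char (circle_point t) = ee t"
proof -
  have "circle_point t = circle_point (SOME s. circle_point t = circle_point s)"
    by (rule someI[of _ t]) simp
  then show ?thesis by (simp only: circle_char_def ee_eq_iff circle_point_eq_iff) (metis Ints_minus minus_diff_eq)
qed

lemma continuous_circle_char: "continuous_map circle_topology euclidean circle_char"
proof -
  have "continuous_map euclideanreal euclidean (circle_char \<circ> circle_point)"
    using continuous_on_ee by (simp add: comp_def circle_char_point)
  then show ?thesis
    unfolding circle_topology_def circle_point_def[abs_def]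
    by (rule continuous_compose_quotient_map[OF quotient_map_quotient_topology])
qed

lemma continuous_lift_cocycle:
  assumes "group G" "g \<in> carrier G"
  shows "continuous_map (torus_quotient_topology G) euclidean (lift_cocycle G g)"
  unfolding torus_quotient_topology_def
proof (rule continuous_compose_quotient_map[OF quotient_map_quotient_topology])
  interpret group G by fact
  have char: "continuous_map (torus_topology G) euclidean (\<lambda>x. circle_char (x k))" if "k \<in> carrier G" for k
  proof -
    have "continuous_map (torus_topology G) euclidean (circle_char \<circ> (\<lambda>x. x k))"
      unfolding torus_topology_def using that
      by (intro continuous_map_compose[OF _ continuous_circle_char] continuous_map_product_projection)
    then show ?thesis by (simp add: comp_def)
  qed
  have "continuous_map (torus_topology G) (prod_topology euclidean euclidean) (\<lambda>x. (circle_char (x g), circle_char (x \<one>\<^bsub>G\<^esub>)))"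
    using assms by (intro continuous_map_pairedI char) auto
  moreover have "continuous_map (prod_topology euclidean euclidean) euclidean (\<lambda>(a::complex, b). a * cnj b)"
    by (auto simp: euclidean_product_topology[symmetric] case_prod_unfold intro!: continuous_intros)
  ultimately have "continuous_map (torus_topology G) euclidean
      ((\<lambda>(a::complex, b). a * cnj b) \<circ> (\<lambda>x. (circle_char (x g), circle_char (x \<one>\<^bsub>G\<^esub>))))"
    by (rule continuous_map_compose)
  then show "continuous_map (torus_topology G) euclidean
      (lift_cocycle G g \<circ> (\<lambda>x. torus_diagonal G #>\<^bsub>torus_group G\<^esub> x))"
  proof (rule continuous_map_eq)
    fix x assume "x \<in> topspace (torus_topology G)"
    then obtain r where "x = torus_point G r"
      using torus_point_surj by (auto simp: topspace_torus)
    then show "((\<lambda>(a::complex, b). a * cnj b) \<circ> (\<lambda>x. (circle_char (x g), circle_char (x \<one>\<^bsub>G\<^esub>)))) x =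
        (lift_cocycle G g \<circ> (\<lambda>x. torus_diagonal G #>\<^bsub>torus_group G\<^esub> x)) x"
      using lift_cocycle_lift[OF assms, of r] assms(2)
      by (simp add: torus_lift_def ee_diff) (simp add: torus_point_def circle_char_point)
  qed
qed

lemma topspace_torus_quotient: "topspace (torus_quotient_topology G) = carrier (torus_quotient_group G)"
  by (simp add: torus_quotient_topology_def topspace_quotient_topology topspace_torus
      torus_quotient_group_def carrier_FactGroup)

abbreviation torus_measure :: "('g, 'm) monoid_scheme \<Rightarrow> ('g \<Rightarrow> real) measure" where
  "torus_measure G \<equiv> PiM (carrier G) (\<lambda>_. unit_circle_measure)"

lemma torus_lift_measurable:
  assumes \<mu>: "haar_prob_measure (torus_quotient_group G) (torus_quotient_topology G) \<mu>"
    and G: "countable (carrier G)"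
  shows "torus_lift G \<in> torus_measure G \<rightarrow>\<^sub>M \<mu>"
proof (rule measurable_sigma_sets)
  show "sets \<mu> = sigma_sets (carrier (torus_quotient_group G)) {U. openin (torus_quotient_topology G) U}"
    using \<mu> by (simp add: haar_prob_measure_def borel_sets_def topspace_torus_quotient)
  show "{U. openin (torus_quotient_topology G) U} \<subseteq> Pow (carrier (torus_quotient_group G))"
    using openin_subset by (fastforce simp: topspace_torus_quotient)
  show "torus_lift G \<in> space (torus_measure G) \<rightarrow> carrier (torus_quotient_group G)"
    by (auto simp: carrier_torus_quotient)
  fix U assume "U \<in> {U. openin (torus_quotient_topology G) U}"
  then have "openin (product_topology (\<lambda>_. euclideanreal) (carrier G))
      {r \<in> topspace (product_topology (\<lambda>_. euclideanreal) (carrier G)). torus_lift G r \<in> U}"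
    using openin_continuous_map_preimage[OF continuous_torus_lift] by auto
  then have "{r \<in> topspace (product_topology (\<lambda>_. euclideanreal) (carrier G)). torus_lift G r \<in> U}
      \<in> sets (PiM (carrier G) (\<lambda>_. borel))"
    using G by (intro openin_product_sets_PiM)
  moreover have "sets (PiM (carrier G) (\<lambda>_. borel)) = sets (torus_measure G)"
    by (intro sets_PiM_cong) (auto simp: sets_unit_circle_measure)
  moreover have "{r \<in> topspace (product_topology (\<lambda>_. euclideanreal) (carrier G)). torus_lift G r \<in> U} =
      torus_lift G -` U \<inter> space (torus_measure G)"
    by (auto simp: space_PiM)
  ultimately show "torus_lift G -` U \<inter> space (torus_measure G) \<in> sets (torus_measure G)" by simp
qed

lemma lift_cocycle_measurable:
  assumes \<mu>: "haar_prob_measure (torus_quotient_group G) (torus_quotient_topology G) \<mu>"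
    and G: "group G" "g \<in> carrier G"
  shows "lift_cocycle G g \<in> borel_measurable \<mu>"
proof (rule borel_measurableI)
  fix S :: "complex set" assume "open S"
  then have "openin (torus_quotient_topology G) {x \<in> topspace (torus_quotient_topology G). lift_cocycle G g x \<in> S}"
    by (intro openin_continuous_map_preimage[OF continuous_lift_cocycle[OF G]]) simp
  moreover have "{x \<in> topspace (torus_quotient_topology G). lift_cocycle G g x \<in> S} = lift_cocycle G g -` S \<inter> space \<mu>"
    using \<mu> by (auto simp: haar_prob_measure_def topspace_torus_quotient)
  ultimately show "lift_cocycle G g -` S \<inter> space \<mu> \<in> sets \<mu>"
    using \<mu> by (auto simp: haar_prob_measure_def borel_sets_def)
qed

text \<open>Uniqueness of Haar measure. For a measurable set \<open>A\<close>, integrate the indicator of \<open>[r] + x \<in> A\<close>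
  over \<open>x\<close> and \<open>r\<close> in both orders. Invariance of \<open>\<mu>\<close> gives \<open>\<mu>(A)\<close> in one order, and invariance
  of the product measure under translations modulo 1 gives the measure of the preimage of \<open>A\<close> in the
  other. Joint measurability comes from a measurable section \<open>s\<close> of \<open>r \<mapsto> [r]\<close>.\<close>

lemma torus_lift_preserves:
  assumes \<mu>: "haar_prob_measure (torus_quotient_group G) (torus_quotient_topology G) \<mu>"
    and G: "group G" "countable (carrier G)"
  shows "preserves (torus_measure G) \<mu> (torus_lift G)"
proof -
  interpret group G by fact
  let ?K = "torus_quotient_group G" and ?R = "torus_measure G"
  interpret mu: prob_space \<mu> using \<mu> by (simp add: haar_prob_measure_def)
  interpret R: prob_space ?R by (intro prob_space_PiM prob_space_unit_circle_measure)
  interpret pair_sigma_finite \<mu> ?R ..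
  have space_\<mu>: "space \<mu> = carrier ?K"
    and inv: "\<And>a A. a \<in> carrier ?K \<Longrightarrow> A \<in> sets \<mu> \<Longrightarrow> emeasure \<mu> (a <#\<^bsub>?K\<^esub> A) = emeasure \<mu> A"
    using \<mu> by (auto simp: haar_prob_measure_def)
  note [measurable] = torus_lift_measurable[OF \<mu> G(2)]
  define s where "s x = (\<lambda>g\<in>carrier G. angle (lift_cocycle G g x))" for x
  have lift_restrict: "torus_lift G (\<lambda>g\<in>carrier G. r g) = torus_lift G r" for r :: "'a \<Rightarrow> real"
    by (rule torus_lift_eqI[of _ _ _ 0]) simp
  have s: "torus_lift G (s x) = x" if "x \<in> space \<mu>" for x
  proof -
    obtain r where x: "x = torus_lift G r" using \<open>x \<in> space \<mu>\<close> by (auto simp: space_\<mu> carrier_torus_quotient)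
    \<comment> \<open>The section normalizes the coordinate at the unit of the group to 0.\<close>
    have "s x g - r g - (- r \<one>\<^bsub>G\<^esub>) \<in> \<int>" if g: "g \<in> carrier G" for g
    proof -
      have "ee (s x g) = ee (r g - r \<one>\<^bsub>G\<^esub>)"
        using g G(1) by (simp add: s_def ee_angle) (simp add: x lift_cocycle_lift)
      then show ?thesis by (simp add: ee_eq_iff algebra_simps)
    qed
    then show ?thesis unfolding x by (rule torus_lift_eqI)
  qed
  have s_meas: "(\<lambda>(x, r). \<lambda>g\<in>carrier G. r g + s x g) \<in> \<mu> \<Otimes>\<^sub>M ?R \<rightarrow>\<^sub>M ?R"
    unfolding case_prod_unfold
  proof (rule measurable_restrict)
    fix g assume g: "g \<in> carrier G"
    have "lift_cocycle G g \<in> borel_measurable \<mu>" by (rule lift_cocycle_measurable[OF \<mu> G(1) g])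
    then have "(\<lambda>x. s x g) \<in> borel_measurable \<mu>" using g by (simp add: s_def)
    moreover have "(\<lambda>r. r g) \<in> borel_measurable ?R"
      using measurable_component_singleton[OF g, of "\<lambda>_. unit_circle_measure"]
      by (simp cong: measurable_cong_sets add: measurable_cong_sets[OF refl sets_unit_circle_measure])
    ultimately have "(\<lambda>p. snd p g + s (fst p) g) \<in> borel_measurable (\<mu> \<Otimes>\<^sub>M ?R)" by measurable
    then show "(\<lambda>p. snd p g + s (fst p) g) \<in> \<mu> \<Otimes>\<^sub>M ?R \<rightarrow>\<^sub>M unit_circle_measure"
      by (simp add: measurable_cong_sets[OF refl sets_unit_circle_measure])
  qed
  have "distr ?R \<mu> (torus_lift G) = \<mu>"
  proof (rule measure_eqI)
    fix A assume "A \<in> sets (distr ?R \<mu> (torus_lift G))"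
    then have A [measurable]: "A \<in> sets \<mu>" by simp
    have A_sub: "A \<subseteq> carrier ?K" using sets.sets_into_space[OF A] by (simp add: space_\<mu>)
    define f where "f = (\<lambda>p. indicator A (torus_lift G (\<lambda>g\<in>carrier G. snd p g + s (fst p) g)) :: ennreal)"
    have f_meas: "f \<in> borel_measurable (\<mu> \<Otimes>\<^sub>M ?R)"
      unfolding f_def using s_meas by (simp add: case_prod_unfold)
    have inner1: "(\<integral>\<^sup>+x. f (x, r) \<partial>\<mu>) = emeasure \<mu> A" if r: "r \<in> space ?R" for r
    proof -
      let ?B = "torus_lift G (\<lambda>g. - r g) <#\<^bsub>?K\<^esub> A"
      have ind: "f (x, r) = indicator ?B x" if x: "x \<in> space \<mu>" for x
      proof -
        have "torus_lift G (\<lambda>g\<in>carrier G. r g + s x g) = torus_lift G r \<otimes>\<^bsub>?K\<^esub> x"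
          unfolding lift_restrict torus_lift_mult[symmetric] s[OF x] ..
        moreover have "torus_lift G r \<otimes>\<^bsub>?K\<^esub> x \<in> A \<longleftrightarrow> x \<in> torus_lift G (\<lambda>g. - r g) <#\<^bsub>?K\<^esub> A"
        proof
          assume *: "torus_lift G r \<otimes>\<^bsub>?K\<^esub> x \<in> A"
          have "torus_lift G (\<lambda>g. - r g) \<otimes>\<^bsub>?K\<^esub> (torus_lift G r \<otimes>\<^bsub>?K\<^esub> torus_lift G (s x)) = torus_lift G (s x)"
            by (simp add: torus_lift_mult)
          then show "x \<in> torus_lift G (\<lambda>g. - r g) <#\<^bsub>?K\<^esub> A"
            using * unfolding s[OF x] by (force simp: l_coset_def)
        next
          assume "x \<in> torus_lift G (\<lambda>g. - r g) <#\<^bsub>?K\<^esub> A"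
          then obtain a where a: "a \<in> A" "x = torus_lift G (\<lambda>g. - r g) \<otimes>\<^bsub>?K\<^esub> a"
            by (auto simp: l_coset_def)
          obtain b where b: "a = torus_lift G b" using a A_sub by (auto simp: carrier_torus_quotient)
          have "torus_lift G r \<otimes>\<^bsub>?K\<^esub> x = a" unfolding a(2) b by (simp add: torus_lift_mult)
          then show "torus_lift G r \<otimes>\<^bsub>?K\<^esub> x \<in> A" using a by simp
        qed
        ultimately show ?thesis
          by (simp add: f_def indicator_def)
      qed
      then have "(\<integral>\<^sup>+x. f (x, r) \<partial>\<mu>) = (\<integral>\<^sup>+x. indicator ?B x \<partial>\<mu>)"
        by (rule nn_integral_cong)
      also have "\<dots> = emeasure \<mu> ?B"
      proof (rule nn_integral_indicator)
        have "?B \<subseteq> space \<mu>"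
          using A_sub by (auto simp: l_coset_def space_\<mu> carrier_torus_quotient torus_lift_mult)
        then have "?B = (\<lambda>x. f (x, r)) -` {1} \<inter> space \<mu>"
          by (auto simp: ind indicator_def)
        also have "\<dots> \<in> sets \<mu>"
          using measurable_compose[OF measurable_Pair2'[OF r] f_meas] by (rule measurable_sets) simp
        finally show "?B \<in> sets \<mu>" .
      qed
      also have "\<dots> = emeasure \<mu> A"
        by (rule inv) (auto simp: carrier_torus_quotient)
      finally show ?thesis .
    qed
    have inner2: "(\<integral>\<^sup>+r. f (x, r) \<partial>?R) = emeasure (distr ?R \<mu> (torus_lift G)) A" for x
    proof -
      let ?T = "\<lambda>r. \<lambda>g\<in>carrier G. frac (r g + s x g)"
      have T: "preserves ?R ?R ?T"
        by (intro PiM_map_preserves prob_space_unit_circle_measure frac_shift_preserves)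
      have "torus_lift G (\<lambda>g\<in>carrier G. r g + s x g) = torus_lift G (?T r)" for r
        by (rule torus_lift_eqI[of _ _ _ 0]) (simp add: frac_def)
      then have "(\<integral>\<^sup>+r. f (x, r) \<partial>?R) = (\<integral>\<^sup>+r. indicator A (torus_lift G (?T r)) \<partial>?R)"
        by (simp add: f_def)
      also have "\<dots> = (\<integral>\<^sup>+r. indicator A (torus_lift G r) \<partial>distr ?R ?R ?T)"
        using preservesD(1)[OF T] by (subst nn_integral_distr) auto
      also have "distr ?R ?R ?T = ?R" using T by (simp add: preserves_def)
      also have "(\<integral>\<^sup>+r. indicator A (torus_lift G r) \<partial>?R) = (\<integral>\<^sup>+y. indicator A y \<partial>distr ?R \<mu> (torus_lift G))"
        by (subst nn_integral_distr) auto
      also have "\<dots> = emeasure (distr ?R \<mu> (torus_lift G)) A" by simp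
      finally show ?thesis .
    qed
    have "emeasure \<mu> A = (\<integral>\<^sup>+r. \<integral>\<^sup>+x. f (x, r) \<partial>\<mu> \<partial>?R)"
      by (simp add: inner1 R.emeasure_space_1 cong: nn_integral_cong)
    also have "\<dots> = (\<integral>\<^sup>+x. \<integral>\<^sup>+r. f (x, r) \<partial>?R \<partial>\<mu>)"
      using f_meas by (rule Fubini)
    also have "\<dots> = emeasure (distr ?R \<mu> (torus_lift G)) A"
      by (simp add: inner2 mu.emeasure_space_1)
    finally show "emeasure (distr ?R \<mu> (torus_lift G)) A = emeasure \<mu> A" by simp
  qed simp
  then show ?thesis by (simp add: preserves_def)
qed

section \<open>The deformation of a Bernoulli shift\<close>

text \<open>The deformation moves one point of a Bernoulli shift to an independent one by resampling
  coordinates. A point of the space \<open>C\<close> consists of both points and of a uniform label for each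
  coordinate.\<close>

locale bernoulli_deformation = group G + N: prob_space N
  for G :: "('g, 'm) monoid_scheme" and N :: "'a measure"
begin

abbreviation "B \<equiv> bernoulli_space G N"
abbreviation "C \<equiv> (B \<Otimes>\<^sub>M B) \<Otimes>\<^sub>M torus_measure G"
abbreviation "shiftC h \<equiv> map_prod (map_prod (right_shift G h) (right_shift G h)) (right_shift G h)"

sublocale B: product_prob_space "\<lambda>_. N" "carrier G"
  rewrites "PiM (carrier G) (\<lambda>_. N) = B"
  by unfold_locales (simp add: bernoulli_space_def)

sublocale R: product_prob_space "\<lambda>_. unit_circle_measure" "carrier G"
  by (intro product_prob_spaceI prob_space_unit_circle_measure)

sublocale BB: pair_prob_space B B ..

sublocale C: pair_prob_space "B \<Otimes>\<^sub>M B" "torus_measure G" ..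

text \<open>The fractional part makes the labels lie in \<open>[0, 1)\<close> everywhere and not just almost everywhere,
  so that \<open>interp_0\<close> and \<open>interp_1\<close> hold without exceptional sets.\<close>

definition interp :: "real \<Rightarrow> (('g \<Rightarrow> 'a) \<times> ('g \<Rightarrow> 'a)) \<times> ('g \<Rightarrow> real) \<Rightarrow> 'g \<Rightarrow> 'a" where
  "interp t p = (\<lambda>g\<in>carrier G. if t \<le> frac (snd p g) then fst (fst p) g else snd (fst p) g)"

lemma space_C_extensional:
  assumes "p \<in> space C"
  shows "fst (fst p) \<in> extensional (carrier G)" "snd (fst p) \<in> extensional (carrier G)"
  using assms by (simp_all add: space_pair_measure bernoulli_space_def space_PiM PiE_def mem_Times_iff)

lemma interp_0:
  assumes "p \<in> space C"
  shows "interp 0 p = fst (fst p)"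
  by (rule ext) (simp add: interp_def restrict_def extensional_arb[OF space_C_extensional(1)[OF assms]])

lemma interp_1:
  assumes "p \<in> space C"
  shows "interp 1 p = snd (fst p)"
proof (rule ext)
  fix g
  have "\<not> 1 \<le> frac (snd p g)" using frac_lt_1[of "snd p g"] by simp
  then show "interp 1 p g = snd (fst p) g"
    by (simp add: interp_def restrict_def extensional_arb[OF space_C_extensional(2)[OF assms]])
qed

lemma interp_shift: "h \<in> carrier G \<Longrightarrow> interp t (shiftC h p) = right_shift G h (interp t p)"
  by (auto simp: interp_def right_shift_def intro!: restrict_ext)

lemma interp_measurable: "interp t \<in> C \<rightarrow>\<^sub>M B"
  unfolding interp_def[abs_def] bernoulli_space_def
proof (rule measurable_restrict)
  fix g assume [measurable]: "g \<in> carrier G"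
  have "(\<lambda>r. r g) \<in> borel_measurable (torus_measure G)"
    using measurable_component_singleton[of g "carrier G" "\<lambda>_. unit_circle_measure"]
    by (simp add: measurable_cong_sets[OF refl sets_unit_circle_measure])
  then have [measurable]: "(\<lambda>p. snd p g) \<in> borel_measurable ((PiM (carrier G) (\<lambda>_. N) \<Otimes>\<^sub>M PiM (carrier G) (\<lambda>_. N)) \<Otimes>\<^sub>M torus_measure G)"
    by measurable
  show "(\<lambda>p. if t \<le> frac (snd p g) then fst (fst p) g else snd (fst p) g)
      \<in> (PiM (carrier G) (\<lambda>_. N) \<Otimes>\<^sub>M PiM (carrier G) (\<lambda>_. N)) \<Otimes>\<^sub>M torus_measure G \<rightarrow>\<^sub>M N"
    by measurable
qed

text \<open>Fix the labels. Then each coordinate of the interpolated point is a coordinate of one of two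
  independent points, and which of the two it is does not depend on them.\<close>

lemma interp_preserves: "preserves C B (interp t)"
proof -
  have "distr C B (interp t) = PiM (carrier G) (\<lambda>_. N)"
  proof (rule B.PiM_eq[unfolded bernoulli_space_def])
    show "sets (distr C B (interp t)) = sets (PiM (carrier G) (\<lambda>_. N))" by (simp add: bernoulli_space_def)
    fix J F assume J: "finite J" "J \<subseteq> carrier G" and F: "\<And>j. j \<in> J \<Longrightarrow> F j \<in> sets N"
    let ?E = "prod_emb (carrier G) (\<lambda>_. N) J (Pi\<^sub>E J F)"
    let ?S = "interp t -` ?E \<inter> space C"
    have E: "?E \<in> sets B" using J F unfolding bernoulli_space_def by (intro sets_PiM_I) auto
    have "emeasure (distr C B (interp t)) ?E = emeasure C ?S"
      using interp_measurable E by (rule emeasure_distr)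
    also have "\<dots> = (\<integral>\<^sup>+u. emeasure (B \<Otimes>\<^sub>M B) ((\<lambda>x. (x, u)) -` ?S) \<partial>torus_measure G)"
      using measurable_sets[OF interp_measurable E] by (rule C.emeasure_pair_measure_alt2)
    also have "\<dots> = (\<integral>\<^sup>+u. (\<Prod>j\<in>J. emeasure N (F j)) \<partial>torus_measure G)"
    proof (rule nn_integral_cong)
      fix u assume u: "u \<in> space (torus_measure G)"
      define J1 where "J1 = {j\<in>J. t \<le> frac (u j)}"
      define J2 where "J2 = {j\<in>J. \<not> t \<le> frac (u j)}"
      have J12: "J = J1 \<union> J2" "J1 \<inter> J2 = {}" "J1 \<subseteq> J" "J2 \<subseteq> J" by (auto simp: J1_def J2_def)
      have fin: "finite J1" "finite J2" and sub: "J1 \<subseteq> carrier G" "J2 \<subseteq> carrier G"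
        and F12: "\<And>j. j \<in> J1 \<Longrightarrow> F j \<in> sets N" "\<And>j. j \<in> J2 \<Longrightarrow> F j \<in> sets N"
        using J F by (auto simp: J1_def J2_def)
      let ?E1 = "prod_emb (carrier G) (\<lambda>_. N) J1 (Pi\<^sub>E J1 F)"
      let ?E2 = "prod_emb (carrier G) (\<lambda>_. N) J2 (Pi\<^sub>E J2 F)"
      have sets: "?E1 \<in> sets B" "?E2 \<in> sets B"
        using fin sub F12 unfolding bernoulli_space_def by (auto intro!: sets_PiM_I)
      have "(\<lambda>x. (x, u)) -` ?S = ?E1 \<times> ?E2"
      proof (intro equalityI subsetI)
        fix x assume x: "x \<in> (\<lambda>x. (x, u)) -` ?S"
        then have mem: "interp t (x, u) j \<in> F j" if "j \<in> J" for j
          using that by (simp add: prod_emb_def PiE_iff)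
        have sp: "fst x \<in> space B" "snd x \<in> space B"
          using x u by (auto simp: space_pair_measure)
        have "fst x j \<in> F j" if "j \<in> J1" for j
          using mem[of j] that J by (auto simp: J1_def interp_def split: if_splits)
        moreover have "snd x j \<in> F j" if "j \<in> J2" for j
          using mem[of j] that J by (auto simp: J2_def interp_def split: if_splits)
        ultimately show "x \<in> ?E1 \<times> ?E2"
          using sp by (simp add: mem_Times_iff prod_emb_def PiE_iff bernoulli_space_def space_PiM)
      next
        fix x assume x: "x \<in> ?E1 \<times> ?E2"
        then have sp: "fst x \<in> space B" "snd x \<in> space B"
          and 1: "\<And>j. j \<in> J1 \<Longrightarrow> fst x j \<in> F j" and 2: "\<And>j. j \<in> J2 \<Longrightarrow> snd x j \<in> F j"
          by (simp_all add: mem_Times_iff prod_emb_def PiE_iff bernoulli_space_def space_PiM)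
        then have "interp t (x, u) j \<in> F j" if "j \<in> J" for j
          using that J 1[of j] 2[of j] by (simp add: J1_def J2_def interp_def subset_eq)
        moreover have p: "(x, u) \<in> space C"
          using sp u by (simp add: space_pair_measure mem_Times_iff)
        moreover have "interp t (x, u) \<in> space B"
          using measurable_space[OF interp_measurable p] .
        ultimately show "x \<in> (\<lambda>x. (x, u)) -` ?S"
          by (simp add: prod_emb_def PiE_iff bernoulli_space_def space_PiM)
      qed
      then have "emeasure (B \<Otimes>\<^sub>M B) ((\<lambda>x. (x, u)) -` ?S) = emeasure B ?E1 * emeasure B ?E2"
        using sets by (simp add: B.emeasure_pair_measure_Times)
      also have "\<dots> = (\<Prod>j\<in>J1. emeasure N (F j)) * (\<Prod>j\<in>J2. emeasure N (F j))"
        by (simp only: B.emeasure_PiM_emb[OF sub(1) fin(1) F12(1)] B.emeasure_PiM_emb[OF sub(2) fin(2) F12(2)])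
      also have "\<dots> = (\<Prod>j\<in>J. emeasure N (F j))"
        by (simp only: J12(1) prod.union_disjoint[OF fin J12(2)])
      finally show "emeasure (B \<Otimes>\<^sub>M B) ((\<lambda>x. (x, u)) -` ?S) = (\<Prod>j\<in>J. emeasure N (F j))" .
    qed
    also have "\<dots> = (\<Prod>j\<in>J. emeasure N (F j))"
      by (simp add: R.emeasure_space_1)
    finally show "emeasure (distr C B (interp t)) ?E = (\<Prod>j\<in>J. emeasure N (F j))" .
  qed
  then show ?thesis using interp_measurable by (simp add: preserves_def bernoulli_space_def)
qed

definition change :: "('g \<Rightarrow> 'a) set \<Rightarrow> real \<Rightarrow> real \<Rightarrow> real" where
  "change A s t = measure C {p \<in> space C. interp s p \<in> A \<and> interp t p \<notin> A}"

lemma change_sets: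
  assumes "A \<in> sets B" "A' \<in> sets B"
  shows "{p \<in> space C. interp s p \<in> A \<and> interp t p \<in> A'} \<in> sets C"
    "{p \<in> space C. interp s p \<in> A \<and> interp t p \<notin> A'} \<in> sets C"
proof -
  note [measurable] = interp_measurable assms
  show "{p \<in> space C. interp s p \<in> A \<and> interp t p \<in> A'} \<in> sets C"
    "{p \<in> space C. interp s p \<in> A \<and> interp t p \<notin> A'} \<in> sets C" by measurable
qed

lemma measure_interp:
  assumes "A \<in> sets B"
  shows "measure C {p \<in> space C. interp s p \<in> A} = measure B A"
  using preserves_measure[OF interp_preserves assms, of s]
  by (simp add: vimage_def Collect_conj_eq Int_commute)

lemma measure_frac:
  assumes "0 \<le> s" "s \<le> t" "t \<le> 1" "g \<in> carrier G"
  shows "measure C {p \<in> space C. s \<le> frac (snd p g) \<and> frac (snd p g) < t} = t - s"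
proof -
  have S: "{v. s \<le> frac v \<and> frac v < t} \<in> sets borel" by measurable
  have pres: "preserves C unit_circle_measure (\<lambda>p. snd p g)"
  proof (rule preserves_comp[of C "torus_measure G" snd unit_circle_measure "\<lambda>r. r g"])
    show "preserves (torus_measure G) unit_circle_measure (\<lambda>r. r g)"
      using assms R.PiM_component[of g] by (simp add: preserves_def)
    show "preserves C (torus_measure G) snd"
      by (intro preserves_snd BB.prob_space_axioms R.prob_space_axioms)
  qed
  have "{p \<in> space C. s \<le> frac (snd p g) \<and> frac (snd p g) < t} =
      (\<lambda>p. snd p g) -` {v. s \<le> frac v \<and> frac v < t} \<inter> space C" by auto
  then have "measure C {p \<in> space C. s \<le> frac (snd p g) \<and> frac (snd p g) < t} =
      measure unit_circle_measure {v. s \<le> frac v \<and> frac v < t}"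
    using preserves_measure[OF pres, of "{v. s \<le> frac v \<and> frac v < t}"] S
    by (simp add: sets_unit_circle_measure)
  also have "\<dots> = measure lborel ({0..<1} \<inter> {v. s \<le> frac v \<and> frac v < t})"
    using S by (simp add: measure_def emeasure_unit_circle_measure)
  also have "{0..<1} \<inter> {v. s \<le> frac v \<and> frac v < t} = {s..<t}"
    using assms by (auto simp: frac_eq_id)
  finally show ?thesis using assms by simp
qed

text \<open>If \<open>A\<close> depends on one coordinate, leaving it forces the label of this coordinate to lie in \<open>[s, t)\<close>. The
  general case follows by induction over the \<open>\<sigma>\<close>-algebra. Complements are handled by the equality
  of the laws at the two times, and countable unions by truncation. The arbitrary filter provides
  uniformity over all subintervals of a fine partition.\<close>

lemma change_tendsto:
  fixes s t :: "'i \<Rightarrow> real"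
  assumes A: "A \<in> sets B"
    and st: "eventually (\<lambda>i. 0 \<le> s i \<and> s i \<le> t i \<and> t i \<le> 1) F"
    and lim: "((\<lambda>i. t i - s i) \<longlongrightarrow> 0) F"
  shows "((\<lambda>i. change A (s i) (t i)) \<longlongrightarrow> 0) F"
proof -
  have spB: "space B = (\<Pi>\<^sub>E i\<in>carrier G. space N)" by (simp add: bernoulli_space_def space_PiM)
  have setsB: "sets B = sigma_sets (space B) {{f \<in> space B. f i \<in> A} |i A. i \<in> carrier G \<and> A \<in> sets N}"
    unfolding spB by (simp add: bernoulli_space_def sets_PiM_single)
  show ?thesis
    using A[unfolded setsB]
  proof induction
    case (Basic A)
    then obtain g E where A: "A = {f \<in> space B. f g \<in> E}" and g: "g \<in> carrier G" by auto
    have "eventually (\<lambda>i. change A (s i) (t i) \<le> t i - s i) F"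
      using st
    proof eventually_elim
      case (elim i)
      have "change A (s i) (t i) \<le> measure C {p \<in> space C. s i \<le> frac (snd p g) \<and> frac (snd p g) < t i}"
        unfolding change_def
      proof (rule C.finite_measure_mono)
        show "{p \<in> space C. interp (s i) p \<in> A \<and> interp (t i) p \<notin> A} \<subseteq>
            {p \<in> space C. s i \<le> frac (snd p g) \<and> frac (snd p g) < t i}"
        proof
          fix p assume p: "p \<in> {p \<in> space C. interp (s i) p \<in> A \<and> interp (t i) p \<notin> A}"
          then have "interp (t i) p \<in> space B" using measurable_space[OF interp_measurable] by blast
          then have "interp (s i) p g \<noteq> interp (t i) p g" using p by (auto simp: A)
          then show "p \<in> {p \<in> space C. s i \<le> frac (snd p g) \<and> frac (snd p g) < t i}"
            using p g elim by (auto simp: interp_def split: if_splits)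
        qed
        have "(\<lambda>r. r g) \<in> borel_measurable (torus_measure G)"
          using measurable_component_singleton[of g "carrier G" "\<lambda>_. unit_circle_measure"] g
          by (simp add: measurable_cong_sets[OF refl sets_unit_circle_measure])
        then have [measurable]: "(\<lambda>p. snd p g) \<in> borel_measurable C" by measurable
        show "{p \<in> space C. s i \<le> frac (snd p g) \<and> frac (snd p g) < t i} \<in> sets C" by measurable
      qed
      also have "\<dots> = t i - s i" using elim g by (intro measure_frac) auto
      finally show ?case .
    qed
    then show ?case
      by (intro tendsto_sandwich[OF _ _ tendsto_const lim]) (auto simp: change_def)
  next
    case Empty
    show ?case by (simp add: change_def)
  next
    case (Compl A)
    then have A: "A \<in> sets B" by (simp add: setsB)
    have "change (space B - A) u v = change A u v" for u v
    proof -
      let ?AA = "{p \<in> space C. interp u p \<in> A \<and> interp v p \<in> A}"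
      have S: "{p \<in> space C. interp w p \<in> A} \<in> sets C" for w
        using change_sets(1)[OF A A, of w w] by simp
      have "{p \<in> space C. interp u p \<in> space B - A \<and> interp v p \<notin> space B - A} =
          {p \<in> space C. interp v p \<in> A} - ?AA"
        using measurable_space[OF interp_measurable] by auto
      then have "change (space B - A) u v = measure C {p \<in> space C. interp v p \<in> A} - measure C ?AA"
        unfolding change_def using S change_sets(1)[OF A A]
        by (simp only:) (intro C.finite_measure_Diff; auto)
      moreover have "{p \<in> space C. interp u p \<in> A \<and> interp v p \<notin> A} = {p \<in> space C. interp u p \<in> A} - ?AA"
        by auto
      then have "change A u v = measure C {p \<in> space C. interp u p \<in> A} - measure C ?AA"
        unfolding change_def using S change_sets(1)[OF A A]
        by (simp only:) (intro C.finite_measure_Diff; auto)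
      ultimately show ?thesis using measure_interp[OF A] by simp
    qed
    then show ?case using Compl by simp
  next
    case (Union A)
    have A: "A i \<in> sets B" for i using Union(1) by (simp add: setsB)
    define A' where "A' m = (\<Union>i<m. A i)" for m
    have A': "A' m \<in> sets B" for m using A by (auto simp: A'_def)
    have "incseq A'" unfolding A'_def incseq_def by (intro allI impI UN_mono) auto
    then have "(\<lambda>m. measure B (A' m)) \<longlonglongrightarrow> measure B (\<Union>m. A' m)"
      using A' by (intro B.finite_Lim_measure_incseq) auto
    moreover have UA: "(\<Union>m. A' m) = (\<Union>i. A i)" unfolding A'_def by blast
    ultimately have lim': "(\<lambda>m. measure B (A' m)) \<longlonglongrightarrow> measure B (\<Union>i. A i)" by simp
    have UAs: "(\<Union>i. A i) \<in> sets B" using A by auto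
    show ?case
    proof (rule tendstoI)
      fix e :: real assume e: "e > 0"
      then obtain m where "\<bar>measure B (A' m) - measure B (\<Union>i. A i)\<bar> < e / 2"
        using lim'[THEN LIMSEQ_D, of "e / 2"] by auto
      moreover have "measure B ((\<Union>i. A i) - A' m) = measure B (\<Union>i. A i) - measure B (A' m)"
        using A' UAs UA by (intro B.finite_measure_Diff) auto
      ultimately have m: "measure B ((\<Union>i. A i) - A' m) < e / 2" by linarith
      have "((\<lambda>i. \<Sum>j<m. change (A j) (s i) (t i)) \<longlongrightarrow> (\<Sum>j<m. 0)) F"
        using Union(2) by (intro tendsto_sum) auto
      then have "eventually (\<lambda>i. (\<Sum>j<m. change (A j) (s i) (t i)) < e / 2) F"
        using e by (intro order_tendstoD(2)[of _ 0]) auto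
      then show "eventually (\<lambda>i. dist (change (\<Union>i. A i) (s i) (t i)) 0 < e) F"
      proof eventually_elim
        case (elim i)
        let ?D = "\<lambda>j. {p \<in> space C. interp (s i) p \<in> A j \<and> interp (t i) p \<notin> A j}"
        let ?E = "{p \<in> space C. interp (s i) p \<in> (\<Union>i. A i) - A' m}"
        have E: "?E \<in> sets C"
          using change_sets(1)[of "(\<Union>i. A i) - A' m" "(\<Union>i. A i) - A' m" "s i" "s i"] UAs A' by simp
        have D: "?D j \<in> sets C" for j using change_sets(2)[OF A A] .
        have "change (\<Union>i. A i) (s i) (t i) \<le> measure C (?E \<union> (\<Union>j<m. ?D j))"
          unfolding change_def using E D
          by (intro C.finite_measure_mono) (auto simp: A'_def)
        also have "\<dots> \<le> measure C ?E + measure C (\<Union>j<m. ?D j)"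
          using E D by (intro measure_subadditive) (auto simp: C.emeasure_finite)
        also have "measure C ?E = measure B ((\<Union>i. A i) - A' m)"
          using UAs A' by (intro measure_interp) auto
        also have "measure C (\<Union>j<m. ?D j) \<le> (\<Sum>j<m. measure C (?D j))"
          using D by (intro measure_subadditive_finite) (auto simp: C.emeasure_finite)
        also have "\<dots> = (\<Sum>j<m. change (A j) (s i) (t i))" by (simp add: change_def)
        finally have "change (\<Union>i. A i) (s i) (t i) < e" using m elim by simp
        then show ?case by (simp add: change_def)
      qed
    qed
  qed
qed

text \<open>Cover the circle by finitely many small discs. If the values of \<open>\<phi>\<close> at the two times are not close,
  then the deformation has left the preimage of one of these discs.\<close>

lemma twist_tendsto:
  fixes s t :: "'i \<Rightarrow> real"
  assumes \<phi>: "\<phi> \<in> borel_measurable B" "\<And>b. cmod (\<phi> b) = 1"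
    and st: "eventually (\<lambda>i. 0 \<le> s i \<and> s i \<le> t i \<and> t i \<le> 1) F"
    and lim: "((\<lambda>i. t i - s i) \<longlongrightarrow> 0) F"
  shows "((\<lambda>i. l2_sq C (\<lambda>p. \<phi> (interp (s i) p) * cnj (\<phi> (interp (t i) p)) - 1)) \<longlongrightarrow> 0) F"
proof (rule tendstoI)
  fix e :: real assume e: "e > 0"
  define d where "d = sqrt (e / 2)"
  have d: "d > 0" "d\<^sup>2 = e / 2" using e by (auto simp: d_def)
  obtain K where K: "finite K" "sphere (0::complex) 1 \<subseteq> (\<Union>c\<in>K. ball c (d / 2))"
    using compact_eq_totally_bounded[of "sphere (0::complex) 1"] d(1) compact_sphere
    by (metis half_gt_zero)
  define A where "A c = \<phi> -` ball c (d / 2) \<inter> space B" for c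
  have A: "A c \<in> sets B" for c using \<phi>(1) by (auto simp: A_def intro: measurable_sets)
  have "((\<lambda>i. 4 * (\<Sum>c\<in>K. change (A c) (s i) (t i))) \<longlongrightarrow> 4 * (\<Sum>c\<in>K. 0)) F"
    using A st lim by (intro tendsto_mult tendsto_const tendsto_sum change_tendsto)
  then have "eventually (\<lambda>i. 4 * (\<Sum>c\<in>K. change (A c) (s i) (t i)) < e / 2) F"
    using e by (intro order_tendstoD(2)[of _ 0]) auto
  then show "eventually (\<lambda>i. dist (l2_sq C (\<lambda>p. \<phi> (interp (s i) p) * cnj (\<phi> (interp (t i) p)) - 1)) 0 < e) F"
  proof eventually_elim
    case (elim i)
    let ?a = "\<lambda>p. \<phi> (interp (s i) p)" and ?b = "\<lambda>p. \<phi> (interp (t i) p)"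
    let ?D = "\<lambda>c. {p \<in> space C. interp (s i) p \<in> A c \<and> interp (t i) p \<notin> A c}"
    note [measurable] = measurable_compose[OF interp_measurable \<phi>(1)]
    have D [measurable]: "?D c \<in> sets C" for c using change_sets(2)[OF A A] .
    have eq: "cmod (?a p * cnj (?b p) - 1) = dist (?a p) (?b p)" for p
    proof -
      have "?a p * cnj (?b p) - 1 = (?a p - ?b p) * cnj (?b p)"
        using complex_norm_square[of "?b p"] by (simp add: \<phi>(2) algebra_simps)
      then show ?thesis by (simp add: norm_mult \<phi>(2) dist_norm)
    qed
    have le2: "dist (?a p) (?b p) \<le> 2" for p
      using norm_triangle_ineq4[of "?a p" "?b p"] by (simp add: dist_norm \<phi>(2))
    have bound: "(cmod (?a p * cnj (?b p) - 1))\<^sup>2 \<le> d\<^sup>2 + 4 * (\<Sum>c\<in>K. indicator (?D c) p)"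
      if p: "p \<in> space C" for p
    proof (cases "dist (?a p) (?b p) < d")
      case True
      then have "(dist (?a p) (?b p))\<^sup>2 \<le> d\<^sup>2" by (intro power_mono) auto
      moreover have "0 \<le> (\<Sum>c\<in>K. indicator (?D c) p :: real)" by (intro sum_nonneg) auto
      ultimately show ?thesis by (simp add: eq)
    next
      case False
      have "?a p \<in> sphere 0 1" by (simp add: \<phi>(2))
      then obtain c where c: "c \<in> K" "?a p \<in> ball c (d / 2)" using K(2) by blast
      have "?b p \<notin> ball c (d / 2)"
      proof
        assume "?b p \<in> ball c (d / 2)"
        then have "dist (?a p) (?b p) < d / 2 + d / 2"
          using c dist_triangle2[of "?a p" "?b p" c] by (simp add: dist_commute)
        then show False using False by simp
      qed
      then have "p \<in> ?D c"
        using c p measurable_space[OF interp_measurable p] by (auto simp: A_def)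
      then have "1 \<le> (\<Sum>c\<in>K. indicator (?D c) p :: real)"
        using member_le_sum[OF c(1), of "\<lambda>c. indicator (?D c) p :: real"] K(1) by simp
      moreover have "(dist (?a p) (?b p))\<^sup>2 \<le> 4" using power_mono[OF le2[of p], of 2] by simp
      moreover have "0 \<le> d\<^sup>2" by simp
      ultimately show ?thesis unfolding eq by linarith
    qed
    have "l2_sq C (\<lambda>p. ?a p * cnj (?b p) - 1) \<le> (LINT p|C. d\<^sup>2 + 4 * (\<Sum>c\<in>K. indicator (?D c) p))"
      unfolding l2_sq_def
    proof (rule integral_mono)
      show "integrable C (\<lambda>p. (cmod (?a p * cnj (?b p) - 1))\<^sup>2)"
      proof (rule C.integrable_const_bound)
        show "AE p in C. norm ((cmod (?a p * cnj (?b p) - 1))\<^sup>2) \<le> 2\<^sup>2"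
          using power_mono[OF le2, of _ 2] by (intro AE_I2) (simp add: eq)
      qed measurable
      show "integrable C (\<lambda>p. d\<^sup>2 + 4 * (\<Sum>c\<in>K. indicator (?D c) p))"
        using D by (auto intro!: integrable_real_indicator simp: C.emeasure_finite less_top[symmetric])
    qed (use bound in auto)
    also have "\<dots> = d\<^sup>2 + 4 * (\<Sum>c\<in>K. change (A c) (s i) (t i))"
      using D by (simp add: change_def C.prob_space integrable_real_indicator C.emeasure_finite less_top[symmetric])
    also have "\<dots> < e" using elim d(2) by simp
    finally show ?case by (simp add: l2_sq_nonneg)
  qed
qed

end

section \<open>Rigidity of cocycles over Bernoulli shifts\<close>

lemma prod_telescope_unit:
  fixes a :: "nat \<Rightarrow> complex"
  assumes "\<And>k. cmod (a k) = 1"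
  shows "(\<Prod>k<n. a k * cnj (a (Suc k))) = a 0 * cnj (a n)"
proof (induction n)
  case 0
  show ?case using complex_norm_square[of "a 0"] by (simp add: assms)
next
  case (Suc n)
  have "cnj (a n) * a n = 1"
    using complex_norm_square[of "a n"] by (simp add: assms mult.commute)
  moreover have "(\<Prod>k<Suc n. a k * cnj (a (Suc k))) = a 0 * (cnj (a n) * a n) * cnj (a (Suc n))"
    by (simp add: Suc mult.assoc)
  ultimately show ?case by simp
qed

context bernoulli_deformation
begin

lemma shift_B_preserves: "h \<in> carrier G \<Longrightarrow> preserves B B (right_shift G h)"
  unfolding bernoulli_space_def by (intro right_shift_preserves N.prob_space_axioms is_group)

lemma shift_R_preserves: "h \<in> carrier G \<Longrightarrow> preserves (torus_measure G) (torus_measure G) (right_shift G h)"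
  by (intro right_shift_preserves prob_space_unit_circle_measure is_group)

lemma shiftC_preserves: "h \<in> carrier G \<Longrightarrow> preserves C C (shiftC h)"
  by (intro preserves_map_prod shift_B_preserves shift_R_preserves B.prob_space_axioms R.prob_space_axioms)

lemma shiftC_mixing:
  assumes "infinite (carrier G)"
  shows "mixing G C shiftC"
proof -
  have "mixing G B (right_shift G)"
    unfolding bernoulli_space_def using assms by (intro right_shift_mixing N.prob_space_axioms is_group)
  moreover have "mixing G (torus_measure G) (right_shift G)"
    using assms by (intro right_shift_mixing prob_space_unit_circle_measure is_group)
  ultimately show ?thesis
    using assms
    by (intro mixing_pair BB.prob_space_axioms B.prob_space_axioms R.prob_space_axioms
        preserves_map_prod shift_B_preserves shift_R_preserves)
qed

lemma right_shift_mult: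
  assumes "g \<in> carrier G" "h \<in> carrier G"
  shows "right_shift G (g \<otimes>\<^bsub>G\<^esub> h) x = right_shift G g (right_shift G h x)"
  using assms by (auto simp: right_shift_def m_assoc intro!: restrict_ext)

lemma right_shift_one: "x \<in> extensional (carrier G) \<Longrightarrow> right_shift G \<one>\<^bsub>G\<^esub> x = x"
  by (auto simp: right_shift_def fun_eq_iff extensional_def)

text \<open>The difference, in multiplicative notation, of the two lifts of a cocycle to independent points is a
  coboundary on the space of the deformation.\<close>

lemma cocycle_difference_coboundary:
  fixes \<phi> :: "'g \<Rightarrow> ('g \<Rightarrow> 'a) \<Rightarrow> complex"
  assumes inf: "infinite (carrier G)" and cnt: "countable (carrier G)" and T: "property_T G"
    and meas: "\<And>g. g \<in> carrier G \<Longrightarrow> \<phi> g \<in> borel_measurable B"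
    and norm: "\<And>g b. cmod (\<phi> g b) = 1"
    and cocycle: "\<And>g h. g \<in> carrier G \<Longrightarrow> h \<in> carrier G \<Longrightarrow>
      AE b in B. \<phi> (g \<otimes>\<^bsub>G\<^esub> h) b = \<phi> g (right_shift G h b) * \<phi> h b"
  obtains \<Xi> where "\<Xi> \<in> borel_measurable C" "AE p in C. \<Xi> p \<noteq> 0"
    "\<And>g. g \<in> carrier G \<Longrightarrow>
      AE p in C. \<Xi> (shiftC g p) = \<phi> g (fst (fst p)) * cnj (\<phi> g (snd (fst p))) * \<Xi> p"
proof -
  obtain Q \<epsilon> where Q: "finite Q" "Q \<subseteq> carrier G" "(0::real) < \<epsilon>"
    and inv: "\<And>(M :: ((('g \<Rightarrow> 'a) \<times> ('g \<Rightarrow> 'a)) \<times> ('g \<Rightarrow> real)) measure) T w. twisted_action G M T w \<Longrightarrow>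
      (\<And>q. q \<in> Q \<Longrightarrow> l2_sq M (\<lambda>x. w q x - 1) < \<epsilon>) \<Longrightarrow>
      \<exists>f\<in>L2 M. \<not> (AE x in M. f x = 0) \<and> (\<forall>g\<in>carrier G. AE x in M. f (T g x) = w g x * f x)"
    using property_T_twisted[OF T is_group] by blast
  define w where "w s t g p = \<phi> g (interp s p) * cnj (\<phi> g (interp t p))" for s t g p
  have interp_comp: "(\<lambda>p. \<phi> g (interp s p)) \<in> borel_measurable C" if "g \<in> carrier G" for g s
    using measurable_compose[OF interp_measurable meas[OF that]] .
  have tw: "twisted_action G C shiftC (w s t)" for s t
  proof
    show "countable (carrier G)" by (rule cnt)
    show "preserves C C (shiftC g)" if "g \<in> carrier G" for g
      using that by (rule shiftC_preserves)
    show "shiftC (g \<otimes>\<^bsub>G\<^esub> h) x = shiftC g (shiftC h x)" if "g \<in> carrier G" "h \<in> carrier G" for g h x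
      by (cases x) (auto simp: right_shift_mult[OF that])
    show "shiftC \<one>\<^bsub>G\<^esub> x = x" if "x \<in> space C" for x
    proof -
      have "snd x \<in> extensional (carrier G)"
        using that by (simp add: space_pair_measure space_PiM PiE_def mem_Times_iff)
      then show ?thesis
        using space_C_extensional[OF that] by (simp add: right_shift_one map_prod_def case_prod_unfold)
    qed
    show "w s t g \<in> borel_measurable C" if "g \<in> carrier G" for g
      using interp_comp[OF that] unfolding w_def by measurable
    show "cmod (w s t g x) = 1" for g x by (simp add: w_def norm_mult norm)
    show "AE p in C. w s t (g \<otimes>\<^bsub>G\<^esub> h) p = w s t g (shiftC h p) * w s t h p"
      if "g \<in> carrier G" "h \<in> carrier G" for g h
      using preserves_AE[OF interp_preserves cocycle[OF that], of s]
        preserves_AE[OF interp_preserves cocycle[OF that], of t]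
      by eventually_elim (simp add: w_def interp_shift[OF that(2)])
  qed
  \<comment> \<open>A pair \<open>(n, k)\<close> stands for the \<open>k\<close>-th interval of the partition of \<open>[0, 1]\<close> into \<open>n\<close> parts.\<close>
  define F where "F = inf (filtercomap fst sequentially) (principal {(n, k). k < (n::nat)})"
  have evF: "eventually P F \<longleftrightarrow> (\<exists>N. \<forall>n\<ge>N. \<forall>k<n. P (n, k))" for P
  proof
    assume "eventually P F"
    then obtain Q where "eventually Q sequentially" "\<And>x. Q (fst x) \<Longrightarrow> x \<in> {(n, k). k < n} \<Longrightarrow> P x"
      unfolding F_def eventually_inf_principal eventually_filtercomap by blast
    then show "\<exists>N. \<forall>n\<ge>N. \<forall>k<n. P (n, k)"
      unfolding eventually_sequentially by (metis case_prodI fst_conv mem_Collect_eq)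
  next
    assume "\<exists>N. \<forall>n\<ge>N. \<forall>k<n. P (n, k)"
    then obtain N where N: "\<And>n k. n \<ge> N \<Longrightarrow> k < n \<Longrightarrow> P (n, k)" by blast
    have "eventually (\<lambda>x. fst x \<ge> N) (filtercomap fst sequentially :: (nat \<times> nat) filter)"
      by (intro eventually_filtercomapI eventually_ge_at_top)
    then show "eventually P F"
      unfolding F_def eventually_inf_principal
      by eventually_elim (use N in auto)
  qed
  have "((\<lambda>(n, k). l2_sq C (\<lambda>p. w (real k / real n) (real (Suc k) / real n) q p - 1)) \<longlongrightarrow> 0) F"
    if "q \<in> Q" for q
    unfolding w_def case_prod_unfold
  proof (rule twist_tendsto)
    have q: "q \<in> carrier G" using that Q by auto
    show "\<phi> q \<in> borel_measurable B" "\<And>b. cmod (\<phi> q b) = 1" using meas[OF q] norm by auto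
    show "\<forall>\<^sub>F i in F. 0 \<le> real (snd i) / real (fst i) \<and>
        real (snd i) / real (fst i) \<le> real (Suc (snd i)) / real (fst i) \<and> real (Suc (snd i)) / real (fst i) \<le> 1"
      unfolding evF by (intro exI[of _ 1]) (auto simp: divide_right_mono)
    have "filterlim fst sequentially F"
      unfolding F_def by (rule filterlim_mono[OF filterlim_filtercomap order_refl inf_le1])
    then have "((\<lambda>i. inverse (real (fst i))) \<longlongrightarrow> 0) F"
      using filterlim_compose[OF lim_inverse_n] by blast
    then show "((\<lambda>i. real (Suc (snd i)) / real (fst i) - real (snd i) / real (fst i)) \<longlongrightarrow> 0) F"
      by (simp add: diff_divide_distrib[symmetric] inverse_eq_divide)
  qed
  then have "eventually (\<lambda>(n, k). l2_sq C (\<lambda>p. w (real k / real n) (real (Suc k) / real n) q p - 1) < \<epsilon>) F"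
    if "q \<in> Q" for q
    using order_tendstoD(2)[OF _ Q(3)] that by (fastforce simp: case_prod_unfold)
  then have "eventually (\<lambda>i. \<forall>q\<in>Q. l2_sq C (\<lambda>p. w (real (snd i) / real (fst i)) (real (Suc (snd i)) / real (fst i)) q p - 1) < \<epsilon>) F"
    using Q(1) by (simp add: eventually_ball_finite_distrib case_prod_unfold)
  then obtain N0 where N0: "\<And>n k q. n \<ge> N0 \<Longrightarrow> k < n \<Longrightarrow> q \<in> Q \<Longrightarrow>
      l2_sq C (\<lambda>p. w (real k / real n) (real (Suc k) / real n) q p - 1) < \<epsilon>"
    unfolding evF by auto
  define n where "n = Suc N0"
  define a where "a k = real k / real n" for k
  define inv_fun where "inv_fun k f \<longleftrightarrow> f \<in> L2 C \<and> \<not> (AE x in C. f x = 0) \<and>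
      (\<forall>g\<in>carrier G. AE x in C. f (shiftC g x) = w (a k) (a (Suc k)) g x * f x)" for k f
  have "\<exists>f. inv_fun k f" if k: "k < n" for k
  proof -
    have "l2_sq C (\<lambda>p. w (a k) (a (Suc k)) q p - 1) < \<epsilon>" if "q \<in> Q" for q
      unfolding a_def using k that by (intro N0) (simp_all add: n_def)
    from inv[OF tw this] show ?thesis unfolding inv_fun_def by blast
  qed
  then have "\<forall>k\<in>{..<n}. \<exists>f. inv_fun k f" by simp
  then obtain \<xi> where "\<forall>k\<in>{..<n}. inv_fun k (\<xi> k)" by (rule bchoice[THEN exE])
  then have \<xi>: "\<And>k. k < n \<Longrightarrow> \<xi> k \<in> L2 C" "\<And>k. k < n \<Longrightarrow> \<not> (AE x in C. \<xi> k x = 0)"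
    "\<And>k g. k < n \<Longrightarrow> g \<in> carrier G \<Longrightarrow> AE x in C. \<xi> k (shiftC g x) = w (a k) (a (Suc k)) g x * \<xi> k x"
    by (simp_all add: inv_fun_def)
  have \<xi>_meas: "\<xi> k \<in> borel_measurable C" if "k < n" for k using \<xi>(1)[OF that] by (rule L2_measurable)
  \<comment> \<open>The set where the function does not vanish is invariant, since the cocycle does not vanish.\<close>
  have nz: "AE p in C. \<xi> k p \<noteq> 0" if k: "k < n" for k
  proof -
    let ?A = "{p \<in> space C. \<xi> k p \<noteq> 0}"
    have A: "?A \<in> sets C" using \<xi>_meas[OF k] by measurable
    have "measure C ?A = 0 \<or> measure C ?A = 1"
    proof (rule mixing_zero_one[OF inf shiftC_mixing[OF inf] A _ shiftC_preserves])
      fix g assume g: "g \<in> carrier G"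
      have "\<phi> g b \<noteq> 0" for b using norm[of g b] by auto
      then have wnz: "w s t g x \<noteq> 0" for s t x by (simp add: w_def)
      show "AE x in C. (shiftC g x \<in> ?A) = (x \<in> ?A)"
        using \<xi>(3)[OF k g] AE_space
      proof eventually_elim
        case (elim x)
        then show ?case using preservesD(3)[OF shiftC_preserves[OF g] elim(2)] wnz by simp
      qed
    qed
    moreover have "measure C ?A \<noteq> 0"
    proof
      assume "measure C ?A = 0"
      then have "?A \<in> null_sets C" using A by (intro null_setsI) (simp_all add: C.emeasure_eq_measure)
      then have "AE p in C. p \<notin> ?A" by (rule AE_not_in)
      then have "AE p in C. \<xi> k p = 0" using AE_space by eventually_elim simp
      then show False using \<xi>(2)[OF k] by simp
    qed
    ultimately have "AE p in C. p \<in> ?A" using C.AE_in_set_eq_1[OF A] by blast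
    then show ?thesis by eventually_elim simp
  qed
  define \<Xi> where "\<Xi> p = (\<Prod>k<n. \<xi> k p)" for p
  show thesis
  proof (rule that)
    show "\<Xi> \<in> borel_measurable C"
      unfolding \<Xi>_def[abs_def] using \<xi>_meas by (intro borel_measurable_prod) auto
    have "AE p in C. \<forall>k\<in>{..<n}. \<xi> k p \<noteq> 0" using nz by (intro AE_finite_allI) auto
    then show "AE p in C. \<Xi> p \<noteq> 0" by eventually_elim (auto simp: \<Xi>_def)
    fix g assume g: "g \<in> carrier G"
    have "AE p in C. \<forall>k\<in>{..<n}. \<xi> k (shiftC g p) = w (a k) (a (Suc k)) g p * \<xi> k p"
      using \<xi>(3) g by (intro AE_finite_allI) auto
    then show "AE p in C. \<Xi> (shiftC g p) = \<phi> g (fst (fst p)) * cnj (\<phi> g (snd (fst p))) * \<Xi> p"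
      using AE_space
    proof eventually_elim
      case (elim p)
      have "\<Xi> (shiftC g p) = (\<Prod>k<n. w (a k) (a (Suc k)) g p * \<xi> k p)"
        unfolding \<Xi>_def using elim(1) by (intro prod.cong) auto
      also have "\<dots> = (\<Prod>k<n. w (a k) (a (Suc k)) g p) * \<Xi> p"
        by (simp add: prod.distrib \<Xi>_def)
      also have "(\<Prod>k<n. w (a k) (a (Suc k)) g p) = \<phi> g (interp (a 0) p) * cnj (\<phi> g (interp (a n) p))"
        unfolding w_def using norm by (rule prod_telescope_unit)
      also have "\<dots> = \<phi> g (fst (fst p)) * cnj (\<phi> g (snd (fst p)))"
        using interp_0[OF elim(2)] interp_1[OF elim(2)] by (simp add: a_def n_def)
      finally show ?case .
    qed
  qed
qed

end

section \<open>The obstruction\<close>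

lemma system_iso_inverse:
  assumes iso: "system_iso G M T N S \<Phi>"
    and T: "\<And>g. g \<in> carrier G \<Longrightarrow> preserves M M (T g)"
  obtains \<Phi>' where "preserves N M \<Phi>'" "AE y in N. \<Phi> (\<Phi>' y) = y"
    "\<And>g. g \<in> carrier G \<Longrightarrow> AE y in N. \<Phi>' (S g y) = T g (\<Phi>' y)"
proof -
  have \<Phi>: "preserves M N \<Phi>" and eq: "\<And>g. g \<in> carrier G \<Longrightarrow> AE x in M. \<Phi> (T g x) = S g (\<Phi> x)"
    using iso unfolding system_iso_def factor_map_def preserves_def by blast+
  obtain \<Phi>' where \<Phi>': "\<Phi>' \<in> N \<rightarrow>\<^sub>M M" "AE x in M. \<Phi>' (\<Phi> x) = x" "AE y in N. \<Phi> (\<Phi>' y) = y"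
    using iso unfolding system_iso_def by blast
  have "distr N M \<Phi>' = distr M M (\<Phi>' \<circ> \<Phi>)"
    using distr_distr[OF \<Phi>'(1) preservesD(1)[OF \<Phi>]] preservesD(2)[OF \<Phi>] by simp
  also have "\<dots> = distr M M (\<lambda>x. x)"
    using \<Phi>'(1,2) preservesD(1)[OF \<Phi>] by (intro distr_cong_AE) (auto simp: comp_def)
  finally have pres: "preserves N M \<Phi>'" using \<Phi>'(1) by (simp add: preserves_def distr_id2)
  show thesis
  proof (rule that[OF pres \<Phi>'(3)])
    fix g assume g: "g \<in> carrier G"
    have "AE x in M. \<Phi>' (S g (\<Phi> x)) = T g x"
      using eq[OF g] preserves_AE[OF T[OF g] \<Phi>'(2)] by eventually_elim simp
    from preserves_AE[OF pres this] \<Phi>'(3)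
    show "AE y in N. \<Phi>' (S g y) = T g (\<Phi>' y)" by eventually_elim simp
  qed
qed

text \<open>Choose a half-plane, with one bounding ray, that contains exactly one of \<open>z\<close> and \<open>-z\<close> for each
  nonzero \<open>z\<close>. Its preimage under \<open>F\<close> is invariant, and its preimage under \<open>F \<circ> \<rho>\<close> is the
  complement up to null sets, so both have measure 1/2.\<close>

lemma no_odd_invariant_function:
  fixes F :: "'x \<Rightarrow> complex"
  assumes inf: "infinite (carrier G)" and M: "prob_space M" and mix: "mixing G M T"
    and T: "\<And>g. g \<in> carrier G \<Longrightarrow> preserves M M (T g)"
    and \<rho>: "preserves M M \<rho>"
    and F: "F \<in> borel_measurable M" "AE x in M. F x \<noteq> 0"
    and inv: "\<And>g. g \<in> carrier G \<Longrightarrow> AE x in M. F (T g x) = F x"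
    and odd: "AE x in M. F (\<rho> x) = - F x"
  shows False
proof -
  interpret prob_space M by fact
  define pos where "pos z \<longleftrightarrow> Re z > 0 \<or> Re z = 0 \<and> Im z > 0" for z
  have pos_minus: "pos (- z) \<longleftrightarrow> \<not> pos z" if "z \<noteq> 0" for z
    using that by (auto simp: pos_def complex_eq_iff)
  let ?A = "{x \<in> space M. pos (F x)}"
  have A: "?A \<in> sets M" using F(1) unfolding pos_def by measurable
  have contra: "\<not> (AE x in M. pos (F x) = b)" for b
  proof
    assume *: "AE x in M. pos (F x) = b"
    have "AE x in M. False"
      using * preserves_AE[OF \<rho> *] odd F(2) by eventually_elim (use pos_minus in auto)
    then show False by simp
  qed
  have "measure M ?A = 0 \<or> measure M ?A = 1"
  proof (rule mixing_zero_one[OF inf mix A _ T])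
    fix g assume g: "g \<in> carrier G"
    show "AE x in M. (T g x \<in> ?A) = (x \<in> ?A)"
      using inv[OF g] AE_space by eventually_elim (simp add: preservesD(3)[OF T[OF g]])
  qed
  then show False
  proof
    assume "measure M ?A = 0"
    then have "?A \<in> null_sets M" using A by (intro null_setsI) (simp_all add: emeasure_eq_measure)
    then have "AE x in M. x \<notin> ?A" by (rule AE_not_in)
    then have "AE x in M. pos (F x) = False" using AE_space by eventually_elim simp
    then show False using contra by blast
  next
    assume "measure M ?A = 1"
    then have "AE x in M. x \<in> ?A" using AE_in_set_eq_1[OF A] by blast
    then have "AE x in M. pos (F x) = True" by eventually_elim simp
    then show False using contra by blast
  qed
qed

theorem mainTheorem6:
  fixes G :: "('g, 'm) monoid_scheme"
    and \<mu> :: "('g \<Rightarrow> real set) set measure"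
    and N :: "'a measure"
  assumes "group G"
    and "infinite (carrier G)"
    and "countable (carrier G)"
    and "residually_finite G"
    and "property_T G"
    and "haar_prob_measure (torus_quotient_group G) (torus_quotient_topology G) \<mu>"
    and "standard_prob_space N"
  shows "\<not> complemented_factor TYPE('z) G \<mu> (torus_quotient_shift G)
            (bernoulli_space G N) (right_shift G)"
proof
  note inf = assms(2) and \<mu> = assms(6)
  assume "complemented_factor TYPE('z) G \<mu> (torus_quotient_shift G) (bernoulli_space G N) (right_shift G)"
  then obtain \<Phi> R \<Psi> and Z :: "'z measure"
    where \<Phi>: "factor_map G (bernoulli_space G N) (right_shift G) \<mu> (torus_quotient_shift G) \<Phi>"
      and Z: "G_system G Z R"
      and \<Psi>: "factor_map G (bernoulli_space G N) (right_shift G) Z R \<Psi>"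
      and iso: "system_iso G (bernoulli_space G N) (right_shift G) (\<mu> \<Otimes>\<^sub>M Z)
        (\<lambda>g. map_prod (torus_quotient_shift G g) (R g)) (\<lambda>x. (\<Phi> x, \<Psi> x))"
    unfolding complemented_factor_def complemented_factor_map_def by blast
  interpret group G by fact
  interpret N: prob_space N using assms(7) by (simp add: standard_prob_space_def)
  interpret bernoulli_deformation G N ..
  let ?TR = "torus_measure G" and ?s = "right_shift G"
  interpret mu: prob_space \<mu> using \<mu> by (simp add: haar_prob_measure_def)
  interpret Z: prob_space Z using Z by (simp add: G_system_def standard_prob_space_def)
  have space_\<mu>: "space \<mu> = carrier (torus_quotient_group G)" using \<mu> by (simp add: haar_prob_measure_def)
  have R_pres: "preserves Z Z (R g)" if "g \<in> carrier G" for g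
    using Z that by (simp add: G_system_def preserves_def)
  have \<Phi>_pres: "preserves B \<mu> \<Phi>"
    and \<Phi>_eq: "\<And>g. g \<in> carrier G \<Longrightarrow> AE b in B. \<Phi> (?s g b) = torus_quotient_shift G g (\<Phi> b)"
    using \<Phi> unfolding factor_map_def preserves_def by blast+
  obtain \<Theta> where \<Theta>: "preserves (\<mu> \<Otimes>\<^sub>M Z) B \<Theta>" "AE y in \<mu> \<Otimes>\<^sub>M Z. (\<Phi> (\<Theta> y), \<Psi> (\<Theta> y)) = y"
    and \<Theta>_eq: "\<And>g. g \<in> carrier G \<Longrightarrow>
      AE y in \<mu> \<Otimes>\<^sub>M Z. \<Theta> (map_prod (torus_quotient_shift G g) (R g) y) = ?s g (\<Theta> y)"
    using system_iso_inverse[OF iso shift_B_preserves] by blast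

  define \<phi> where "\<phi> g b = lift_cocycle G g (\<Phi> b)" for g b
  obtain \<Xi> where \<Xi>_meas: "\<Xi> \<in> borel_measurable C" and \<Xi>_nz: "AE p in C. \<Xi> p \<noteq> 0"
    and \<Xi>_eq: "\<And>g. g \<in> carrier G \<Longrightarrow>
      AE p in C. \<Xi> (shiftC g p) = \<phi> g (fst (fst p)) * cnj (\<phi> g (snd (fst p))) * \<Xi> p"
  proof (rule cocycle_difference_coboundary[OF assms(2,3,5), of \<phi>])
    show "\<phi> g \<in> borel_measurable B" if "g \<in> carrier G" for g
      unfolding \<phi>_def
      using measurable_compose[OF preservesD(1)[OF \<Phi>_pres] lift_cocycle_measurable[OF \<mu> is_group that]] .
    show "cmod (\<phi> g b) = 1" for g b by (simp add: \<phi>_def)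
    show "AE b in B. \<phi> (g \<otimes>\<^bsub>G\<^esub> h) b = \<phi> g (?s h b) * \<phi> h b" if "g \<in> carrier G" "h \<in> carrier G" for g h
      using \<Phi>_eq[OF that(2)] AE_space
    proof eventually_elim
      case (elim b)
      then have "\<Phi> b \<in> carrier (torus_quotient_group G)" using preservesD(3)[OF \<Phi>_pres] by (simp add: space_\<mu>)
      then show ?case using lift_cocycle_mult[OF is_group that] elim by (simp add: \<phi>_def)
    qed
  qed blast

  have B_mix: "mixing G B ?s"
    unfolding bernoulli_space_def using inf by (intro right_shift_mixing N.prob_space_axioms is_group)
  have Z_mix: "mixing G Z R"
  proof (rule mixing_factor[OF B_mix])
    show "preserves B Z \<Psi>" using \<Psi> by (simp add: factor_map_def preserves_def)
    show "AE b in B. \<Psi> (?s g b) = R g (\<Psi> b)" if "g \<in> carrier G" for g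
      using \<Psi> that by (simp add: factor_map_def)
  qed (rule shift_B_preserves R_pres, assumption)+
  let ?Y = "?TR \<Otimes>\<^sub>M Z" and ?sY = "\<lambda>g. map_prod (?s g) (R g)"
  interpret Y: pair_prob_space ?TR Z ..
  have Y_pres: "preserves ?Y ?Y (?sY g)" if "g \<in> carrier G" for g
    using that by (intro preserves_map_prod shift_R_preserves R_pres Z.prob_space_axioms)
  have TR_mix: "mixing G ?TR ?s"
    using inf by (intro right_shift_mixing prob_space_unit_circle_measure is_group)
  have Y_mix: "mixing G ?Y ?sY"
    using inf by (intro mixing_pair TR_mix Z_mix shift_R_preserves R_pres R.prob_space_axioms Z.prob_space_axioms)
  interpret YY: pair_prob_space ?Y ?Y ..
  let ?D = "(?Y \<Otimes>\<^sub>M ?Y) \<Otimes>\<^sub>M ?TR" and ?sD = "\<lambda>g. map_prod (map_prod (?sY g) (?sY g)) (?s g)"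
  interpret D: pair_prob_space "?Y \<Otimes>\<^sub>M ?Y" ?TR ..
  have D_pres: "preserves ?D ?D (?sD g)" if "g \<in> carrier G" for g
    using that by (intro preserves_map_prod Y_pres shift_R_preserves Y.prob_space_axioms R.prob_space_axioms)
  have D_mix: "mixing G ?D ?sD"
    using inf by (intro mixing_pair Y_mix TR_mix preserves_map_prod Y_pres shift_R_preserves
        Y.prob_space_axioms YY.prob_space_axioms R.prob_space_axioms)

  \<comment> \<open>From \<open>(r, z)\<close> to the point of the Bernoulli shift that corresponds to \<open>([r], z)\<close>.\<close>
  define \<tau> where "\<tau> y = \<Theta> (map_prod (torus_lift G) (\<lambda>z. z) y)" for y
  have lift_pres: "preserves ?Y (\<mu> \<Otimes>\<^sub>M Z) (map_prod (torus_lift G) (\<lambda>z. z))"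
    by (intro preserves_map_prod torus_lift_preserves \<mu> is_group assms(3) preserves_id Z.prob_space_axioms)
  have \<tau>_pres: "preserves ?Y B \<tau>"
    unfolding \<tau>_def using lift_pres \<Theta>(1) by (rule preserves_comp)
  have \<tau>_eq: "AE y in ?Y. \<tau> (?sY g y) = ?s g (\<tau> y)" if g: "g \<in> carrier G" for g
    using preserves_AE[OF lift_pres \<Theta>_eq[OF g]]
    by eventually_elim (simp add: \<tau>_def map_prod_def case_prod_unfold torus_shift_lift[OF is_group g])
  have \<phi>_\<tau>: "AE y in ?Y. \<forall>g\<in>carrier G. \<phi> g (\<tau> y) = ee (fst y g - fst y \<one>\<^bsub>G\<^esub>)"
    using preserves_AE[OF lift_pres \<Theta>(2)]
    by eventually_elim (simp add: \<phi>_def \<tau>_def map_prod_def case_prod_unfold lift_cocycle_lift[OF is_group])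

  define q where "q = map_prod (map_prod \<tau> \<tau>) (\<lambda>u :: 'g \<Rightarrow> real. u)"
  have q_pres: "preserves ?D C q"
    unfolding q_def by (intro preserves_map_prod \<tau>_pres preserves_id B.prob_space_axioms R.prob_space_axioms)
  have AE_Y1: "AE d in ?D. P (fst (fst d))" and AE_Y2: "AE d in ?D. P (snd (fst d))" if "AE y in ?Y. P y" for P
  proof -
    note Y = Y.prob_space_axioms and R = preserves_fst[OF R.prob_space_axioms, of "?Y \<Otimes>\<^sub>M ?Y"]
    show "AE d in ?D. P (fst (fst d))"
      by (rule preserves_AE[OF R preserves_AE[OF preserves_fst[OF Y] that]])
    show "AE d in ?D. P (snd (fst d))"
      by (rule preserves_AE[OF R preserves_AE[OF preserves_snd[OF Y Y] that]])
  qed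
  \<comment> \<open>The function that is invariant by the construction of \<open>\<Xi>\<close>, yet odd under the rotation \<open>\<rho>\<close>.\<close>
  define F where "F d = ee (fst (fst (fst d)) \<one>\<^bsub>G\<^esub> - fst (snd (fst d)) \<one>\<^bsub>G\<^esub>) * cnj (\<Xi> (q d))" for d
  define \<rho> where "\<rho> = map_prod (map_prod (map_prod (\<lambda>r. \<lambda>g\<in>carrier G. frac (r g + 1/2 :: real)) (\<lambda>z :: 'z. z))
      (\<lambda>y :: ('g \<Rightarrow> real) \<times> 'z. y)) (\<lambda>u :: 'g \<Rightarrow> real. u)"
  show False
  proof (rule no_odd_invariant_function[OF inf D.prob_space_axioms D_mix D_pres])
    show "preserves ?D ?D \<rho>"
      unfolding \<rho>_def
      by (intro preserves_map_prod preserves_id PiM_map_preserves frac_shift_preserves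
          prob_space_unit_circle_measure Z.prob_space_axioms Y.prob_space_axioms R.prob_space_axioms)
    have coord [measurable]: "(\<lambda>r. r \<one>\<^bsub>G\<^esub>) \<in> borel_measurable ?TR"
      using measurable_component_singleton[OF one_closed, of "\<lambda>_. unit_circle_measure"]
      by (simp add: measurable_cong_sets[OF refl sets_unit_circle_measure])
    have [measurable]: "(\<lambda>d. \<Xi> (q d)) \<in> borel_measurable ?D"
      using measurable_compose[OF preservesD(1)[OF q_pres] \<Xi>_meas] .
    show "F \<in> borel_measurable ?D" unfolding F_def by measurable
    show "AE d in ?D. F d \<noteq> 0"
      using preserves_AE[OF q_pres \<Xi>_nz]
    proof eventually_elim
      case (elim d)
      have "ee x \<noteq> 0" for x using norm_ee[of x] by (metis norm_zero zero_neq_one)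
      then show ?case using elim by (simp add: F_def)
    qed
    show "AE d in ?D. F (\<rho> d) = - F d"
    proof (intro AE_I2)
      fix d
      have half: "torus_lift G (\<lambda>g\<in>carrier G. frac (r g + 1/2)) = torus_lift G r" for r
        by (rule torus_lift_eqI[of _ _ _ "1/2"]) (simp add: frac_def)
      have "ee (frac (a + 1/2) - b) = - ee (a - b)" for a b
      proof -
        have "ee (frac (a + 1/2) - b) = ee (a - b) * ee (1/2)"
          unfolding ee_add[symmetric] ee_eq_iff by (simp add: frac_def)
        also have "ee (1/2) = -1" by (simp add: ee_def)
        finally show ?thesis by simp
      qed
      moreover have "q (\<rho> d) = q d"
        by (simp add: q_def \<rho>_def \<tau>_def map_prod_def case_prod_unfold half)
      ultimately show "F (\<rho> d) = - F d"
        by (simp add: F_def) (simp add: \<rho>_def map_prod_def case_prod_unfold)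
    qed
    fix g assume g: "g \<in> carrier G"
    show "AE d in ?D. F (?sD g d) = F d"
      using AE_Y1[OF \<tau>_eq[OF g]] AE_Y2[OF \<tau>_eq[OF g]] AE_Y1[OF \<phi>_\<tau>] AE_Y2[OF \<phi>_\<tau>]
        preserves_AE[OF q_pres \<Xi>_eq[OF g]]
    proof eventually_elim
      case (elim d)
      obtain yy u where "d = (yy, u)" by (cases d)
      moreover obtain y y' where "yy = (y, y')" by (cases yy)
      moreover obtain r z where "y = (r, z)" by (cases y)
      moreover obtain r' z' where "y' = (r', z')" by (cases y')
      ultimately have d: "d = (((r, z), (r', z')), u)" by simp
      have "q (?sD g d) = shiftC g (q d)"
        using elim(1,2) by (simp add: q_def d)
      then have "\<Xi> (q (?sD g d)) = ee (r g - r \<one>\<^bsub>G\<^esub>) * cnj (ee (r' g - r' \<one>\<^bsub>G\<^esub>)) * \<Xi> (q d)"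
        using elim(3-5) g by (simp add: q_def d)
      then have "F (?sD g d) = ee (r g - r' g) * cnj (ee (r g - r \<one>\<^bsub>G\<^esub>)) * ee (r' g - r' \<one>\<^bsub>G\<^esub>) * cnj (\<Xi> (q d))"
        using g by (simp add: F_def) (simp add: d right_shift_def)
      also have "ee (r g - r' g) * cnj (ee (r g - r \<one>\<^bsub>G\<^esub>)) * ee (r' g - r' \<one>\<^bsub>G\<^esub>) = ee (r \<one>\<^bsub>G\<^esub> - r' \<one>\<^bsub>G\<^esub>)"
        unfolding ee_diff[symmetric] ee_add[symmetric] by simp
      finally show ?case by (simp add: F_def d)
    qed
  qed
qed

end
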